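(* Let $\mathcal{L}$ be the set of all $n\in\mathbb{N}$ for which there exists a non-degenerate integer linear recurrence sequence $\mathbf{u}$ such that $u_n=0$ and $n\ge\exp\exp(10H_{\mathbf{u}}\log H_{\mathbf{u}})$, where $H_{\mathbf{u}}$ is the height of $\mathbf{u}$. Then the set $\mathcal{S}:=\mathbb{N}\setminus\mathcal{L}$ is a Universal Skolem Set of density one.
   Context: Logarithms and exponentials are natural; $\exp\exp(x)=e^{e^x}$. An (integer) linear recurrence sequence (LRS) $\mathbf{u}=\langle u_n\rangle_{n=0}^\infty$ is a sequence of integers satisfying a recurrence of the form $u_{n+k}=a_1u_{n+k-1}+\cdots+a_ku_n$, where the coefficients $a_1,\ldots,a_k$ are integers. An LRS is non-degenerate if in its minimal recurrence no quotient of two distinct roots of the characteristic polynomial is a root of unity; the characteristic polynomial of the recurrence above is $x^k-a_1x^{k-1}-\cdots-a_k$. The height of an LRS $\mathbf{u}$ given by the recurrence above is $H_{\mathbf{u}}:=\max\{k,|a_1|,\ldots,|a_k|,|u_0|,\ldots,|u_{k-1}|\}$. No height restriction is placed on the LRS in the definition of $\mathcal{L}$. An infinite, recursive set $\mathcal{S}\subseteq\mathbb{N}$ is a Universal Skolem Set if there is some algorithm which, given any integer LRS, determines whether or not the LRS has a zero in $\mathcal{S}$, i.e., whether or not there exists $n\in\mathcal{S}$ with $u_n=0$. Density one means $\lim_{X\to\infty}\#(\mathcal{S}\cap[1,X])/X=1$.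
   Formalization: In the definition of L, sequences that are zero from some point on are excluded; otherwise the zero sequence (height 1) is non-degenerate and puts every n ≥ 3 in L, so S would be finite. *)

theory Defs
  imports
    Complex_Main
    "HOL-Computational_Algebra.Polynomial"
    "HOL-Library.Nat_Bijection"
begin

section \<open>Integer linear recurrence sequences\<close>

text \<open>
  A recurrence of order \<open>k \<ge> 1\<close> is the list \<open>[a\<^sub>1, \<dots>, a\<^sub>k]\<close> of its coefficients, so \<open>a ! i\<close> is
  \<open>a\<^sub>i\<^sub>+\<^sub>1\<close>. The last coefficient may be \<open>0\<close>.
\<close>

definition satisfies_recurrence :: "int list \<Rightarrow> (nat \<Rightarrow> int) \<Rightarrow> bool" where
  "satisfies_recurrence a u \<longleftrightarrow>
     a \<noteq> [] \<and>
     (\<forall>n. u (n + length a) = (\<Sum>i<length a. a ! i * u (n + length a - 1 - i)))"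

definition characteristic_poly :: "int list \<Rightarrow> int poly" where
  "characteristic_poly a =
     monom 1 (length a) - (\<Sum>i<length a. monom (a ! i) (length a - 1 - i))"

definition characteristic_roots :: "int list \<Rightarrow> complex set" where
  "characteristic_roots a = {z. poly (map_poly of_int (characteristic_poly a)) z = 0}"

definition minimal_recurrence :: "int list \<Rightarrow> (nat \<Rightarrow> int) \<Rightarrow> bool" where
  "minimal_recurrence a u \<longleftrightarrow>
     satisfies_recurrence a u \<and> (\<forall>b. satisfies_recurrence b u \<longrightarrow> length a \<le> length b)"

text \<open>
  If \<open>0\<close> is a root, the quotients involving it evaluate to \<open>0\<close> (also \<open>x / 0\<close>), which is not a
  root of unity, so they impose no condition.
\<close>

definition non_degenerate :: "(nat \<Rightarrow> int) \<Rightarrow> bool" where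
  "non_degenerate u \<longleftrightarrow>
     (\<exists>a. minimal_recurrence a u \<and>
          (\<forall>x\<in>characteristic_roots a. \<forall>y\<in>characteristic_roots a.
             x \<noteq> y \<longrightarrow> \<not> (\<exists>m::nat. m \<ge> 1 \<and> (x / y) ^ m = 1)))"

text \<open>
  The height belongs to a sequence together with a recurrence defining it, which need not be
  the minimal one.
\<close>

definition height :: "int list \<Rightarrow> (nat \<Rightarrow> int) \<Rightarrow> int" where
  "height a u =
     Max ({int (length a)} \<union> {\<bar>a ! i\<bar> | i. i < length a} \<union> {\<bar>u j\<bar> | j. j < length a})"

text \<open>
  The set \<open>\<L>\<close>. Sequences that vanish from some point on have to be left out: for instance
  \<open>0, 0, 0, \<dots>\<close> and \<open>1, 0, 0, \<dots>\<close> are non-degenerate in the above sense and of height \<open>1\<close>, and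
  each of them would put every \<open>n \<ge> 3\<close> into the set. (The usual conventions that an LRS is not
  identically zero and that \<open>a\<^sub>k \<noteq> 0\<close> have the same effect on such sequences.)
\<close>

definition large_zeros :: "nat set" where
  "large_zeros =
     {n. \<exists>a u. satisfies_recurrence a u \<and> non_degenerate u \<and> infinite {m. u m \<noteq> 0} \<and>
           u n = 0 \<and>
           real n \<ge> exp (exp (10 * real_of_int (height a u) * ln (real_of_int (height a u))))}"


section \<open>Computability\<close>

text \<open>
  Partial recursive functions: \<open>computes p xs y\<close> means that the program \<open>p\<close> halts on the
  arguments \<open>xs\<close> with result \<open>y\<close>. The recursion variable of \<open>PrimRec\<close> and the search variable
  of \<open>Mu\<close> come first in the argument list.
\<close>

datatype program =
    Zero
  | Successor
  | Proj nat
  | Comp program "program list"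
  | PrimRec program program
  | Mu program

inductive computes :: "program \<Rightarrow> nat list \<Rightarrow> nat \<Rightarrow> bool" where
  Zero: "computes Zero xs 0"
| Successor: "computes Successor [x] (Suc x)"
| Proj: "i < length xs \<Longrightarrow> computes (Proj i) xs (xs ! i)"
| Comp: "list_all2 (\<lambda>g y. computes g xs y) gs ys \<Longrightarrow> computes f ys z
           \<Longrightarrow> computes (Comp f gs) xs z"
| PrimRec_0: "computes f xs y \<Longrightarrow> computes (PrimRec f g) (0 # xs) y"
| PrimRec_Suc: "computes (PrimRec f g) (n # xs) y \<Longrightarrow> computes g (n # y # xs) z
           \<Longrightarrow> computes (PrimRec f g) (Suc n # xs) z"
| Mu: "computes f (n # xs) 0 \<Longrightarrow> (\<And>m. m < n \<Longrightarrow> \<exists>y>0. computes f (m # xs) y)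
           \<Longrightarrow> computes (Mu f) xs n"

lemma computes_deterministic:
  "computes p xs y \<Longrightarrow> computes p xs z \<Longrightarrow> y = z"
proof (induction arbitrary: z rule: computes.induct)
  case (Zero xs)
  then show ?case by cases simp
next
  case (Successor x)
  then show ?case by cases simp
next
  case (Proj i xs)
  from Proj.prems show ?case by cases simp
next
  case (Comp xs gs ys f z')
  from Comp.prems obtain ys' where
    ys': "list_all2 (\<lambda>g y. computes g xs y) gs ys'" and f: "computes f ys' z"
    by cases simp
  have "ys = ys'"
    using Comp.IH(1) ys' unfolding list_all2_conv_all_nth
    by (intro nth_equalityI) simp_all
  then show ?case
    using Comp.IH(2) f by blast
next
  case (PrimRec_0 f xs y g)
  from PrimRec_0.prems have "computes f xs z"
    by cases simp
  then show ?case by (rule PrimRec_0.IH)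
next
  case (PrimRec_Suc f g n xs y z')
  from PrimRec_Suc.prems obtain y' where
    "computes (PrimRec f g) (n # xs) y'" and "computes g (n # y' # xs) z"
    by cases simp
  then show ?case
    using PrimRec_Suc.IH by blast
next
  case (Mu f n xs)
  from Mu.prems have z: "computes f (z # xs) 0"
    and below: "\<And>m. m < z \<Longrightarrow> \<exists>y>0. computes f (m # xs) y"
    by (cases, simp)+
  show ?case
  proof (cases n z rule: linorder_cases)
    case less
    then show ?thesis using Mu.IH(1) below by fastforce
  next
    case greater
    then show ?thesis using Mu.IH(2) z by fastforce
  qed
qed

definition recursive_set :: "nat set \<Rightarrow> bool" where
  "recursive_set A \<longleftrightarrow> (\<exists>p. \<forall>n. computes p [n] (of_bool (n \<in> A)))"


section \<open>Universal Skolem sets and density\<close>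

text \<open>
  The input of the decision algorithm is the pair of codes of the coefficient list
  \<open>[a\<^sub>1, \<dots>, a\<^sub>k]\<close> and of the list of initial values \<open>[u 0, \<dots>, u (k - 1)]\<close>.
\<close>

definition encode_ints :: "int list \<Rightarrow> nat" where
  "encode_ints xs = list_encode (map int_encode xs)"

definition universal_skolem_set :: "nat set \<Rightarrow> bool" where
  "universal_skolem_set S \<longleftrightarrow>
     infinite S \<and> recursive_set S \<and>
     (\<exists>p. \<forall>a u. satisfies_recurrence a u \<longrightarrow>
        computes p [encode_ints a, encode_ints (map u [0..<length a])]
          (of_bool (\<exists>n\<in>S. u n = 0)))"

definition density_one :: "nat set \<Rightarrow> bool" where
  "density_one S \<longleftrightarrow> (\<lambda>X. real (card (S \<inter> {1..X})) / real X) \<longlonglongrightarrow> 1"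

end

theory Submission
  imports Defs "Jordan_Normal_Form.Char_Poly" "HOL-Library.Function_Algebras"
begin

text \<open>
  Both halves rest on a \<open>p\<close>-adic argument. Let \<open>p\<close> be a prime not dividing the last coefficient of
  a recurrence. Along a progression modulo a period \<open>N\<close> of the recurrence modulo \<open>p\<^sup>2\<close>, the \<open>j\<close>-th
  differences of a solution are divisible by \<open>p\<^sup>2\<^sup>j\<close>, and by Strassmann's argument \<open>s\<close> zeros on such a
  progression make all values there divisible by \<open>p\<^sup>s\<close>. Hence a solution that does not vanish
  identically on the progression has few zeros there. As \<open>p\<close>, \<open>N\<close> and a nonzero value are bounded in
  terms of the height, the large zeros up to \<open>X\<close> number \<open>O(sqrt X)\<close>.

  A sequence is non-degenerate iff no combination of its shifts vanishes on a progression without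
  vanishing eventually. By the \<open>p\<close>-adic argument the progressions modulo \<open>N\<close> suffice, so that
  non-degeneracy is a question of linear algebra over the rationals, and the set of large zeros is
  recursive.

  For the decision procedure let \<open>u\<close> be any recurrence sequence. If \<open>u\<close> vanishes on a residue class
  modulo \<open>N\<close>, it has a zero outside the large zeros, by density. Otherwise, on each class, some
  non-degenerate \<open>w\<close> is a multiple of \<open>u\<close>, so that the zeros of \<open>u\<close> in the class beyond a bound given
  by the height of \<open>w\<close> are large; such \<open>w\<close> can be found by search. To see that \<open>w\<close> exists, consider
  polynomials in the solutions of the recurrence as functions on the class. Those of the form
  \<open>n \<mapsto> g (N n + r)\<close> are non-degenerate, and in degree at most \<open>M\<close> they span a space of the same
  dimension as all polynomials of degree at most \<open>M\<close>, since \<open>g\<close> is determined by its values on any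
  infinite part of a class. If \<open>u\<close> were transcendental over them, these dimensions would grow faster
  than any polynomial in \<open>M\<close>. The lowest nonzero coefficient of an algebraic equation for \<open>u\<close> is
  then the wanted multiple of \<open>u\<close>.
\<close>

text \<open>Splitting \<open>u\<close> into the subsequences \<open>u (r + N * m)\<close> also leads
  to non-degenerate sequences, but it moves a zero from \<open>n\<close> to \<open>m\<close>,
  whereas a large zero needs a non-degenerate sequence that vanishes at the index \<open>n\<close>
  itself. This is the obstacle for the decision procedure. It is why a multiple \<open>w\<close> of
  \<open>u\<close> on the class is constructed instead: \<open>w n = g (N * n + r)\<close> is
  non-degenerate as a sequence in all \<open>n\<close>, and only its relation to \<open>u\<close> is
  confined to the class.

  No bound for the height of \<open>w\<close> is derived. The search for certificates supplies one,
  and it terminates because some certificate exists.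

  The p-adic analysis is carried out on integer sequences: divisibility of iterated differences
  stands for analyticity, so that no completion and no number field enters. Complex roots occur only
  where non-degeneracy is translated into a statement about integer combinations of shifts.

  The threshold matches the number of zeros: for \<open>h >= 2\<close>, all sequences of height at
  most \<open>h\<close> that are counted have together at most the square root of
  \<open>exp (h ^ (10 * h))\<close> zeros.\<close>

hide_const (open) Module.smult

section \<open>Computable functions\<close>

definition computable1 :: "(nat \<Rightarrow> nat) \<Rightarrow> bool" where
  "computable1 f \<longleftrightarrow> (\<exists>p. \<forall>x. computes p [x] (f x))"

definition computable2 :: "(nat \<Rightarrow> nat \<Rightarrow> nat) \<Rightarrow> bool" where
  "computable2 f \<longleftrightarrow> (\<exists>p. \<forall>x y. computes p [x, y] (f x y))"

section \<open>Programs for arithmetic and for the Cantor pairing\<close>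

lemma computes_Comp1:
  "computes g xs y \<Longrightarrow> computes f [y] z \<Longrightarrow> computes (Comp f [g]) xs z"
  by (rule computes.Comp[of xs "[g]" "[y]"]) auto

lemma computes_Comp2:
  "computes g xs y \<Longrightarrow> computes h xs y' \<Longrightarrow> computes f [y, y'] z \<Longrightarrow>
     computes (Comp f [g, h]) xs z"
  by (rule computes.Comp[of xs "[g, h]" "[y, y']"]) auto

lemma computes_Proj0: "computes (Proj 0) (x # xs) x"
  using computes.Proj[of 0 "x # xs"] by simp

lemma computes_Proj1: "computes (Proj 1) (x # y # xs) y"
  using computes.Proj[of 1 "x # y # xs"] by simp

lemma computes_Proj2: "computes (Proj 2) (x # y # z # xs) z"
  using computes.Proj[of 2 "x # y # z # xs"] by (simp add: numeral_2_eq_2)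

lemmas computes_intros = computes_Comp1 computes_Comp2 computes_Proj0 computes_Proj1
  computes_Proj2 computes.Successor computes.Zero

lemma computable1_rec:
  assumes "\<And>n y. computes s [n, y] (f n y)"
  shows "computable1 (rec_nat 0 f)"
proof -
  have r: "computes (PrimRec Zero (Comp s [Proj 0, Proj 1])) (n # [x]) (rec_nat 0 f n)" for n x
  proof (induction n)
    case 0
    show ?case by (simp add: computes.PrimRec_0 computes.Zero)
  next
    case (Suc n)
    have "computes (Comp s [Proj 0, Proj 1]) (n # rec_nat 0 f n # [x]) (f n (rec_nat 0 f n))"
      by (rule computes_intros assms)+
    with Suc show ?case by (simp add: computes.PrimRec_Suc)
  qed
  have "computes (Comp (PrimRec Zero (Comp s [Proj 0, Proj 1])) [Proj 0, Proj 0]) [n]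
      (rec_nat 0 f n)" for n
    by (rule computes_intros r)+
  then show ?thesis unfolding computable1_def by blast
qed

lemma computable2_rec:
  assumes "\<And>y x. computes s [y, x] (f y x)" "\<And>x. computes p [x] (b x)"
  shows "computable2 (\<lambda>n x. rec_nat (b x) (\<lambda>_ y. f y x) n)"
proof -
  have "computes (PrimRec p (Comp s [Proj 1, Proj 2])) (n # [x]) (rec_nat (b x) (\<lambda>_ y. f y x) n)"
    for n x
  proof (induction n)
    case 0
    show ?case by (simp add: computes.PrimRec_0 assms(2))
  next
    case (Suc n)
    let ?r = "rec_nat (b x) (\<lambda>_ y. f y x) n"
    have "computes (Comp s [Proj 1, Proj 2]) (n # ?r # [x]) (f ?r x)"
      by (rule computes_intros assms)+
    with Suc show ?case by (simp add: computes.PrimRec_Suc)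
  qed
  then show ?thesis unfolding computable2_def by blast
qed

lemma computable2_add: "computable2 (+)"
proof -
  have "computable2 (\<lambda>n x. rec_nat x (\<lambda>_ y. Suc y) n)"
    by (rule computable2_rec[where s = "Comp Successor [Proj 0]" and p = "Proj 0"])
      (rule computes_intros)+
  also have "(\<lambda>n x. rec_nat x (\<lambda>_ y. Suc y) n) = (+)"
  proof (intro ext)
    fix n x :: nat show "rec_nat x (\<lambda>_ y. Suc y) n = n + x" by (induction n) auto
  qed
  finally show ?thesis .
qed

lemma computable1_pred: "computable1 (\<lambda>n. n - 1)"
proof -
  have "computable1 (rec_nat 0 (\<lambda>n y. n))"
    by (rule computable1_rec) (rule computes_Proj0)
  also have "rec_nat 0 (\<lambda>n y. n) = (\<lambda>n. n - 1)"
  proof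
    fix n :: nat show "rec_nat 0 (\<lambda>n y. n) n = n - 1" by (cases n) auto
  qed
  finally show ?thesis .
qed

lemma computable2_minus: "computable2 (-)"
proof -
  obtain p where p: "\<And>x. computes p [x] (x - 1)"
    using computable1_pred unfolding computable1_def by blast
  have "computable2 (\<lambda>n x. rec_nat x (\<lambda>_ y. y - 1) n)"
    by (rule computable2_rec[where s = "Comp p [Proj 0]" and p = "Proj 0"])
      (rule computes_intros p)+
  also have "(\<lambda>n x. rec_nat x (\<lambda>_ y. y - 1) n) = (\<lambda>n x. x - n)"
  proof (intro ext)
    fix n x :: nat show "rec_nat x (\<lambda>_ y. y - 1) n = x - n" by (induction n) auto
  qed
  finally obtain q where q: "\<And>n x. computes q [n, x] (x - n)"
    unfolding computable2_def by blast
  \<comment> \<open>The recursion runs over the first argument, which is the subtrahend; the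
    projections restore the usual order.\<close>
  have "computes (Comp q [Proj 1, Proj 0]) [x, y] (x - y)" for x y
    by (rule computes_intros q)+
  then show ?thesis unfolding computable2_def by blast
qed

lemma computable2_times: "computable2 (*)"
proof -
  obtain p where p: "\<And>x y. computes p [x, y] (x + y)"
    using computable2_add unfolding computable2_def by blast
  have "computable2 (\<lambda>n x. rec_nat 0 (\<lambda>_ y. y + x) n)"
    by (rule computable2_rec[where s = p and p = Zero]) (rule computes_intros p)+
  also have "(\<lambda>n x. rec_nat 0 (\<lambda>_ y. y + x) n) = (*)"
  proof (intro ext)
    fix n x :: nat show "rec_nat 0 (\<lambda>_ y. y + x) n = n * x" by (induction n) auto
  qed
  finally show ?thesis .
qed

lemma computable1_triangle: "computable1 triangle"
proof -
  obtain p where p: "\<And>x y. computes p [x, y] (x + y)"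
    using computable2_add unfolding computable2_def by blast
  have "computes (Comp p [Proj 1, Comp Successor [Proj 0]]) [n, y] (y + Suc n)" for n y
    by (rule computes_intros p)+
  then have "computable1 (rec_nat 0 (\<lambda>n y. y + Suc n))"
    by (rule computable1_rec)
  also have "rec_nat 0 (\<lambda>n y. y + Suc n) = triangle"
  proof
    fix n :: nat show "rec_nat 0 (\<lambda>n y. y + Suc n) n = triangle n" by (induction n) auto
  qed
  finally show ?thesis .
qed

lemma computable2_prod_encode: "computable2 (\<lambda>x y. prod_encode (x, y))"
proof -
  obtain p where p: "\<And>x y. computes p [x, y] (x + y)"
    using computable2_add unfolding computable2_def by blast
  obtain t where t: "\<And>x. computes t [x] (triangle x)"
    using computable1_triangle unfolding computable1_def by blast
  have "computes (Comp p [Comp t [p], Proj 0]) [x, y] (prod_encode (x, y))" for x y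
    unfolding prod_encode_def prod.case by (rule computes_intros p t)+
  then show ?thesis unfolding computable2_def by blast
qed

lemma triangle_strict_mono: "strict_mono triangle"
  by (rule strict_mono_Suc_iff[THEN iffD2]) simp

text \<open>The Cantor code of \<open>(m, n)\<close> is \<open>triangle (m + n) + m\<close>, so the
  diagonal \<open>m + n\<close> is the index of the interval between consecutive triangular numbers
  that contains the code. This makes unpairing an unbounded search.\<close>

lemma prod_decode_sum: "(LEAST s. z < triangle (Suc s)) = fst (prod_decode z) + snd (prod_decode z)"
proof -
  obtain m n where mn: "prod_decode z = (m, n)" by force
  then have "prod_encode (m, n) = z" by (metis prod_decode_inverse)
  then have z: "z = triangle (m + n) + m" by (simp add: prod_encode_def)
  show ?thesis unfolding mn fst_conv snd_conv
  proof (rule Least_equality)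
    show "z < triangle (Suc (m + n))" unfolding z triangle_Suc by simp
  next
    fix s assume "z < triangle (Suc s)"
    then have "triangle (m + n) < triangle (Suc s)" using z by simp
    then have "m + n < Suc s" by (simp only: strict_mono_less[OF triangle_strict_mono])
    then show "m + n \<le> s" by simp
  qed
qed

lemma fst_prod_decode: "fst (prod_decode z) = z - triangle (LEAST s. z < triangle (Suc s))"
proof -
  obtain m n where mn: "prod_decode z = (m, n)" by force
  then have "prod_encode (m, n) = z" by (metis prod_decode_inverse)
  then have z: "z = triangle (m + n) + m" by (simp add: prod_encode_def)
  show ?thesis unfolding prod_decode_sum mn fst_conv snd_conv using z by simp
qed

lemma computable1_prod_decode:
  "computable1 (\<lambda>z. fst (prod_decode z))" "computable1 (\<lambda>z. snd (prod_decode z))"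
proof -
  obtain m where m: "\<And>x y. computes m [x, y] (x - y)"
    using computable2_minus unfolding computable2_def by blast
  obtain t where t: "\<And>x. computes t [x] (triangle x)"
    using computable1_triangle unfolding computable1_def by blast
  \<comment> \<open>Truncated subtraction turns the test into a value that is \<open>0\<close>
    exactly when \<open>z < triangle (Suc s)\<close>.\<close>
  define f where "f = Comp m [Comp Successor [Proj 1], Comp t [Comp Successor [Proj 0]]]"
  have f: "computes f [s, z] (Suc z - triangle (Suc s))" for s z
    unfolding f_def by (rule computes_intros m t)+
  have mu: "computes (Mu f) [z] (LEAST s. z < triangle (Suc s))" for z
  proof (rule computes.Mu)
    have ex: "z < triangle (Suc z)" by (induction z) auto
    then have "z < triangle (Suc (LEAST s. z < triangle (Suc s)))" by (rule LeastI)
    then show "computes f ((LEAST s. z < triangle (Suc s)) # [z]) 0"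
      using f[of "LEAST s. z < triangle (Suc s)" z] by simp
  next
    fix k assume "k < (LEAST s. z < triangle (Suc s))"
    then have "\<not> z < triangle (Suc k)" by (rule not_less_Least)
    then show "\<exists>y>0. computes f (k # [z]) y"
      by (intro exI[of _ "Suc z - triangle (Suc k)"] conjI f) simp
  qed
  define g where "g = Comp m [Proj 0, Comp t [Mu f]]"
  have g: "computes g [z] (fst (prod_decode z))" for z
    unfolding g_def fst_prod_decode by (rule computes_intros m t mu)+
  have "computes (Comp m [Mu f, g]) [z] (snd (prod_decode z))" for z
  proof -
    have "snd (prod_decode z) = (LEAST s. z < triangle (Suc s)) - fst (prod_decode z)"
      unfolding prod_decode_sum by simp
    then show ?thesis by (simp only:) (rule computes_intros m mu g)+
  qed
  then show "computable1 (\<lambda>z. snd (prod_decode z))" unfolding computable1_def by blast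
  show "computable1 (\<lambda>z. fst (prod_decode z))" unfolding computable1_def using g by blast
qed

section \<open>Codes of data types\<close>

class coded =
  fixes code :: "'a \<Rightarrow> nat"
  assumes code_inject: "code x = code y \<Longrightarrow> x = y"

text \<open>If every natural number is a code, an unbounded search over codes is a search over the
  values of the type.\<close>

class coded_onto = coded +
  assumes code_onto: "\<exists>x. code x = n"

instantiation nat :: coded_onto
begin
definition code_nat :: "nat \<Rightarrow> nat" where "code_nat n = n"
instance by standard (auto simp: code_nat_def)
end

instantiation bool :: coded
begin
definition code_bool :: "bool \<Rightarrow> nat" where "code_bool b = of_bool b"
instance by standard (auto simp: code_bool_def of_bool_def split: if_splits)
end

instantiation int :: coded_onto
begin
definition code_int :: "int \<Rightarrow> nat" where "code_int = int_encode"
instance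
proof
  fix n show "\<exists>x::int. code x = n"
    unfolding code_int_def by (rule exI[of _ "int_decode n"]) simp
qed (auto simp: code_int_def dest: injD[OF inj_int_encode])
end

instantiation prod :: (coded, coded) coded
begin
definition code_prod :: "'a \<times> 'b \<Rightarrow> nat" where "code_prod x = prod_encode (code (fst x), code (snd x))"
instance by standard (auto simp: code_prod_def dest: code_inject intro: prod_eqI)
end

instance prod :: (coded_onto, coded_onto) coded_onto
proof
  fix n
  obtain x :: 'a where "code x = fst (prod_decode n)" using code_onto by blast
  moreover obtain y :: 'b where "code y = snd (prod_decode n)" using code_onto by blast
  ultimately show "\<exists>x :: 'a \<times> 'b. code x = n"
    by (intro exI[of _ "(x, y)"]) (simp add: code_prod_def)
qed

instantiation list :: (coded) coded
begin
definition code_list :: "'a list \<Rightarrow> nat" where "code_list xs = list_encode (map code xs)"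
instance
proof
  fix x y :: "'a list" assume "code x = code y"
  then have "map code x = map (code :: 'a \<Rightarrow> nat) y"
    unfolding code_list_def by (rule injD[OF inj_list_encode])
  moreover have "inj (code :: 'a \<Rightarrow> nat)" by (rule injI) (rule code_inject)
  ultimately show "x = y" by (simp add: inj_map_eq_map)
qed
end

instance list :: (coded_onto) coded_onto
proof
  fix n
  have "\<exists>xs :: 'a list. map code xs = ns" for ns
  proof (induction ns)
    case (Cons n ns)
    then obtain xs :: "'a list" where "map code xs = ns" by blast
    moreover obtain x :: 'a where "code x = n" using code_onto by blast
    ultimately show ?case by (intro exI[of _ "x # xs"]) simp
  qed simp
  then obtain xs :: "'a list" where "map code xs = list_decode n" by blast
  then show "\<exists>x :: 'a list. code x = n"
    by (intro exI[of _ xs]) (simp add: code_list_def)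
qed

definition uncode :: "nat \<Rightarrow> 'a::coded_onto" where "uncode n = (SOME x. code x = n)"

lemma code_uncode [simp]: "code (uncode n) = n"
  unfolding uncode_def by (rule someI_ex) (rule code_onto)

lemma uncode_code [simp]: "uncode (code x) = x"
  by (rule code_inject) simp

section \<open>Closure properties of the computable functions\<close>

definition computable :: "('a::coded \<Rightarrow> 'b::coded) \<Rightarrow> bool" where
  "computable f \<longleftrightarrow> (\<exists>p. \<forall>x. computes p [code x] (code (f x)))"

named_theorems computable_intros

lemma computable_id [computable_intros]: "computable (\<lambda>x. x)"
  unfolding computable_def by (rule exI, rule allI, rule computes_Proj0)

lemma computable_const [computable_intros]: "computable (\<lambda>_. c)"
proof -
  have "\<exists>p. \<forall>xs. computes p xs n" for n
  proof (induction n)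
    case 0
    then show ?case using computes.Zero by blast
  next
    case (Suc n)
    then show ?case using computes_Comp1 computes.Successor by blast
  qed
  then show ?thesis unfolding computable_def by blast
qed

lemma computable_compose: "computable f \<Longrightarrow> computable g \<Longrightarrow> computable (\<lambda>x. f (g x))"
  unfolding computable_def using computes_Comp1 by blast

lemma computable_computable1: "computable1 f \<Longrightarrow> computable g \<Longrightarrow> computable (\<lambda>x. f (g x))"
  unfolding computable_def computable1_def code_nat_def using computes_Comp1 by blast

lemma computable_computable2:
  assumes "computable2 f" "computable g" "computable h"
  shows "computable (\<lambda>x. f (g x) (h x))"
proof -
  obtain p q r where "\<And>x y. computes p [x, y] (f x y)" "\<And>x. computes q [code x] (g x)"
    "\<And>x. computes r [code x] (h x)"
    using assms unfolding computable_def computable2_def code_nat_def by blast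
  then have "computes (Comp p [q, r]) [code x] (f (g x) (h x))" for x
    by (intro computes_Comp2[of q _ "g x" r "h x"])
  then show ?thesis unfolding computable_def code_nat_def by blast
qed

lemma computable_code_iff: "computable (\<lambda>x. code (f x)) \<longleftrightarrow> computable f"
  unfolding computable_def code_nat_def ..

lemma computable_code [computable_intros]: "computable f \<Longrightarrow> computable (\<lambda>x. code (f x))"
  by (simp only: computable_code_iff)

lemma computable_uncode [computable_intros]: "computable f \<Longrightarrow> computable (\<lambda>x. uncode (f x))"
  unfolding computable_def code_uncode code_nat_def .

lemma computable_Pair [computable_intros]:
  assumes "computable f" "computable g"
  shows "computable (\<lambda>x. (f x, g x))"
proof -
  have "computable (\<lambda>x. prod_encode (code (f x), code (g x)))"
    by (intro computable_computable2[OF computable2_prod_encode] computable_intros assms)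
  then show ?thesis unfolding computable_def by (simp add: code_prod_def code_nat_def)
qed

lemma computable_fst [computable_intros]: "computable f \<Longrightarrow> computable (\<lambda>x. fst (f x))"
  using computable_computable1[OF computable1_prod_decode(1) computable_code, of f]
  by (simp add: code_prod_def computable_code_iff)

lemma computable_snd [computable_intros]: "computable f \<Longrightarrow> computable (\<lambda>x. snd (f x))"
  using computable_computable1[OF computable1_prod_decode(2) computable_code, of f]
  by (simp add: code_prod_def computable_code_iff)

lemma computable_compose2:
  "computable (\<lambda>z. f (fst z) (snd z)) \<Longrightarrow> computable g \<Longrightarrow> computable h \<Longrightarrow> computable (\<lambda>x. f (g x) (h x))"
  using computable_compose[of "\<lambda>z. f (fst z) (snd z)" "\<lambda>x. (g x, h x)", OF _ computable_Pair]
  by simp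

lemma computable_compose3:
  "computable (\<lambda>z. f (fst z) (fst (snd z)) (snd (snd z))) \<Longrightarrow> computable g \<Longrightarrow> computable h \<Longrightarrow>
     computable k \<Longrightarrow> computable (\<lambda>x. f (g x) (h x) (k x))"
  using computable_compose[of "\<lambda>z. f (fst z) (fst (snd z)) (snd (snd z))" "\<lambda>x. (g x, h x, k x)",
      OF _ computable_Pair[OF _ computable_Pair]]
  by simp

lemma computable_rec_nat [computable_intros]:
  fixes s :: "'a::coded \<Rightarrow> nat \<Rightarrow> 'b::coded \<Rightarrow> 'b"
  assumes "computable b" "computable (\<lambda>z. s (fst z) (fst (snd z)) (snd (snd z)))" "computable c"
  shows "computable (\<lambda>x. rec_nat (b x) (\<lambda>n y. s x n y) (c x))"
proof -
  obtain pb where pb: "\<And>x. computes pb [code x] (code (b x))"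
    using assms(1) unfolding computable_def by blast
  obtain ps where "\<And>z. computes ps [code z] (code (s (fst z) (fst (snd z)) (snd (snd z))))"
    using assms(2) unfolding computable_def by blast
  from this[of "(x, n, y)" for x n y]
  have ps: "computes ps [prod_encode (code x, prod_encode (n, code y))] (code (s x n y))" for x n y
    by (simp add: code_prod_def code_nat_def)
  obtain pc where pc: "\<And>x. computes pc [code x] (c x)"
    using assms(3) unfolding computable_def code_nat_def by blast
  obtain q where q: "\<And>x y. computes q [x, y] (prod_encode (x, y))"
    using computable2_prod_encode unfolding computable2_def by blast
  \<comment> \<open>The step program receives the counter, the previous value and the parameter in
    this order; the projections assemble the code of \<open>(x, n, y)\<close>.\<close>
  define r where "r = PrimRec pb (Comp ps [Comp q [Proj 2, Comp q [Proj 0, Proj 1]]])"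
  have r: "computes r (n # [code x]) (code (rec_nat (b x) (s x) n))" for n x
  proof (induction n)
    case 0
    show ?case unfolding r_def by (simp add: computes.PrimRec_0 pb)
  next
    case (Suc n)
    have "computes (Comp ps [Comp q [Proj 2, Comp q [Proj 0, Proj 1]]])
        (n # code (rec_nat (b x) (s x) n) # [code x]) (code (s x n (rec_nat (b x) (s x) n)))"
      by (rule computes_intros q ps)+
    with Suc show ?case unfolding r_def by (simp add: computes.PrimRec_Suc)
  qed
  have "computes (Comp r [pc, Proj 0]) [code x] (code (rec_nat (b x) (s x) (c x)))" for x
    by (rule computes_intros pc r)+
  then show ?thesis unfolding computable_def by blast
qed

lemma computable_of_bool_iff: "computable (\<lambda>x. of_bool (P x) :: nat) \<longleftrightarrow> computable P"
  unfolding computable_def code_nat_def code_bool_def ..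

lemma computable_Suc [computable_intros]: "computable f \<Longrightarrow> computable (\<lambda>x. Suc (f x))"
  by (rule computable_computable1) (auto simp: computable1_def intro: computes.Successor)

lemma computable_add [computable_intros]:
  "computable f \<Longrightarrow> computable g \<Longrightarrow> computable (\<lambda>x. f x + g x :: nat)"
  by (rule computable_computable2[OF computable2_add])

lemma computable_minus [computable_intros]:
  "computable f \<Longrightarrow> computable g \<Longrightarrow> computable (\<lambda>x. f x - g x :: nat)"
  by (rule computable_computable2[OF computable2_minus])

lemma computable_times [computable_intros]:
  "computable f \<Longrightarrow> computable g \<Longrightarrow> computable (\<lambda>x. f x * g x :: nat)"
  by (rule computable_computable2[OF computable2_times])

lemma computable_not [computable_intros]:
  assumes "computable P" shows "computable (\<lambda>x. \<not> P x)"
proof -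
  have "computable (\<lambda>x. 1 - of_bool (P x) :: nat)"
    using assms by (intro computable_intros) (simp add: computable_of_bool_iff)
  also have "(\<lambda>x. 1 - of_bool (P x) :: nat) = (\<lambda>x. of_bool (\<not> P x))" by auto
  finally show ?thesis by (simp only: computable_of_bool_iff)
qed

lemma computable_conj [computable_intros]:
  assumes "computable P" "computable Q" shows "computable (\<lambda>x. P x \<and> Q x)"
proof -
  have "computable (\<lambda>x. of_bool (P x) * of_bool (Q x) :: nat)"
    using assms by (intro computable_intros) (simp_all add: computable_of_bool_iff)
  also have "(\<lambda>x. of_bool (P x) * of_bool (Q x) :: nat) = (\<lambda>x. of_bool (P x \<and> Q x))" by auto
  finally show ?thesis by (simp only: computable_of_bool_iff)
qed

lemma computable_disj [computable_intros]:
  assumes "computable P" "computable Q" shows "computable (\<lambda>x. P x \<or> Q x)"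
proof -
  have "computable (\<lambda>x. \<not> (\<not> P x \<and> \<not> Q x))" by (intro computable_intros assms)
  then show ?thesis by simp
qed

text \<open>A conditional is a recursion of length \<open>0\<close> or \<open>1\<close>: no step
  leaves \<open>g x\<close>, one step overwrites it by \<open>f x\<close>.\<close>

lemma computable_If [computable_intros]:
  assumes "computable P" "computable f" "computable g"
  shows "computable (\<lambda>x. if P x then f x else g x)"
proof -
  have "computable (\<lambda>x. rec_nat (g x) (\<lambda>_ _. f x) (of_bool (P x)))"
    using assms(1) by (intro computable_intros assms computable_compose[OF assms(2)])
      (simp add: computable_of_bool_iff)
  also have "(\<lambda>x. rec_nat (g x) (\<lambda>_ _. f x) (of_bool (P x))) = (\<lambda>x. if P x then f x else g x)"
    by auto
  finally show ?thesis .
qed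

lemma computable_le [computable_intros]:
  assumes "computable f" "computable g" shows "computable (\<lambda>x. f x \<le> (g x :: nat))"
proof -
  have "computable (\<lambda>x. 1 - (f x - g x))" by (intro computable_intros assms)
  also have "(\<lambda>x. 1 - (f x - g x)) = (\<lambda>x. of_bool (f x \<le> g x))" by auto
  finally show ?thesis by (simp only: computable_of_bool_iff)
qed

lemma computable_less [computable_intros]:
  assumes "computable f" "computable g" shows "computable (\<lambda>x. f x < (g x :: nat))"
  unfolding not_le[symmetric] by (intro computable_intros assms)

lemma computable_eq [computable_intros]:
  fixes f :: "'a::coded \<Rightarrow> 'b::coded"
  assumes "computable f" "computable g" shows "computable (\<lambda>x. f x = g x)"
proof -
  have "computable (\<lambda>x. code (f x) \<le> code (g x) \<and> code (g x) \<le> code (f x))"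
    by (intro computable_intros assms)
  also have "(\<lambda>x. code (f x) \<le> code (g x) \<and> code (g x) \<le> code (f x)) = (\<lambda>x. f x = g x)"
    by (intro ext) (auto intro: code_inject antisym)
  finally show ?thesis .
qed

lemma computable_Least [computable_intros]:
  fixes P :: "'a::coded \<Rightarrow> nat \<Rightarrow> bool"
  assumes "computable (\<lambda>z. P (fst z) (snd z))" "\<And>x. \<exists>n. P x n"
  shows "computable (\<lambda>x. LEAST n. P x n)"
proof -
  have "computable (\<lambda>z. of_bool (\<not> P (fst z) (snd z)) :: nat)"
    using computable_not[OF assms(1)] by (simp only: computable_of_bool_iff)
  then obtain p where "\<And>z. computes p [code z] (of_bool (\<not> P (fst z) (snd z)))"
    unfolding computable_def code_nat_def by blast
  from this[of "(x, n)" for x n]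
  have p: "computes p [prod_encode (code x, n)] (of_bool (\<not> P x n))" for x n
    by (simp add: code_prod_def code_nat_def)
  obtain q where q: "\<And>x y. computes q [x, y] (prod_encode (x, y))"
    using computable2_prod_encode unfolding computable2_def by blast
  define f where "f = Comp p [Comp q [Proj 1, Proj 0]]"
  have f: "computes f (n # [code x]) (of_bool (\<not> P x n))" for n x
    unfolding f_def by (rule computes_intros p q)+
  have "computes (Mu f) [code x] (LEAST n. P x n)" for x
  proof (rule computes.Mu)
    have "P x (LEAST n. P x n)" using assms(2) by (rule LeastI_ex)
    then show "computes f ((LEAST n. P x n) # [code x]) 0"
      using f[of "LEAST n. P x n" x] by simp
  next
    fix m assume "m < (LEAST n. P x n)"
    then have "\<not> P x m" by (rule not_less_Least)
    then show "\<exists>y>0. computes f (m # [code x]) y"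
      using f[of m x] by (intro exI[of _ 1]) simp
  qed
  then show ?thesis unfolding computable_def code_nat_def by blast
qed

lemma computable_all_less [computable_intros]:
  fixes P :: "'a::coded \<Rightarrow> nat \<Rightarrow> bool"
  assumes "computable (\<lambda>z. P (fst z) (snd z))" "computable c"
  shows "computable (\<lambda>x. \<forall>i<c x. P x i)"
proof -
  have "computable (\<lambda>x. rec_nat True (\<lambda>i y. y \<and> P x i) (c x))"
    by (intro computable_intros computable_compose2[OF assms(1)] assms(2))
  also have "(\<lambda>x. rec_nat True (\<lambda>i y. y \<and> P x i) (c x)) = (\<lambda>x. \<forall>i<c x. P x i)"
  proof
    fix x
    have "rec_nat True (\<lambda>i y. y \<and> P x i) n \<longleftrightarrow> (\<forall>i<n. P x i)" for n
      by (induction n) (auto simp: less_Suc_eq)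
    then show "rec_nat True (\<lambda>i y. y \<and> P x i) (c x) = (\<forall>i<c x. P x i)" .
  qed
  finally show ?thesis .
qed

lemma computable_ex_less [computable_intros]:
  fixes P :: "'a::coded \<Rightarrow> nat \<Rightarrow> bool"
  assumes "computable (\<lambda>z. P (fst z) (snd z))" "computable c"
  shows "computable (\<lambda>x. \<exists>i<c x. P x i)"
proof -
  have "computable (\<lambda>x. \<not> (\<forall>i<c x. \<not> P x i))"
    by (intro computable_intros computable_compose2[OF assms(1)] assms(2))
  then show ?thesis by simp
qed

lemma computable_ex_code_less:
  fixes P :: "'a::coded \<Rightarrow> 'b::coded_onto \<Rightarrow> bool"
  assumes "computable (\<lambda>z. P (fst z) (snd z))" "computable c"
  shows "computable (\<lambda>x. \<exists>y. code y < c x \<and> P x y)"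
proof -
  have "computable (\<lambda>x. \<exists>i<c x. P x (uncode i))"
    by (intro computable_intros computable_compose2[OF assms(1)] assms(2))
  also have "(\<lambda>x. \<exists>i<c x. P x (uncode i)) = (\<lambda>x. \<exists>y. code y < c x \<and> P x y)"
  proof (intro ext iffI)
    fix x assume "\<exists>i<c x. P x (uncode i)"
    then obtain i where "i < c x" "P x (uncode i)" by blast
    then show "\<exists>y. code y < c x \<and> P x y" by (intro exI[of _ "uncode i"]) simp
  next
    fix x assume "\<exists>y. code y < c x \<and> P x y"
    then obtain y where "code y < c x" "P x y" by blast
    then show "\<exists>i<c x. P x (uncode i)" by (intro exI[of _ "code y"]) simp
  qed
  finally show ?thesis .
qed

text \<open>Post's theorem: both kinds of certificates are searched simultaneously, and the kind
  that turns up first is the answer. All decision procedures below have this form.\<close>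

lemma computable_decide:
  fixes P :: "'a::coded \<Rightarrow> 'b::coded_onto \<Rightarrow> bool" and Q :: "'a \<Rightarrow> 'c::coded_onto \<Rightarrow> bool"
  assumes "computable (\<lambda>z. P (fst z) (snd z))" "computable (\<lambda>z. Q (fst z) (snd z))"
    and "\<And>x. (\<exists>y. P x y) \<longleftrightarrow> \<not> (\<exists>y. Q x y)"
  shows "computable (\<lambda>x. \<exists>y. P x y)"
proof -
  define l where "l x = (LEAST n. P x (uncode n) \<or> Q x (uncode n))" for x
  have ex: "\<exists>n. P x (uncode n) \<or> Q x (uncode n)" for x
  proof (cases "\<exists>y. P x y")
    case True
    then obtain y where "P x y" by blast
    then show ?thesis by (intro exI[of _ "code y"]) simp
  next
    case False
    then obtain y where "Q x y" using assms(3)[of x] by blast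
    then show ?thesis by (intro exI[of _ "code y"]) simp
  qed
  have "computable l"
    unfolding l_def
    by (intro computable_intros computable_compose2[OF assms(1)] computable_compose2[OF assms(2)] ex)
  then have "computable (\<lambda>x. P x (uncode (l x)))"
    by (intro computable_compose2[OF assms(1)] computable_intros)
  also have "(\<lambda>x. P x (uncode (l x))) = (\<lambda>x. \<exists>y. P x y)"
  proof
    fix x
    have "P x (uncode (l x)) \<or> Q x (uncode (l x))" unfolding l_def by (rule LeastI_ex[OF ex])
    then show "P x (uncode (l x)) = (\<exists>y. P x y)" using assms(3)[of x] by blast
  qed
  finally show ?thesis .
qed

lemma computable_power [computable_intros]:
  assumes "computable f" "computable g" shows "computable (\<lambda>x. (f x :: nat) ^ g x)"
proof -
  have "computable (\<lambda>x. rec_nat 1 (\<lambda>_ y. f x * y) (g x))"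
    by (intro computable_intros computable_compose[OF assms(1)] assms(2))
  also have "(\<lambda>x. rec_nat 1 (\<lambda>_ y. f x * y) (g x)) = (\<lambda>x. f x ^ g x)"
  proof
    fix x
    have "rec_nat 1 (\<lambda>_ y. f x * y) n = f x ^ n" for n by (induction n) auto
    then show "rec_nat 1 (\<lambda>_ y. f x * y) (g x) = f x ^ g x" .
  qed
  finally show ?thesis .
qed

lemma computable_fact [computable_intros]:
  assumes "computable f" shows "computable (\<lambda>x. fact (f x) :: nat)"
proof -
  have "computable (\<lambda>x. rec_nat 1 (\<lambda>n y. Suc n * y) (f x))"
    by (intro computable_intros assms)
  also have "(\<lambda>x. rec_nat 1 (\<lambda>n y. Suc n * y) (f x)) = (\<lambda>x. fact (f x))"
  proof
    fix x
    have "rec_nat 1 (\<lambda>n y. Suc n * y) n = fact n" for n by (induction n) auto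
    then show "rec_nat 1 (\<lambda>n y. Suc n * y) (f x) = fact (f x)" .
  qed
  finally show ?thesis .
qed

text \<open>The parity and the half of an integer's code give its sign and its absolute
  value.\<close>

lemma computable_half:
  assumes "computable f" shows "computable (\<lambda>x. (f x :: nat) div 2)"
proof -
  have "computable (\<lambda>x. LEAST h. f x < 2 * Suc h)"
  proof (intro computable_intros computable_compose[OF assms])
    show "\<exists>n. f x < 2 * Suc n" for x by (rule exI[of _ "f x"]) simp
  qed
  also have "(\<lambda>x. LEAST h. f x < 2 * Suc h) = (\<lambda>x. f x div 2)"
    by (intro ext Least_equality) auto
  finally show ?thesis .
qed

section \<open>Integer arithmetic on codes\<close>

lemma int_encode_nonneg: "0 \<le> i \<Longrightarrow> int_encode i = 2 * nat i"
  by (simp add: int_encode_def sum_encode_def)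

lemma int_encode_neg: "i < 0 \<Longrightarrow> int_encode i = Suc (2 * nat (- i - 1))"
  by (simp add: int_encode_def sum_encode_def)

lemma computable_nat [computable_intros]:
  fixes f :: "'a::coded \<Rightarrow> int"
  assumes "computable f" shows "computable (\<lambda>x. nat (f x))"
proof -
  have "computable (\<lambda>x. if code (f x) = 2 * (code (f x) div 2) then code (f x) div 2 else 0)"
    by (intro computable_intros computable_half assms)
  also have "(\<lambda>x. if code (f x) = 2 * (code (f x) div 2) then code (f x) div 2 else 0) = (\<lambda>x. nat (f x))"
  proof
    fix x
    show "(if code (f x) = 2 * (code (f x) div 2) then code (f x) div 2 else 0) = nat (f x)"
      by (cases "0 \<le> f x") (simp_all add: code_int_def int_encode_nonneg int_encode_neg)
  qed
  finally show ?thesis .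
qed

lemma computable_nat_uminus [computable_intros]:
  fixes f :: "'a::coded \<Rightarrow> int"
  assumes "computable f" shows "computable (\<lambda>x. nat (- f x))"
proof -
  have "computable (\<lambda>x. if code (f x) = 2 * (code (f x) div 2) then 0 else Suc (code (f x) div 2))"
    by (intro computable_intros computable_half assms)
  also have "(\<lambda>x. if code (f x) = 2 * (code (f x) div 2) then 0 else Suc (code (f x) div 2)) =
      (\<lambda>x. nat (- f x))"
  proof
    fix x
    show "(if code (f x) = 2 * (code (f x) div 2) then 0 else Suc (code (f x) div 2)) = nat (- f x)"
    proof (cases "0 \<le> f x")
      case True
      then show ?thesis by (simp add: code_int_def int_encode_nonneg)
    next
      case False
      then have c: "code (f x) = Suc (2 * nat (- f x - 1))" by (simp add: code_int_def int_encode_neg)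
      have "Suc (2 * k) \<noteq> 2 * (Suc (2 * k) div 2)" "Suc (2 * k) div 2 = k" for k :: nat by presburger+
      then show ?thesis unfolding c using False by simp
    qed
  qed
  finally show ?thesis .
qed

lemma computable_int_diff:
  assumes "computable f" "computable g" shows "computable (\<lambda>x. int (f x) - int (g x))"
proof -
  \<comment> \<open>The code of an integer \<open>z\<close> is \<open>2 * z\<close> if
    \<open>z\<close> is nonnegative, and \<open>2 * (- z) - 1\<close> otherwise.\<close>
  have "computable (\<lambda>x. if g x \<le> f x then 2 * (f x - g x) else 2 * (g x - f x) - 1)"
    by (intro computable_intros assms)
  also have "(\<lambda>x. if g x \<le> f x then 2 * (f x - g x) else 2 * (g x - f x) - 1) =
      (\<lambda>x. code (int (f x) - int (g x)))"
  proof
    fix x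
    show "(if g x \<le> f x then 2 * (f x - g x) else 2 * (g x - f x) - 1) = code (int (f x) - int (g x))"
      by (auto simp: code_int_def int_encode_nonneg int_encode_neg nat_diff_distrib')
  qed
  finally show ?thesis by (simp only: computable_code_iff)
qed

lemma computable_int [computable_intros]:
  assumes "computable f" shows "computable (\<lambda>x. int (f x))"
  using computable_int_diff[OF assms computable_const[of 0]] by simp

lemma computable_int_add [computable_intros]:
  fixes f :: "'a::coded \<Rightarrow> int"
  assumes "computable f" "computable g" shows "computable (\<lambda>x. f x + g x)"
proof -
  have "computable (\<lambda>x. int (nat (f x) + nat (g x)) - int (nat (- f x) + nat (- g x)))"
    by (intro computable_intros computable_int_diff assms)
  also have "(\<lambda>x. int (nat (f x) + nat (g x)) - int (nat (- f x) + nat (- g x))) = (\<lambda>x. f x + g x)"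
    by auto
  finally show ?thesis .
qed

lemma computable_int_times [computable_intros]:
  fixes f :: "'a::coded \<Rightarrow> int"
  assumes "computable f" "computable g" shows "computable (\<lambda>x. f x * g x)"
proof -
  have "computable (\<lambda>x. int (nat (f x) * nat (g x) + nat (- f x) * nat (- g x)) -
      int (nat (f x) * nat (- g x) + nat (- f x) * nat (g x)))"
    by (intro computable_intros computable_int_diff assms)
  also have "(\<lambda>x. int (nat (f x) * nat (g x) + nat (- f x) * nat (- g x)) -
      int (nat (f x) * nat (- g x) + nat (- f x) * nat (g x))) = (\<lambda>x. f x * g x)"
  proof
    fix x
    have "f x = int (nat (f x)) - int (nat (- f x))" "g x = int (nat (g x)) - int (nat (- g x))" by auto
    then have "f x * g x = (int (nat (f x)) - int (nat (- f x))) * (int (nat (g x)) - int (nat (- g x)))"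
      by simp
    then show "int (nat (f x) * nat (g x) + nat (- f x) * nat (- g x)) -
      int (nat (f x) * nat (- g x) + nat (- f x) * nat (g x)) = f x * g x"
      by (simp add: algebra_simps del: int_nat_eq)
  qed
  finally show ?thesis .
qed

lemma computable_abs_le [computable_intros]:
  fixes f :: "'a::coded \<Rightarrow> int"
  assumes "computable f" "computable g" shows "computable (\<lambda>x. \<bar>f x\<bar> \<le> int (g x))"
proof -
  have "computable (\<lambda>x. nat (f x) + nat (- f x) \<le> g x)" by (intro computable_intros assms)
  also have "(\<lambda>x. nat (f x) + nat (- f x) \<le> g x) = (\<lambda>x. \<bar>f x\<bar> \<le> int (g x))" by auto
  finally show ?thesis .
qed

lemma computable_int_sum [computable_intros]:
  fixes F :: "'a::coded \<Rightarrow> nat \<Rightarrow> int"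
  assumes "computable (\<lambda>z. F (fst z) (snd z))" "computable c"
  shows "computable (\<lambda>x. \<Sum>i<c x. F x i)"
proof -
  have "computable (\<lambda>x. rec_nat 0 (\<lambda>i y. y + F x i) (c x))"
    by (intro computable_intros computable_compose2[OF assms(1)] assms(2))
  also have "(\<lambda>x. rec_nat 0 (\<lambda>i y. y + F x i) (c x)) = (\<lambda>x. \<Sum>i<c x. F x i)"
  proof
    fix x
    have "rec_nat 0 (\<lambda>i y. y + F x i) n = (\<Sum>i<n. F x i)" for n by (induction n) auto
    then show "rec_nat 0 (\<lambda>i y. y + F x i) (c x) = (\<Sum>i<c x. F x i)" .
  qed
  finally show ?thesis .
qed

section \<open>Lists on codes\<close>

lemma computable_Cons [computable_intros]:
  assumes "computable f" "computable g" shows "computable (\<lambda>x. f x # g x)"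
proof -
  have "computable (\<lambda>x. Suc (prod_encode (code (f x), code (g x))))"
    by (intro computable_intros computable_computable2[OF computable2_prod_encode] assms)
  also have "(\<lambda>x. Suc (prod_encode (code (f x), code (g x)))) = (\<lambda>x. code (f x # g x))"
    by (auto simp: code_list_def)
  finally show ?thesis by (simp only: computable_code_iff)
qed

lemma computable_drop [computable_intros]:
  assumes "computable c" "computable f" shows "computable (\<lambda>x. drop (c x) (f x))"
proof -
  have "computable (\<lambda>x. rec_nat (code (f x)) (\<lambda>_ y. snd (prod_decode (y - 1))) (c x))"
    by (intro computable_intros computable_computable1[OF computable1_prod_decode(2)] assms)
  also have "(\<lambda>x. rec_nat (code (f x)) (\<lambda>_ y. snd (prod_decode (y - 1))) (c x)) =
    (\<lambda>x. code (drop (c x) (f x)))"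
  proof
    fix x
    \<comment> \<open>The empty list has code \<open>0\<close>, and \<open>0 - 1 = 0\<close> decodes
      to \<open>(0, 0)\<close>, so the formula for the tail also maps the empty list to
      itself.\<close>
    have tl: "snd (prod_decode (code xs - 1)) = code (tl xs)" for xs :: "'b list"
    proof (cases xs)
      case Nil
      have "prod_encode (0, 0) = 0" by (simp add: prod_encode_def)
      then have "prod_decode 0 = (0, 0)" by (metis prod_encode_inverse)
      with Nil show ?thesis by (simp add: code_list_def)
    qed (simp add: code_list_def)
    have "rec_nat (code (f x)) (\<lambda>_ y. snd (prod_decode (y - 1))) n = code (drop n (f x))" for n
      by (induction n) (simp_all add: tl[simplified] tl_drop drop_Suc)
    then show "rec_nat (code (f x)) (\<lambda>_ y. snd (prod_decode (y - 1))) (c x) = code (drop (c x) (f x))" .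
  qed
  finally show ?thesis by (simp only: computable_code_iff)
qed

lemma computable_length [computable_intros]:
  assumes "computable f" shows "computable (\<lambda>x. length (f x))"
proof -
  have "computable (\<lambda>x. LEAST n. drop n (f x) = [])"
    by (intro computable_intros computable_compose[OF assms]) (metis drop_all order_refl)
  also have "(\<lambda>x. LEAST n. drop n (f x) = []) = (\<lambda>x. length (f x))"
    by (intro ext Least_equality) auto
  finally show ?thesis .
qed

lemma computable_nth_default [computable_intros]:
  assumes "computable f" "computable g"
  shows "computable (\<lambda>x. nth_default d (f x) (g x))"
proof -
  have "computable (\<lambda>x. if g x < length (f x)
      then fst (prod_decode (code (drop (g x) (f x)) - 1)) else code d)"
    by (intro computable_intros computable_computable1[OF computable1_prod_decode(1)] assms)
  also have "(\<lambda>x. if g x < length (f x)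
      then fst (prod_decode (code (drop (g x) (f x)) - 1)) else code d) =
    (\<lambda>x. code (nth_default d (f x) (g x)))"
  proof
    fix x
    show "(if g x < length (f x) then fst (prod_decode (code (drop (g x) (f x)) - 1)) else code d) =
      code (nth_default d (f x) (g x))"
      by (auto simp: nth_default_def code_list_def simp flip: Cons_nth_drop_Suc)
  qed
  finally show ?thesis by (simp only: computable_code_iff)
qed

lemma recursive_setI: "computable (\<lambda>n. n \<in> A) \<Longrightarrow> recursive_set A"
  unfolding computable_def recursive_set_def code_nat_def code_bool_def .

lemma encode_ints_eq_code: "encode_ints xs = code xs"
  by (simp add: encode_ints_def code_list_def code_int_def)

lemma computable_on_encode_ints:
  assumes "computable (\<lambda>z. P (fst z) (snd z))"
  shows "\<exists>p. \<forall>a b. computes p [encode_ints a, encode_ints b] (of_bool (P a b))"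
proof -
  obtain p where "\<And>z. computes p [code z] (of_bool (P (fst z) (snd z)))"
    using assms unfolding computable_def code_bool_def by blast
  from this[of "(a, b)" for a b]
  have p: "computes p [prod_encode (code a, code b)] (of_bool (P a b))" for a b
    by (simp add: code_prod_def)
  obtain q where q: "\<And>x y. computes q [x, y] (prod_encode (x, y))"
    using computable2_prod_encode unfolding computable2_def by blast
  have "computes (Comp p [q]) [encode_ints a, encode_ints b] (of_bool (P a b))" for a b
    unfolding encode_ints_eq_code by (rule computes_Comp1[OF q p])
  then show ?thesis by blast
qed

section \<open>Polynomials acting on sequences\<close>

text \<open>The indeterminate acts as the shift, which makes the sequences a module over the
  polynomials: multiplication becomes composition, and a recurrence says that its characteristic
  polynomial annihilates the sequence.\<close>

definition act :: "'a::comm_ring_1 poly \<Rightarrow> (nat \<Rightarrow> 'a) \<Rightarrow> nat \<Rightarrow> 'a" where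
  "act p u n = (\<Sum>i\<le>degree p. coeff p i * u (n + i))"

lemma act_eq_sum: "degree p < N \<Longrightarrow> act p u n = (\<Sum>i<N. coeff p i * u (n + i))"
  unfolding act_def by (rule sum.mono_neutral_left) (auto simp: coeff_eq_0)

lemma act_pCons: "act (pCons c p) u n = c * u n + act p u (Suc n)"
proof -
  have "degree (pCons c p) < Suc (Suc (degree p))" using degree_pCons_le[of c p] by simp
  then have "act (pCons c p) u n = (\<Sum>i<Suc (Suc (degree p)). coeff (pCons c p) i * u (n + i))"
    by (rule act_eq_sum)
  also have "\<dots> = c * u n + (\<Sum>i<Suc (degree p). coeff p i * u (Suc n + i))"
    by (subst sum.lessThan_Suc_shift) simp
  finally show ?thesis by (simp add: act_eq_sum[of p "Suc (degree p)"])
qed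

lemma act_zero [simp]: "act 0 u n = 0"
  by (simp add: act_def)

lemma act_add: "act (p + q) u n = act p u n + act q u n"
proof -
  let ?N = "Suc (max (degree p) (degree q))"
  have "degree (p + q) < ?N" using degree_add_le_max[of p q] by simp
  then show ?thesis
    by (simp add: act_eq_sum[of _ ?N] less_Suc_eq_le sum.distrib distrib_right)
qed

lemma act_smult: "act (smult c p) u n = c * act p u n"
proof -
  have "degree (smult c p) < Suc (degree p)" using degree_smult_le[of c p] by simp
  then show ?thesis
    by (simp add: act_eq_sum[of _ "Suc (degree p)"] sum_distrib_left mult.assoc del: sum.lessThan_Suc)
qed

lemma act_uminus: "act (- p) u n = - act p u n"
  using act_smult[of "- 1" p u n] by simp

lemma act_diff: "act (p - q) u n = act p u n - act q u n"
  using act_add[of p "- q" u n] by (simp add: act_uminus)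

lemma act_sum: "act (\<Sum>i\<in>I. p i) u n = (\<Sum>i\<in>I. act (p i) u n)"
  by (induction I rule: infinite_finite_induct) (simp_all add: act_add)

lemma act_mult: "act (p * q) u n = act p (act q u) n"
proof (induction p arbitrary: n)
  case (pCons c p)
  have "act (pCons c p * q) u n = c * act q u n + act (p * q) u (Suc n)"
    by (simp add: mult_pCons_left act_add act_smult act_pCons)
  then show ?case using pCons by (simp add: act_pCons)
qed simp

lemma act_monom: "act (monom c k) u n = c * u (n + k)"
proof (induction k arbitrary: n)
  case 0
  then show ?case by (simp add: monom_0 act_pCons)
next
  case (Suc k)
  then show ?case by (simp add: monom_Suc act_pCons)
qed

lemma act_const: "act [:c:] u n = c * u n"
  by (simp add: act_pCons)

lemma act_seq_zero [simp]: "act p (\<lambda>_. 0) n = 0"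
  by (simp add: act_def)

lemma act_seq_add: "act p (\<lambda>n. u n + v n) n = act p u n + act p v n"
  by (simp add: act_def sum.distrib distrib_left)

lemma act_seq_diff: "act p (\<lambda>n. u n - v n) n = act p u n - act p v n"
  by (simp add: act_def sum_subtractf right_diff_distrib)

lemma act_seq_smult: "act p (\<lambda>n. c * u n) n = c * act p u n"
  by (simp add: act_def sum_distrib_left mult.left_commute)

lemma act_seq_sum: "act p (\<lambda>n. \<Sum>i\<in>I. u i n) n = (\<Sum>i\<in>I. act p (u i) n)"
  by (induction I rule: infinite_finite_induct) (simp_all add: act_seq_add)

lemma act_shift: "act p (\<lambda>n. u (n + k)) n = act p u (n + k)"
  by (simp add: act_def algebra_simps)

lemma act_power: "act p (\<lambda>n. x ^ n) n = poly p x * x ^ n"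
  unfolding act_def poly_altdef sum_distrib_right by (simp add: power_add mult_ac)

lemma act_commute: "act p (act q u) n = act q (act p u) n"
  by (metis act_mult mult.commute)

lemma act_of_int:
  "act (map_poly of_int p) (\<lambda>n. of_int (u n)) n = (of_int (act p u n) :: 'a::comm_ring_1)"
proof -
  have "degree (map_poly (of_int :: int \<Rightarrow> 'a) p) < Suc (degree p)"
    using degree_map_poly_le[of of_int p] by (simp add: less_Suc_eq_le)
  then show ?thesis
    by (simp add: act_eq_sum[of _ "Suc (degree p)"] coeff_map_poly del: sum.lessThan_Suc)
qed

text \<open>Each term from index \<open>D\<close> on is determined by its \<open>D\<close>
  predecessors. Identities between solutions thereby reduce to finitely many checks.\<close>

lemma monic_recurrence_zero:
  assumes "lead_coeff P = 1" "degree P = D" "\<And>n. act P u n = 0" "\<And>n. n < D \<Longrightarrow> u n = 0"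
  shows "u n = 0"
proof (induction n rule: less_induct)
  case (less n)
  show ?case
  proof (cases "n < D")
    case False
    then have "0 = (\<Sum>i<Suc D. coeff P i * u (n - D + i))"
      using assms(3)[of "n - D"] assms(2) by (simp add: act_eq_sum[of P "Suc D"])
    also have "\<dots> = coeff P D * u n" using False less by simp
    finally show ?thesis using assms(1,2) by simp
  qed (rule assms(4))
qed

section \<open>Recurrences\<close>

lemma coeff_characteristic_poly:
  "coeff (characteristic_poly a) j =
     (if j = length a then 1 else if j < length a then - (a ! (length a - 1 - j)) else 0)"
proof -
  have "coeff (\<Sum>i<length a. monom (a ! i) (length a - 1 - i)) j =
      (\<Sum>i<length a. if length a - 1 - i = j then a ! i else 0)"
    by (simp add: coeff_sum)
  also have "\<dots> = (if j < length a then a ! (length a - 1 - j) else 0)"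
  proof (cases "j < length a")
    case True
    have "(\<Sum>i<length a. if length a - 1 - i = j then a ! i else 0) =
        (\<Sum>i<length a. if i = length a - 1 - j then a ! i else 0)"
      by (rule sum.cong) (use True in auto)
    then show ?thesis using True by simp
  next
    case False
    then have "(\<Sum>i<length a. if length a - 1 - i = j then a ! i else 0) = (\<Sum>i<length a. 0)"
      by (intro sum.cong) auto
    then show ?thesis using False by simp
  qed
  finally show ?thesis by (simp add: characteristic_poly_def)
qed

lemma degree_characteristic_poly [simp]: "degree (characteristic_poly a) = length a"
proof (rule antisym)
  show "degree (characteristic_poly a) \<le> length a"
    by (rule degree_le) (simp add: coeff_characteristic_poly)
  show "length a \<le> degree (characteristic_poly a)"
    by (rule le_degree) (simp add: coeff_characteristic_poly)
qed

lemma coeff_characteristic_poly_length [simp]: "coeff (characteristic_poly a) (length a) = 1"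
  by (simp add: coeff_characteristic_poly)

lemma characteristic_poly_nonzero [simp]: "characteristic_poly a \<noteq> 0"
proof
  assume "characteristic_poly a = 0"
  then show False using coeff_characteristic_poly_length[of a] by simp
qed

lemma satisfies_recurrence_iff:
  "satisfies_recurrence a u \<longleftrightarrow> a \<noteq> [] \<and> (\<forall>n. act (characteristic_poly a) u n = 0)"
proof -
  have "act (characteristic_poly a) u n =
      u (n + length a) - (\<Sum>i<length a. a ! i * u (n + length a - 1 - i))" for n
    unfolding characteristic_poly_def act_diff act_sum act_monom by (auto intro!: sum.cong)
  then show ?thesis unfolding satisfies_recurrence_def by simp
qed

lemma recurrence_of_monic:
  assumes "lead_coeff P = 1" "degree P \<ge> 1" "\<And>n. act P u n = 0"
  obtains a where "length a = degree P" "satisfies_recurrence a u"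
proof -
  define a where "a = map (\<lambda>i. - coeff P (degree P - 1 - i)) [0..<degree P]"
  have "characteristic_poly a = P"
    by (rule poly_eqI) (use assms(1) in \<open>auto simp: coeff_characteristic_poly a_def coeff_eq_0\<close>)
  then have "satisfies_recurrence a u"
    using assms(2,3) by (auto simp: satisfies_recurrence_iff a_def)
  then show ?thesis using that[of a] by (simp add: a_def)
qed

lemma solutions_eqI:
  assumes "satisfies_recurrence a u" "satisfies_recurrence a v" "\<And>n. n < length a \<Longrightarrow> u n = v n"
  shows "u n = v n"
proof -
  have "(\<lambda>n. u n - v n) n = 0"
    by (rule monic_recurrence_zero[of "characteristic_poly a"])
      (use assms in \<open>auto simp: act_seq_diff satisfies_recurrence_iff\<close>)
  then show ?thesis by simp
qed

lemma recurrence_act: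
  assumes "satisfies_recurrence a u" shows "satisfies_recurrence a (act p u)"
proof -
  have "act (characteristic_poly a) u = (\<lambda>_. 0)" using assms by (auto simp: satisfies_recurrence_iff)
  then have "act (characteristic_poly a) (act p u) n = 0" for n
    by (subst act_commute) simp
  then show ?thesis using assms by (simp add: satisfies_recurrence_iff)
qed

lemma recurrence_shift: "satisfies_recurrence a u \<Longrightarrow> satisfies_recurrence a (\<lambda>n. u (n + k))"
  by (simp add: satisfies_recurrence_iff act_shift)

lemma recurrence_shift': "satisfies_recurrence a u \<Longrightarrow> satisfies_recurrence a (\<lambda>n. u (k + n))"
  using recurrence_shift[of a u k] by (simp add: add.commute)

lemma recurrence_sum:
  "a \<noteq> [] \<Longrightarrow> (\<And>i. i \<in> I \<Longrightarrow> satisfies_recurrence a (u i)) \<Longrightarrow>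
     satisfies_recurrence a (\<lambda>n. \<Sum>i\<in>I. c i * u i n)"
  by (simp add: satisfies_recurrence_iff act_seq_sum act_seq_smult)

text \<open>The reversed list of the first \<open>n\<close> terms: a form of the recursion that needs only \<open>Cons\<close>.\<close>

definition lrs_prefix :: "int list \<Rightarrow> int list \<Rightarrow> nat \<Rightarrow> int list" where
  "lrs_prefix a w = rec_nat [] (\<lambda>m xs. (if m < length a then nth_default 0 w m
     else \<Sum>i<length a. nth_default 0 a i * nth_default 0 xs i) # xs)"

definition lrs :: "int list \<Rightarrow> int list \<Rightarrow> nat \<Rightarrow> int" where
  "lrs a w n = nth_default 0 (lrs_prefix a w (Suc n)) 0"

lemma nth_default_lrs_prefix:
  "i < n \<Longrightarrow> nth_default 0 (lrs_prefix a w n) i = lrs a w (n - 1 - i)"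
proof (induction n arbitrary: i)
  case (Suc n)
  show ?case
  proof (cases i)
    case (Suc j)
    then have "nth_default 0 (lrs_prefix a w (Suc n)) i = nth_default 0 (lrs_prefix a w n) j"
      by (simp add: lrs_prefix_def)
    then show ?thesis using Suc.IH[of j] Suc.prems Suc by simp
  qed (simp add: lrs_def)
qed simp

lemma lrs_init: "n < length a \<Longrightarrow> lrs a w n = nth_default 0 w n"
  by (simp add: lrs_def lrs_prefix_def)

lemma satisfies_recurrence_lrs:
  assumes "a \<noteq> []" shows "satisfies_recurrence a (lrs a w)"
  unfolding satisfies_recurrence_def
proof (intro conjI allI assms)
  fix n
  let ?k = "length a"
  have "lrs a w (n + ?k) = (\<Sum>i<?k. nth_default 0 a i * nth_default 0 (lrs_prefix a w (n + ?k)) i)"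
    by (simp add: lrs_def lrs_prefix_def)
  also have "\<dots> = (\<Sum>i<?k. a ! i * lrs a w (n + ?k - 1 - i))"
    by (rule sum.cong) (simp_all add: nth_default_lrs_prefix nth_default_nth)
  finally show "lrs a w (n + ?k) = (\<Sum>i<?k. a ! i * lrs a w (n + ?k - 1 - i))" .
qed

lemma lrs_eq:
  assumes "satisfies_recurrence a u" shows "lrs a (map u [0..<length a]) = u"
proof
  fix n
  have "a \<noteq> []" using assms by (simp add: satisfies_recurrence_def)
  then show "lrs a (map u [0..<length a]) n = u n"
    by (rule solutions_eqI[OF satisfies_recurrence_lrs assms])
      (simp_all add: lrs_init nth_default_nth)
qed

text \<open>The fundamental solutions, whose initial values are the unit vectors.\<close>

definition basis_solution :: "int list \<Rightarrow> nat \<Rightarrow> nat \<Rightarrow> int" where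
  "basis_solution a l = lrs a (map (\<lambda>i. of_bool (i = l)) [0..<length a])"

lemma satisfies_recurrence_basis: "a \<noteq> [] \<Longrightarrow> satisfies_recurrence a (basis_solution a l)"
  unfolding basis_solution_def by (rule satisfies_recurrence_lrs)

lemma basis_solution_init: "i < length a \<Longrightarrow> basis_solution a l i = of_bool (i = l)"
  by (simp add: basis_solution_def lrs_init nth_default_nth)

text \<open>As functions of \<open>m\<close> both sides solve the recurrence, and they agree for
  \<open>m < length a\<close>. Consequently \<open>length a\<close> consecutive shifts of a solution
  form a family stable under every further shift.\<close>

lemma addition_formula:
  assumes "satisfies_recurrence a u"
  shows "u (n + m) = (\<Sum>l<length a. basis_solution a l m * u (n + l))"
proof -
  have a: "a \<noteq> []" using assms by (simp add: satisfies_recurrence_def)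
  have "satisfies_recurrence a (\<lambda>m. \<Sum>l<length a. u (n + l) * basis_solution a l m)"
    by (intro recurrence_sum a satisfies_recurrence_basis)
  moreover have "u (n + i) = (\<Sum>l<length a. u (n + l) * basis_solution a l i)" if i: "i < length a" for i
  proof -
    have "(\<Sum>l<length a. u (n + l) * basis_solution a l i) =
        (\<Sum>l<length a. if l = i then u (n + l) else 0)"
      by (rule sum.cong) (use i in \<open>auto simp: basis_solution_init\<close>)
    then show ?thesis using i by simp
  qed
  ultimately have "u (n + m) = (\<Sum>l<length a. u (n + l) * basis_solution a l m)"
    by (rule solutions_eqI[OF recurrence_shift'[OF assms, of n]])
  also have "\<dots> = (\<Sum>l<length a. basis_solution a l m * u (n + l))"
    by (simp only: mult.commute)
  finally show ?thesis .
qed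

text \<open>The last nonzero coefficient allows the recurrence to be solved for an earlier term, so
  zeros propagate backwards. Trailing zero coefficients stop this only at an index below
  \<open>length a\<close>.\<close>

lemma eventually_zero_from_order:
  assumes "satisfies_recurrence a v" "\<And>n. n \<ge> m \<Longrightarrow> v n = 0" "n \<ge> length a"
  shows "v n = 0"
proof (cases "\<exists>i<length a. a ! i \<noteq> 0")
  case False
  have "v (n - length a + length a) = (\<Sum>i<length a. a ! i * v (n - length a + length a - 1 - i))"
    using assms(1) unfolding satisfies_recurrence_def by blast
  also have "\<dots> = 0" using False by simp
  finally show ?thesis using assms(3) by simp
next
  case True
  define i0 where "i0 = Max {i. i < length a \<and> a ! i \<noteq> 0}"
  have fin: "finite {i. i < length a \<and> a ! i \<noteq> 0}" by simp
  have i0: "i0 < length a" "a ! i0 \<noteq> 0"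
    using Max_in[OF fin] True unfolding i0_def by auto
  have above: "a ! i = 0" if "i < length a" "i > i0" for i
  proof (rule ccontr)
    assume "a ! i \<noteq> 0"
    then have "i \<le> i0" unfolding i0_def using that by (intro Max_ge[OF fin]) simp
    then show False using that by simp
  qed
  have "\<forall>k\<ge>max m n - d. k \<ge> length a - 1 - i0 \<longrightarrow> v k = 0" for d
  proof (induction d)
    case 0
    then show ?case using assms(2) by auto
  next
    case (Suc d)
    show ?case
    proof (intro allI impI)
      fix n' assume n': "max m n - Suc d \<le> n'" "length a - 1 - i0 \<le> n'"
      have zero: "v j = 0" if "j > n'" for j using Suc that n' by auto
      \<comment> \<open>At this index the summand \<open>i0\<close> of the recurrence is the one
        containing \<open>v n'\<close>; summands with smaller \<open>i\<close> involve later terms,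
        and those with larger \<open>i\<close> have coefficient \<open>0\<close>.\<close>
      define s where "s = n' + 1 + i0 - length a"
      have s: "s + length a = n' + 1 + i0" using n'(2) i0(1) unfolding s_def by simp
      have "v (s + length a) = (\<Sum>i<length a. a ! i * v (s + length a - 1 - i))"
        using assms(1) unfolding satisfies_recurrence_def by blast
      also have "\<dots> = (\<Sum>i<length a. if i = i0 then a ! i0 * v n' else 0)"
      proof (rule sum.cong, rule refl)
        fix i assume "i \<in> {..<length a}"
        then show "a ! i * v (s + length a - 1 - i) = (if i = i0 then a ! i0 * v n' else 0)"
          using above[of i] zero[of "s + length a - 1 - i"] unfolding s
          by (cases i i0 rule: linorder_cases) auto
      qed
      also have "\<dots> = a ! i0 * v n'" using i0 by simp
      finally have "a ! i0 * v n' = 0" using zero[of "n' + 1 + i0"] unfolding s by simp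
      then show "v n' = 0" using i0 by simp
    qed
  qed
  from this[of "max m n"] show ?thesis using assms(3) by simp
qed

text \<open>The proof multiplies the relations \<open>(S - M) f = 0\<close>, where \<open>S\<close> is the shift, by the adjugate.\<close>

lemma shift_family_nat:
  fixes f :: "nat \<Rightarrow> nat \<Rightarrow> 'a::comm_ring_1"
  assumes "\<And>i n. i < D \<Longrightarrow> f i (Suc n) = (\<Sum>j<D. M i j * f j n)"
  shows "\<exists>P. lead_coeff P = 1 \<and> degree P = D \<and> (\<forall>i<D. \<forall>n. act P (f i) n = 0)"
proof -
  define A where "A = mat D D (\<lambda>(i, j). M i j)"
  have A: "A \<in> carrier_mat D D" by (simp add: A_def)
  define C where "C = char_poly_matrix A"
  have C: "C \<in> carrier_mat D D" using A by (simp add: C_def)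
  have Cij: "C $$ (i, j) = (if i = j then [:0, 1:] else 0) + [:- M i j:]" if "i < D" "j < D" for i j
    using that by (simp add: C_def char_poly_matrix_def A_def)
  have row: "(\<Sum>j<D. act (C $$ (k, j)) (f j) n) = 0" if "k < D" for k n
  proof -
    have "(\<Sum>j<D. act (C $$ (k, j)) (f j) n) =
        (\<Sum>j<D. (if j = k then f k (Suc n) else 0) - M k j * f j n)"
      by (rule sum.cong) (use that in \<open>auto simp: Cij act_add act_pCons\<close>)
    also have "\<dots> = 0" using that assms[of k n] by (simp add: sum_subtractf)
    finally show ?thesis .
  qed
  define B where "B = adj_mat C"
  have B: "B \<in> carrier_mat D D" and BC: "B * C = det C \<cdot>\<^sub>m 1\<^sub>m D"
    unfolding B_def using adj_mat[OF C] by auto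
  have "act (det C) (f i) n = 0" if i: "i < D" for i n
  proof -
    have entry: "(\<Sum>k<D. B $$ (i, k) * C $$ (k, j)) = (if j = i then det C else 0)" if "j < D" for j
    proof -
      have "(\<Sum>k<D. B $$ (i, k) * C $$ (k, j)) = (B * C) $$ (i, j)"
        using B C i that by (simp add: scalar_prod_def atLeast0LessThan)
      then show ?thesis using i that unfolding BC by auto
    qed
    have "act (det C) (f i) n = (\<Sum>j<D. if j = i then act (det C) (f i) n else 0)"
      using i by simp
    also have "\<dots> = (\<Sum>j<D. act (\<Sum>k<D. B $$ (i, k) * C $$ (k, j)) (f j) n)"
      by (rule sum.cong) (auto simp: entry)
    also have "\<dots> = (\<Sum>j<D. \<Sum>k<D. act (B $$ (i, k)) (act (C $$ (k, j)) (f j)) n)"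
      by (simp add: act_sum act_mult)
    also have "\<dots> = (\<Sum>k<D. \<Sum>j<D. act (B $$ (i, k)) (act (C $$ (k, j)) (f j)) n)"
      by (rule sum.swap)
    also have "\<dots> = (\<Sum>k<D. act (B $$ (i, k)) (\<lambda>n. \<Sum>j<D. act (C $$ (k, j)) (f j) n) n)"
      by (simp add: act_seq_sum)
    also have "\<dots> = 0"
    proof (rule sum.neutral, rule ballI)
      fix k assume "k \<in> {..<D}"
      then have "(\<lambda>n. \<Sum>j<D. act (C $$ (k, j)) (f j) n) = (\<lambda>_. 0)" using row by auto
      then show "act (B $$ (i, k)) (\<lambda>n. \<Sum>j<D. act (C $$ (k, j)) (f j) n) n = 0"
        by (simp only: act_seq_zero)
    qed
    finally show ?thesis .
  qed
  moreover have "degree (det C) = D \<and> coeff (det C) D = 1"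
    using degree_monic_char_poly[OF A] unfolding C_def char_poly_def .
  ultimately show ?thesis by auto
qed

lemma shift_family:
  fixes f :: "'i \<Rightarrow> nat \<Rightarrow> 'a::comm_ring_1"
  assumes "finite I" "\<And>i n. i \<in> I \<Longrightarrow> f i (Suc n) = (\<Sum>j\<in>I. M i j * f j n)"
  shows "\<exists>P. lead_coeff P = 1 \<and> degree P = card I \<and> (\<forall>i\<in>I. \<forall>n. act P (f i) n = 0)"
proof -
  obtain h where h: "bij_betw h {..<card I} I"
    using ex_bij_betw_nat_finite[OF assms(1)] by (auto simp: atLeast0LessThan)
  have "\<exists>P. lead_coeff P = 1 \<and> degree P = card I \<and> (\<forall>i<card I. \<forall>n. act P (f (h i)) n = 0)"
  proof (rule shift_family_nat[where M = "\<lambda>i j. M (h i) (h j)"])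
    fix i n assume "i < card I"
    then have "h i \<in> I" using h by (auto simp: bij_betw_def)
    then have "f (h i) (Suc n) = (\<Sum>j\<in>I. M (h i) j * f j n)" by (rule assms(2))
    also have "\<dots> = (\<Sum>j<card I. M (h i) (h j) * f (h j) n)"
      by (rule sum.reindex_bij_betw[OF h, symmetric])
    finally show "f (h i) (Suc n) = (\<Sum>j<card I. M (h i) (h j) * f (h j) n)" .
  qed
  then obtain P where P: "lead_coeff P = 1" "degree P = card I"
    "\<And>i n. i < card I \<Longrightarrow> act P (f (h i)) n = 0" by blast
  have "act P (f i) n = 0" if "i \<in> I" for i n
  proof -
    obtain k where "k < card I" "i = h k" using h \<open>i \<in> I\<close> unfolding bij_betw_def by blast
    then show ?thesis using P(3) by simp
  qed
  with P(1,2) show ?thesis by blast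
qed

section \<open>Closure properties of recurrence sequences\<close>

definition is_lrs :: "(nat \<Rightarrow> int) \<Rightarrow> bool" where
  "is_lrs u \<longleftrightarrow> (\<exists>a. satisfies_recurrence a u)"

lemma is_lrs_of_monic:
  assumes "lead_coeff P = 1" "degree P \<ge> 1" "\<And>n. act P u n = 0"
  shows "is_lrs u"
  unfolding is_lrs_def by (rule recurrence_of_monic[OF assms]) blast+

lemma is_lrs_shift_family:
  fixes f :: "'i \<Rightarrow> nat \<Rightarrow> int"
  assumes "finite I" "\<And>i n. i \<in> I \<Longrightarrow> f i (Suc n) = (\<Sum>j\<in>I. M i j * f j n)" "i \<in> I"
  shows "is_lrs (f i)"
proof -
  obtain P where P: "lead_coeff P = 1" "degree P = card I" "\<And>i n. i \<in> I \<Longrightarrow> act P (f i) n = 0"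
    using shift_family[where f = f and I = I and M = M] assms(1,2) by blast
  have "card I > 0" using assms(1,3) card_gt_0_iff by blast
  then show ?thesis using P assms(3) by (intro is_lrs_of_monic[of P]) simp_all
qed

lemma is_lrs_add: "is_lrs u \<Longrightarrow> is_lrs v \<Longrightarrow> is_lrs (\<lambda>n. u n + v n)"
proof -
  assume "is_lrs u" "is_lrs v"
  then obtain a b where ab: "satisfies_recurrence a u" "satisfies_recurrence b v"
    unfolding is_lrs_def by blast
  let ?p = "characteristic_poly a" and ?q = "characteristic_poly b"
  have "lead_coeff (?p * ?q) = 1" by (simp add: lead_coeff_mult)
  moreover have "degree (?p * ?q) \<ge> 1"
    using ab(1) by (subst degree_mult_eq) (auto simp: satisfies_recurrence_def Suc_le_eq)
  moreover have "act (?p * ?q) (\<lambda>n. u n + v n) n = 0" for n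
  proof -
    have "act ?p u = (\<lambda>_. 0)" "act ?q v = (\<lambda>_. 0)" using ab by (auto simp: satisfies_recurrence_iff)
    then have "act (?q * ?p) u n = 0" "act (?p * ?q) v n = 0" by (simp_all only: act_mult act_seq_zero)
    then show ?thesis by (simp add: act_seq_add mult.commute)
  qed
  ultimately show ?thesis by (rule is_lrs_of_monic)
qed

text \<open>The products of a shift of \<open>u\<close> with a shift of \<open>v\<close>, taken over
  one basis range each, form a finite family stable under the shift.\<close>

lemma is_lrs_mult: "is_lrs u \<Longrightarrow> is_lrs v \<Longrightarrow> is_lrs (\<lambda>n. u n * v n)"
proof -
  assume "is_lrs u" "is_lrs v"
  then obtain a b where ab: "satisfies_recurrence a u" "satisfies_recurrence b v"
    unfolding is_lrs_def by blast
  define f where "f = (\<lambda>(i, j) n. u (n + i) * v (n + j))"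
  define M where "M = (\<lambda>(i, j) (k, l). basis_solution a k (Suc i) * basis_solution b l (Suc j))"
  have "is_lrs (f (0, 0))"
  proof (rule is_lrs_shift_family[of "{..<length a} \<times> {..<length b}" f M])
    fix x n assume "x \<in> {..<length a} \<times> {..<length b}"
    obtain i j where x: "x = (i, j)" by force
    have "f x (Suc n) = u (n + Suc i) * v (n + Suc j)" by (simp add: f_def x)
    also have "\<dots> = (\<Sum>k<length a. basis_solution a k (Suc i) * u (n + k)) *
        (\<Sum>l<length b. basis_solution b l (Suc j) * v (n + l))"
      by (rule arg_cong2[where f = "(*)", OF addition_formula[OF ab(1)] addition_formula[OF ab(2)]])
    also have "\<dots> = (\<Sum>y\<in>{..<length a} \<times> {..<length b}. M x y * f y n)"
      unfolding sum_product sum.cartesian_product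
      by (rule sum.cong) (auto simp: M_def f_def x)
    finally show "f x (Suc n) = (\<Sum>y\<in>{..<length a} \<times> {..<length b}. M x y * f y n)" .
  qed (use ab in \<open>auto simp: satisfies_recurrence_def\<close>)
  then show ?thesis by (simp add: f_def)
qed

lemma is_lrs_progression: "is_lrs u \<Longrightarrow> is_lrs (\<lambda>n. u (N * n + r))"
proof -
  assume "is_lrs u"
  then obtain a where a: "satisfies_recurrence a u" unfolding is_lrs_def by blast
  define f where "f = (\<lambda>i n. u (N * n + r + i))"
  have "is_lrs (f 0)"
  proof (rule is_lrs_shift_family[of "{..<length a}" f "\<lambda>i k. basis_solution a k (N + i)"])
    fix i n
    show "f i (Suc n) = (\<Sum>k<length a. basis_solution a k (N + i) * f k n)"
      using addition_formula[OF a, of "N * n + r" "N + i"] by (simp add: f_def algebra_simps)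
  qed (use a in \<open>auto simp: satisfies_recurrence_def\<close>)
  then show ?thesis by (simp add: f_def)
qed

lemma is_lrs_const: "is_lrs (\<lambda>_. c)"
  unfolding is_lrs_def by (rule exI[of _ "[1]"]) (simp add: satisfies_recurrence_def)

lemma is_lrs_sum: "(\<And>i. i \<in> I \<Longrightarrow> is_lrs (u i)) \<Longrightarrow> is_lrs (\<lambda>n. \<Sum>i\<in>I. u i n)"
  by (induction I rule: infinite_finite_induct) (simp_all add: is_lrs_const is_lrs_add)

lemma is_lrs_power: "is_lrs u \<Longrightarrow> is_lrs (\<lambda>n. u n ^ k)"
  by (induction k) (simp_all add: is_lrs_const is_lrs_mult)

text \<open>The subsequences \<open>v (r + N * m + i)\<close> with \<open>i < length a\<close> form
  a family stable under the step in \<open>m\<close>. Hence each of them satisfies a monic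
  recurrence of order \<open>length a\<close>, and that many zeros suffice.\<close>

lemma progression_zero:
  assumes "satisfies_recurrence a v" "\<And>m. m < length a \<Longrightarrow> v (r + N * m) = 0"
  shows "v (r + N * m) = 0"
proof -
  define f where "f i m = v (r + N * m + i)" for i m
  have "f i (Suc m) = (\<Sum>k<length a. basis_solution a k (N + i) * f k m)" for i m
    using addition_formula[OF assms(1), of "r + N * m" "N + i"] by (simp add: f_def algebra_simps)
  then obtain P where P: "lead_coeff P = 1" "degree P = card {..<length a}"
    "\<forall>i\<in>{..<length a}. \<forall>n. act P (f i) n = 0"
    using shift_family[of "{..<length a}" f "\<lambda>i k. basis_solution a k (N + i)"] by auto
  have "f 0 m = 0"
  proof (rule monic_recurrence_zero[OF P(1,2)])
    show "act P (f 0) n = 0" for n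
      using P(3) assms(1) by (auto simp: satisfies_recurrence_def)
    show "f 0 n = 0" if "n < card {..<length a}" for n using assms(2) that by (simp add: f_def)
  qed
  then show ?thesis by (simp add: f_def)
qed

text \<open>The bound is the size of a shift-stable family that contains both sides.\<close>

lemma progression_product_eq:
  assumes "satisfies_recurrence a u" "satisfies_recurrence b w" "satisfies_recurrence c t"
    and "\<And>m. m < length b + length a * length c \<Longrightarrow> w (r + N * m) = u (r + N * m) * t (r + N * m)"
  shows "w (r + N * m) = u (r + N * m) * t (r + N * m)"
proof -
  define I where "I = {..<length b} <+> ({..<length a} \<times> {..<length c})"
  define f :: "nat + nat \<times> nat \<Rightarrow> nat \<Rightarrow> int" where
    "f x m = (case x of Inl i \<Rightarrow> w (r + N * m + i) | Inr (i, j) \<Rightarrow> u (r + N * m + i) * t (r + N * m + j))"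
    for x m
  define M :: "nat + nat \<times> nat \<Rightarrow> nat + nat \<times> nat \<Rightarrow> int" where
    "M x y = (case x of
        Inl i \<Rightarrow> (case y of Inl k \<Rightarrow> basis_solution b k (N + i) | Inr _ \<Rightarrow> 0)
      | Inr (i, j) \<Rightarrow> (case y of Inl _ \<Rightarrow> 0
          | Inr (k, l) \<Rightarrow> basis_solution a k (N + i) * basis_solution c l (N + j)))" for x y
  have ne: "a \<noteq> []" "b \<noteq> []" "c \<noteq> []" using assms by (auto simp: satisfies_recurrence_def)
  have "f x (Suc n) = (\<Sum>y\<in>I. M x y * f y n)" for x n
  proof (cases x)
    case (Inl i)
    have "f x (Suc n) = w (r + N * n + (N + i))" by (simp add: f_def Inl algebra_simps)
    also have "\<dots> = (\<Sum>k<length b. basis_solution b k (N + i) * w (r + N * n + k))"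
      by (rule addition_formula[OF assms(2)])
    also have "\<dots> = (\<Sum>y\<in>I. M x y * f y n)"
      unfolding I_def by (subst sum.Plus) (simp_all add: M_def f_def Inl)
    finally show ?thesis .
  next
    case (Inr y)
    obtain i j where x: "x = Inr (i, j)" using Inr by (cases y) auto
    have "f x (Suc n) = u (r + N * n + (N + i)) * t (r + N * n + (N + j))"
      by (simp add: f_def x algebra_simps)
    also have "\<dots> = (\<Sum>k<length a. basis_solution a k (N + i) * u (r + N * n + k)) *
        (\<Sum>l<length c. basis_solution c l (N + j) * t (r + N * n + l))"
      by (rule arg_cong2[where f = "(*)", OF addition_formula[OF assms(1)] addition_formula[OF assms(3)]])
    also have "\<dots> = (\<Sum>z\<in>{..<length a} \<times> {..<length c}. M x (Inr z) * f (Inr z) n)"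
      unfolding sum_product sum.cartesian_product
      by (rule sum.cong) (auto simp: M_def f_def x)
    also have "\<dots> = (\<Sum>y\<in>I. M x y * f y n)"
      unfolding I_def by (subst sum.Plus) (simp_all add: M_def x)
    finally show ?thesis .
  qed
  moreover have "finite I" "card I = length b + length a * length c"
    by (simp_all add: I_def card_Plus card_cartesian_product)
  ultimately obtain P where P: "lead_coeff P = 1" "degree P = length b + length a * length c"
    "\<forall>x\<in>I. \<forall>n. act P (f x) n = 0"
    using shift_family[of I f M] by auto
  have I: "Inl 0 \<in> I" "Inr (0, 0) \<in> I" using ne by (auto simp: I_def)
  have "(\<lambda>m. f (Inl 0) m - f (Inr (0, 0)) m) m = 0"
  proof (rule monic_recurrence_zero[OF P(1,2)])
    show "act P (\<lambda>m. f (Inl 0) m - f (Inr (0, 0)) m) n = 0" for n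
      using P(3) I by (simp only: act_seq_diff)
    show "f (Inl 0) n - f (Inr (0, 0)) n = 0" if "n < length b + length a * length c" for n
      using assms(4)[OF that] by (simp add: f_def)
  qed
  then show ?thesis by (simp add: f_def)
qed

section \<open>Linear algebra over the rationals\<close>

text \<open>The Fredholm alternative, by induction on the number of vectors. If the new vector
  depends on the others, it changes nothing; otherwise a functional \<open>y0\<close> separates it
  from them and serves to correct both \<open>t\<close> and the functional found for
  \<open>t\<close>.\<close>

lemma span_or_functional:
  fixes h :: "nat \<Rightarrow> 'i \<Rightarrow> 'a::field"
  assumes "finite I"
  shows "(\<exists>c. \<forall>i\<in>I. t i = (\<Sum>j<r. c j * h j i)) \<or>
    (\<exists>y. (\<forall>j<r. (\<Sum>i\<in>I. y i * h j i) = 0) \<and> (\<Sum>i\<in>I. y i * t i) \<noteq> 0)"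
proof (induction r arbitrary: t)
  case 0
  show ?case
  proof (cases "\<forall>i\<in>I. t i = 0")
    case False
    then obtain i0 where i0: "i0 \<in> I" "t i0 \<noteq> 0" by blast
    have "(\<Sum>i\<in>I. (if i = i0 then 1 else 0) * t i) = (\<Sum>i\<in>I. if i = i0 then t i0 else 0)"
      by (rule sum.cong) auto
    then have "(\<Sum>i\<in>I. (if i = i0 then 1 else 0) * t i) \<noteq> 0" using i0 assms by simp
    then show ?thesis by (intro disjI2 exI[of _ "\<lambda>i. if i = i0 then 1 else 0"]) simp
  qed simp
next
  case (Suc r)
  show ?case
  proof (cases "\<exists>c. \<forall>i\<in>I. h r i = (\<Sum>j<r. c j * h j i)")
    case True
    then obtain c where c: "\<forall>i\<in>I. h r i = (\<Sum>j<r. c j * h j i)" by blast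
    from Suc.IH[of t] show ?thesis
    proof (elim disjE exE conjE)
      fix d assume "\<forall>i\<in>I. t i = (\<Sum>j<r. d j * h j i)"
      then have "\<forall>i\<in>I. t i = (\<Sum>j<Suc r. (d(r := 0)) j * h j i)" by simp
      then show ?thesis by blast
    next
      fix y assume y: "\<forall>j<r. (\<Sum>i\<in>I. y i * h j i) = 0" "(\<Sum>i\<in>I. y i * t i) \<noteq> 0"
      have "(\<Sum>i\<in>I. y i * h r i) = (\<Sum>i\<in>I. y i * (\<Sum>j<r. c j * h j i))"
        by (rule sum.cong) (use c in auto)
      also have "\<dots> = (\<Sum>i\<in>I. \<Sum>j<r. c j * (y i * h j i))"
        by (simp add: sum_distrib_left mult.left_commute)
      also have "\<dots> = (\<Sum>j<r. c j * (\<Sum>i\<in>I. y i * h j i))"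
        by (subst sum.swap) (simp add: sum_distrib_left)
      also have "\<dots> = 0" using y by simp
      finally show ?thesis using y by (intro disjI2 exI[of _ y]) (auto simp: less_Suc_eq)
    qed
  next
    case False
    then obtain y0 where y0: "\<forall>j<r. (\<Sum>i\<in>I. y0 i * h j i) = 0" "(\<Sum>i\<in>I. y0 i * h r i) \<noteq> 0"
      using Suc.IH[of "h r"] by blast
    define dot where "dot y t = (\<Sum>i\<in>I. y i * t i)" for y t :: "'i \<Rightarrow> 'a"
    have dot_diff: "dot y (\<lambda>i. s i - c * t i) = dot y s - c * dot y t"
      "dot (\<lambda>i. y i - c * z i) t = dot y t - c * dot z t" for y z s t c
      by (simp_all add: dot_def algebra_simps sum_subtractf sum_distrib_left)
    \<comment> \<open>Chosen such that \<open>y0\<close> annihilates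
      \<open>t - k * h r\<close>.\<close>
    define k where "k = dot y0 t / dot y0 (h r)"
    from Suc.IH[of "\<lambda>i. t i - k * h r i"] show ?thesis
    proof (elim disjE exE conjE)
      fix d assume "\<forall>i\<in>I. t i - k * h r i = (\<Sum>j<r. d j * h j i)"
      then have "\<forall>i\<in>I. t i = (\<Sum>j<Suc r. (d(r := k)) j * h j i)" by (auto simp: algebra_simps)
      then show ?thesis by blast
    next
      fix y assume y: "\<forall>j<r. (\<Sum>i\<in>I. y i * h j i) = 0"
        "(\<Sum>i\<in>I. y i * (t i - k * h r i)) \<noteq> 0"
      \<comment> \<open>The multiple of \<open>y0\<close> makes the value at \<open>h r\<close>
        vanish; the values at the earlier vectors stay \<open>0\<close>, since \<open>y0\<close>
        annihilates them.\<close>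
      let ?z = "\<lambda>i. y i - (dot y (h r) / dot y0 (h r)) * y0 i"
      have d0: "dot y0 (h r) \<noteq> 0" using y0(2) by (simp add: dot_def)
      have "dot ?z t = dot y (\<lambda>i. t i - k * h r i)"
        unfolding dot_diff k_def using d0 by (simp add: field_simps)
      then have "dot ?z t \<noteq> 0" using y(2) by (simp add: dot_def)
      moreover have "dot ?z (h j) = 0" if "j < Suc r" for j
      proof (cases "j = r")
        case True
        show ?thesis unfolding dot_diff True using d0 by simp
      next
        case False
        then have "dot y (h j) = 0" "dot y0 (h j) = 0" using y(1) y0(1) that by (auto simp: dot_def)
        then show ?thesis unfolding dot_diff by simp
      qed
      ultimately obtain z where "\<forall>j<Suc r. dot z (h j) = 0" "dot z t \<noteq> 0"
        by (meson that)
      then show ?thesis unfolding dot_def by (intro disjI2 exI[of _ z] conjI)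
    qed
  qed
qed

text \<open>Descent from complex to rational coefficients: without a rational functional,
  \<open>t\<close> would be a rational combination of the \<open>h j\<close>, and then a complex
  functional annihilating all \<open>h j\<close> would annihilate \<open>t\<close> as well.\<close>

lemma rational_functional:
  fixes h :: "nat \<Rightarrow> 'i \<Rightarrow> rat" and y :: "'i \<Rightarrow> complex"
  assumes "finite I" "\<And>j. j < r \<Longrightarrow> (\<Sum>i\<in>I. y i * of_rat (h j i)) = 0"
    "(\<Sum>i\<in>I. y i * of_rat (t i)) \<noteq> 0"
  shows "\<exists>z :: 'i \<Rightarrow> rat. (\<forall>j<r. (\<Sum>i\<in>I. z i * h j i) = 0) \<and> (\<Sum>i\<in>I. z i * t i) \<noteq> 0"
proof (rule ccontr)
  assume "\<not> ?thesis"
  then obtain c where c: "\<forall>i\<in>I. t i = (\<Sum>j<r. c j * h j i)"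
    using span_or_functional[OF assms(1), where t = t and h = h and r = r] by blast
  have "(\<Sum>i\<in>I. y i * of_rat (t i)) = (\<Sum>i\<in>I. y i * (\<Sum>j<r. of_rat (c j) * of_rat (h j i)))"
    by (rule sum.cong) (use c in \<open>auto simp: of_rat_sum of_rat_mult\<close>)
  also have "\<dots> = (\<Sum>i\<in>I. \<Sum>j<r. of_rat (c j) * (y i * of_rat (h j i)))"
    by (simp add: sum_distrib_left mult.left_commute)
  also have "\<dots> = (\<Sum>j<r. of_rat (c j) * (\<Sum>i\<in>I. y i * of_rat (h j i)))"
    by (subst sum.swap) (simp add: sum_distrib_left)
  also have "\<dots> = 0" using assms(2) by simp
  finally show False using assms(3) by simp
qed

text \<open>The dual descent: a rational functional that separates \<open>t\<close> from the
  \<open>h j\<close> would also rule out a complex combination.\<close>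

lemma rational_combination:
  fixes h :: "nat \<Rightarrow> 'i \<Rightarrow> rat" and c :: "nat \<Rightarrow> complex"
  assumes "finite I" "\<And>i. i \<in> I \<Longrightarrow> of_rat (t i) = (\<Sum>j<r. c j * of_rat (h j i))"
  shows "\<exists>d :: nat \<Rightarrow> rat. \<forall>i\<in>I. t i = (\<Sum>j<r. d j * h j i)"
proof (rule ccontr)
  assume "\<not> ?thesis"
  then obtain y where y: "\<forall>j<r. (\<Sum>i\<in>I. y i * h j i) = 0" "(\<Sum>i\<in>I. y i * t i) \<noteq> 0"
    using span_or_functional[OF assms(1), where t = t and h = h and r = r] by blast
  have "of_rat (\<Sum>i\<in>I. y i * t i) = (\<Sum>i\<in>I. of_rat (y i) * (\<Sum>j<r. c j * of_rat (h j i)))"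
    unfolding of_rat_sum of_rat_mult by (rule sum.cong) (use assms(2) in auto)
  also have "\<dots> = (\<Sum>i\<in>I. \<Sum>j<r. c j * of_rat (y i * h j i))"
    by (simp add: sum_distrib_left of_rat_mult mult.left_commute)
  also have "\<dots> = (\<Sum>j<r. c j * of_rat (\<Sum>i\<in>I. y i * h j i))"
    by (subst sum.swap) (simp add: sum_distrib_left of_rat_sum)
  also have "\<dots> = (0::complex)" using y by simp
  finally show False using y(2) by simp
qed

lemma common_denominator:
  fixes y :: "'i \<Rightarrow> rat"
  assumes "finite I"
  shows "\<exists>d>0. \<exists>z :: 'i \<Rightarrow> int. \<forall>i\<in>I. of_int (z i) = of_int d * y i"
  using assms
proof (induction I)
  case empty
  then show ?case by (intro exI[of _ 1]) simp
next
  case (insert x I)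
  then obtain d z where dz: "d > 0" "\<forall>i\<in>I. of_int (z i) = of_int d * y i" by blast
  obtain p q where pq: "y x = of_int p / of_int q" "q > 0"
    by (metis quotient_of_div quotient_of_denom_pos surj_pair)
  have "\<forall>i\<in>insert x I. of_int (((\<lambda>i. q * z i)(x := d * p)) i) = of_int (d * q) * y i"
    using dz pq insert.hyps by auto
  moreover have "d * q > 0" using dz(1) pq(2) by simp
  ultimately show ?case by blast
qed

section \<open>Non-degeneracy in terms of vanishing on progressions\<close>

definition eventually_zero :: "(nat \<Rightarrow> int) \<Rightarrow> bool" where
  "eventually_zero v \<longleftrightarrow> (\<exists>m. \<forall>n\<ge>m. v n = 0)"

text \<open>A substitute for the condition on quotients of roots that mentions neither roots nor a
  minimal recurrence. It is stable enough to be verified by counting zeros, see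
  \<open>non_degenerate_iff\<close>.\<close>

definition progression_faithful :: "(nat \<Rightarrow> int) \<Rightarrow> bool" where
  "progression_faithful u \<longleftrightarrow>
     (\<forall>c M n. M \<ge> 1 \<longrightarrow> (\<forall>j. act c u (n + M * j) = 0) \<longrightarrow> eventually_zero (act c u))"

lemma geometric_sequence:
  fixes v :: "nat \<Rightarrow> 'a::comm_ring_1"
  assumes "\<And>n. act [:- x, 1:] v n = 0" "v n0 \<noteq> 0"
  shows "\<exists>k. k \<noteq> 0 \<and> (\<forall>n. v n = k * x ^ n)"
proof -
  define k where "k = v 0"
  have "v n = k * x ^ n" for n
  proof (induction n)
    case (Suc n)
    have "v (Suc n) = x * v n" using assms(1)[of n] by (simp add: act_pCons)
    with Suc show ?case by simp
  qed (simp add: k_def)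
  moreover from this[of n0] have "k \<noteq> 0" using assms(2) by auto
  ultimately show ?thesis by blast
qed

lemma linear_factor:
  fixes P :: "complex poly"
  assumes "degree P \<noteq> 0"
  shows "\<exists>x Q. P = [:- x, 1:] * Q"
proof -
  obtain x where "poly P x = 0"
    using assms fundamental_theorem_of_algebra[of P] by (auto simp: constant_degree)
  then show ?thesis by (auto simp: poly_eq_0_iff_dvd dvd_def)
qed

text \<open>Linear factors are split off \<open>P\<close> until the remaining factor no longer
  annihilates \<open>w\<close>. The last factor split off then makes the result geometric.\<close>

lemma eigen_sequence:
  fixes w :: "nat \<Rightarrow> complex"
  assumes "P \<noteq> 0" "\<And>n. act P w n = 0" "w n0 \<noteq> 0"
  shows "\<exists>R x c. poly P x = 0 \<and> c \<noteq> 0 \<and> (\<forall>n. act R w n = c * x ^ n)"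
  using assms(1,2)
proof (induction "degree P" arbitrary: P)
  case 0
  then obtain c where "P = [:c:]" by (metis degree_eq_zeroE)
  then show ?case using 0(2) 0(3)[of n0] assms(3) by (simp add: act_const)
next
  case (Suc d)
  then obtain x Q where PQ: "P = [:- x, 1:] * Q" using linear_factor[of P] by (metis nat.distinct(2))
  then have Q0: "Q \<noteq> 0" using Suc.prems by auto
  show ?case
  proof (cases "\<exists>n. act Q w n \<noteq> 0")
    case True
    then obtain n1 where n1: "act Q w n1 \<noteq> 0" by blast
    have "act [:- x, 1:] (act Q w) n = 0" for n
      by (simp only: act_mult[symmetric] PQ[symmetric] Suc.prems(2))
    then have "\<exists>k. k \<noteq> 0 \<and> (\<forall>n. act Q w n = k * x ^ n)" using n1 by (rule geometric_sequence)
    moreover have "poly P x = 0" by (simp add: PQ)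
    ultimately show ?thesis by blast
  next
    case False
    have "degree P = Suc (degree Q)" unfolding PQ using Q0 by (subst degree_mult_eq) auto
    then have "d = degree Q" using Suc.hyps(2) by simp
    then obtain R y c where "poly Q y = 0" "c \<noteq> 0" "\<forall>n. act R w n = c * y ^ n"
      using Suc.hyps(1)[of Q] Q0 False by blast
    then show ?thesis by (intro exI[of _ R] exI[of _ y] exI[of _ c]) (simp add: PQ)
  qed
qed

text \<open>The value of \<open>g\<close> at \<open>x\<close> is \<open>M * x ^ (M - 1)\<close>: the
  root \<open>x\<close> is simple, so every root of \<open>g\<close> differs from
  \<open>x\<close>.\<close>

lemma power_diff_factor:
  fixes x :: complex
  assumes "M \<ge> 1" "x \<noteq> 0"
  obtains g where "monom 1 M - [:x ^ M:] = [:- x, 1:] * g" "poly g x \<noteq> 0"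
proof -
  define g where "g = (\<Sum>i<M. [:x:] ^ (M - Suc i) * [:0, 1:] ^ i)"
  have "monom 1 M - [:x ^ M:] = [:0, 1:] ^ M - [:x:] ^ M"
    by (simp add: monom_altdef poly_const_pow)
  also have "\<dots> = ([:0, 1:] - [:x:]) * g" unfolding g_def by (rule power_diff_sumr2)
  finally have "monom 1 M - [:x ^ M:] = [:- x, 1:] * g" by simp
  moreover have "poly g x = (\<Sum>i<M. x ^ (M - 1))"
    unfolding g_def poly_sum by (rule sum.cong) (auto simp: poly_power simp flip: power_add)
  then have "poly g x \<noteq> 0" using assms by simp
  ultimately show ?thesis using that by blast
qed

text \<open>For a root \<open>x\<close> of \<open>F\<close>, the operator taking \<open>w n\<close>
  to \<open>w (n + M) - x ^ M * w n\<close> removes the factor of \<open>x\<close> and preserves the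
  zeros at the multiples of \<open>M\<close>. Repeating this until the next result would be zero
  leaves an eigenvector of the shift by \<open>M\<close>.\<close>

lemma power_eigen_sequence:
  fixes w :: "nat \<Rightarrow> complex"
  assumes "F \<noteq> 0" "M \<ge> 1" "poly F 0 \<noteq> 0"
    and "\<And>n. act F w n = 0" "\<And>n. act P w n = 0" "\<And>j. w (M * j) = 0" "w n0 \<noteq> 0"
  shows "\<exists>w' x. poly F x = 0 \<and> (\<forall>n. act P w' n = 0) \<and> (\<forall>j. w' (M * j) = 0) \<and>
    (\<forall>n. w' (n + M) = x ^ M * w' n) \<and> (\<exists>n. w' n \<noteq> 0)"
  using assms(1,3-)
proof (induction "degree F" arbitrary: F w n0)
  case 0
  then obtain c where "F = [:c:]" by (metis degree_eq_zeroE)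
  then show ?case using 0(2) 0(4)[of n0] 0(7) by (simp add: act_const)
next
  case (Suc d)
  then obtain x G where FG: "F = [:- x, 1:] * G" using linear_factor[of F] by (metis nat.distinct(2))
  have G0: "G \<noteq> 0" "poly G 0 \<noteq> 0" and x0: "x \<noteq> 0" using Suc.prems(1,2) FG by auto
  obtain g where g: "monom 1 M - [:x ^ M:] = [:- x, 1:] * g"
    using power_diff_factor[OF assms(2) x0] by blast
  define w' where "w' = act (monom 1 M - [:x ^ M:]) w"
  have w': "w' n = w (n + M) - x ^ M * w n" for n
    by (simp add: w'_def act_diff act_monom act_const)
  show ?case
  proof (cases "\<exists>n. w' n \<noteq> 0")
    case True
    then obtain n1 where n1: "w' n1 \<noteq> 0" by blast
    have "act G w' n = 0" for n
    proof -
      have "act G w' n = act (g * F) w n"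
        unfolding w'_def act_mult[symmetric] g FG by (simp only: mult_ac)
      also have "act F w = (\<lambda>_. 0)" using Suc.prems(3) by auto
      then have "act (g * F) w n = 0" by (simp add: act_mult)
      finally show ?thesis .
    qed
    moreover have "act P w' n = 0" for n
    proof -
      have "act P w = (\<lambda>_. 0)" using Suc.prems(4) by auto
      then show ?thesis unfolding w'_def by (subst act_commute) simp
    qed
    moreover have "w' (M * j) = 0" for j
      using Suc.prems(5)[of j] Suc.prems(5)[of "Suc j"] by (simp add: w' algebra_simps)
    moreover have "d = degree G"
    proof -
      have "degree F = Suc (degree G)" unfolding FG using G0 by (subst degree_mult_eq) auto
      then show ?thesis using Suc.hyps(2) by simp
    qed
    ultimately have "\<exists>v y. poly G y = 0 \<and> (\<forall>n. act P v n = 0) \<and> (\<forall>j. v (M * j) = 0) \<and>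
        (\<forall>n. v (n + M) = y ^ M * v n) \<and> (\<exists>n. v n \<noteq> 0)"
      using Suc.hyps(1)[of G w' n1] G0 n1 by blast
    then show ?thesis unfolding FG by auto
  next
    case False
    then have "\<forall>n. w (n + M) = x ^ M * w n" using w' by simp
    then show ?thesis
      using Suc.prems(4-6) FG by (intro exI[of _ w] exI[of _ x]) auto
  qed
qed

text \<open>A counterexample yields a nonzero eigenvector \<open>w'\<close> of the shift by
  \<open>M\<close> with \<open>w' 0 = 0\<close> and eigenvalue \<open>x ^ M\<close>. It is not
  geometric with ratio \<open>x\<close>, so after application of the factor of \<open>x\<close> a
  second root \<open>y\<close> of the recurrence with \<open>y ^ M = x ^ M\<close> comes to
  light.\<close>

lemma non_degenerate_imp_faithful:
  assumes "non_degenerate u" shows "progression_faithful u"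
  unfolding progression_faithful_def
proof (intro allI impI)
  fix c M n0 assume M: "1 \<le> M" and zero: "\<forall>j. act c u (n0 + M * j) = 0"
  obtain a where a: "satisfies_recurrence a u"
    and nd: "\<And>x y m. x \<in> characteristic_roots a \<Longrightarrow> y \<in> characteristic_roots a \<Longrightarrow>
      x \<noteq> y \<Longrightarrow> m \<ge> 1 \<Longrightarrow> (x / y) ^ m \<noteq> 1"
    using assms unfolding non_degenerate_def minimal_recurrence_def by blast
  show "eventually_zero (act c u)"
  proof (rule ccontr)
    assume nz: "\<not> eventually_zero (act c u)"
    define P :: "complex poly" where "P = map_poly of_int (characteristic_poly a)"
    have P0: "P \<noteq> 0" unfolding P_def by simp
    \<comment> \<open>The root \<open>0\<close> affects only the first \<open>e\<close> terms; the
      rest is annihilated by \<open>P1\<close>, whose roots are nonzero.\<close>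
    define e where "e = order 0 P"
    obtain P1 where P1: "P = [:- 0, 1:] ^ e * P1" "\<not> [:- 0, 1:] dvd P1"
      using order_decomp[OF P0, of 0] unfolding e_def by blast
    have P1_0: "poly P1 0 \<noteq> 0" using P1(2) by (simp only: poly_eq_0_iff_dvd not_False_eq_True)
    then have P1_nz: "P1 \<noteq> 0" by auto
    have Pe: "P = monom 1 e * P1" using P1(1) by (simp add: monom_altdef)
    define v where "v n = (of_int (act c u n) :: complex)" for n
    have "act P v n = 0" for n
      using recurrence_act[OF a, of c]
      unfolding P_def v_def act_of_int by (simp add: satisfies_recurrence_iff)
    then have v1: "act P1 v (n + e) = 0" for n
      unfolding Pe act_mult act_monom by simp
    \<comment> \<open>This offset moves the progression to the multiples of \<open>M\<close> and
      skips at least the first \<open>e\<close> terms.\<close>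
    define w where "w n = v (n + (n0 + M * e))" for n
    have w1: "act P1 w n = 0" for n
    proof -
      have "n + (n0 + M * e) = (n + n0 + (M - 1) * e) + e" using M by (cases M) simp_all
      then show ?thesis unfolding w_def act_shift by (simp only: v1)
    qed
    have w2: "w (M * j) = 0" for j
      using zero[rule_format, of "j + e"] by (simp add: w_def v_def algebra_simps)
    obtain n1 where w3: "w n1 \<noteq> 0"
    proof -
      obtain n where "n \<ge> n0 + M * e" "act c u n \<noteq> 0" using nz unfolding eventually_zero_def by blast
      then show ?thesis using that[of "n - (n0 + M * e)"] by (simp add: w_def v_def)
    qed
    obtain w' x where x: "poly P1 x = 0" and w'P: "\<And>n. act P1 w' n = 0" and w'0: "\<And>j. w' (M * j) = 0"
      and w'M: "\<And>n. w' (n + M) = x ^ M * w' n" and w'nz: "\<exists>n. w' n \<noteq> 0"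
      using power_eigen_sequence[OF P1_nz M P1_0 w1 w1 w2 w3] by blast
    have x0: "x \<noteq> 0" using x P1_0 by auto
    obtain g where g: "monom 1 M - [:x ^ M:] = [:- x, 1:] * g" "poly g x \<noteq> 0"
      using power_diff_factor[OF M x0] by blast
    define w2 where "w2 = act [:- x, 1:] w'"
    show False
    proof (cases "\<exists>n. w2 n \<noteq> 0")
      case False
      then have "act [:- x, 1:] w' n = 0" for n by (simp add: w2_def)
      moreover obtain n where "w' n \<noteq> 0" using w'nz by blast
      ultimately obtain k where k: "k \<noteq> 0" "\<forall>n. w' n = k * x ^ n"
        using geometric_sequence[of x w' n] by blast
      have "w' 0 = 0" using w'0[of 0] by simp
      then show False using k(1) k(2)[rule_format, of 0] by simp
    next
      case True
      then obtain n2 where n2: "w2 n2 \<noteq> 0" by blast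
      have "act P1 w' = (\<lambda>_. 0)" using w'P by auto
      then have "act P1 w2 n = 0" for n unfolding w2_def by (subst act_commute) simp
      then obtain R y k where y: "poly P1 y = 0" "k \<noteq> 0" "\<forall>n. act R w2 n = k * y ^ n"
        using eigen_sequence[of P1 w2 n2] P1_nz n2 by blast
      have "act g w2 n = 0" for n
      proof -
        have "act g w2 n = act (monom 1 M - [:x ^ M:]) w' n"
          unfolding w2_def act_mult[symmetric] g(1) by (simp only: mult.commute)
        then show ?thesis by (simp add: act_diff act_monom act_const w'M)
      qed
      then have "act g w2 = (\<lambda>_. 0)" by auto
      then have "act g (act R w2) 0 = 0" by (subst act_commute) simp
      moreover have "act R w2 = (\<lambda>n. k * y ^ n)" using y(3) by auto
      ultimately have gy: "poly g y = 0" using y(2) by (simp add: act_seq_smult act_power)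
      then have "poly (monom 1 M - [:x ^ M:]) y = 0" unfolding g(1) by simp
      then have "y ^ M = x ^ M" by (simp add: poly_monom)
      then have "(x / y) ^ M = 1" using x0 by (simp add: power_divide)
      moreover have "x \<in> characteristic_roots a" "y \<in> characteristic_roots a"
        using x y(1) Pe unfolding characteristic_roots_def P_def[symmetric] by auto
      moreover have "x \<noteq> y" using gy g(2) by auto
      ultimately show False using nd[of x y M] M by blast
    qed
  qed
qed

text \<open>Gauss's lemma: contents are multiplicative, so the cofactor absorbs the constant
  \<open>k\<close>.\<close>

lemma dvd_of_primitive_dvd_smult:
  fixes g P :: "int poly"
  assumes "content g = 1" "k \<noteq> 0" "g dvd smult k P"
  shows "g dvd P"
proof -
  obtain Q where Q: "smult k P = g * Q" using assms(3) by (auto simp: dvd_def)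
  have "content (smult k P) = content Q" unfolding Q content_mult assms(1) by simp
  then have "k dvd content Q" by (metis content_smult dvd_normalize_iff dvd_triv_left dvd_mult2 normalize_dvd_iff)
  then obtain Q' where "Q = smult k Q'"
    by (metis const_poly_dvd_iff_dvd_content dvd_def mult_smult_left mult_1 smult_one)
  then have "smult k P = smult k (g * Q')" using Q by simp
  then have "P = g * Q'" using assms(2) by (intro poly_eqI) (metis coeff_smult mult_cancel_left)
  then show ?thesis by simp
qed

text \<open>
  The integral annihilators of \<open>u\<close> are the multiples of one polynomial, which is monic since it
  divides the characteristic polynomial.
\<close>

lemma minimal_recurrence_annihilator:
  assumes min: "minimal_recurrence a u" and g: "g \<noteq> 0" "\<And>n. act g u n = 0"
    and a2: "length a \<ge> 2"
  shows "length a \<le> degree g"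
proof -
  let ?P = "characteristic_poly a"
  have a: "satisfies_recurrence a u" and le: "\<And>b. satisfies_recurrence b u \<Longrightarrow> length a \<le> length b"
    using min unfolding minimal_recurrence_def by auto
  define A where "A g \<longleftrightarrow> g \<noteq> 0 \<and> (\<forall>n. act g u n = 0)" for g
  obtain g0 where g0: "A g0" and g0_min: "\<And>h. A h \<Longrightarrow> degree g0 \<le> degree h"
    using ex_has_least_nat[of A g degree] g unfolding A_def by blast
  define g1 where "g1 = primitive_part g0"
  have g01: "g0 = smult (content g0) g1" unfolding g1_def by simp
  have g1: "A g1"
  proof -
    have "content g0 * act g1 u n = 0" for n
      using g0 g01 unfolding A_def by (metis act_smult)
    then show ?thesis using g0 unfolding A_def g1_def by auto
  qed
  have cont: "content g1 = 1" using g0 unfolding g1_def A_def by simp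
  have deg: "degree g1 = degree g0" unfolding g1_def by simp
  \<comment> \<open>Pseudo-division stays within integer coefficients. Its remainder annihilates
    \<open>u\<close> as well, so it vanishes by minimality of the degree.\<close>
  define Q r where "Q = fst (pseudo_divmod ?P g1)" and "r = snd (pseudo_divmod ?P g1)"
  have g1nz: "g1 \<noteq> 0" using g1 unfolding A_def by simp
  let ?k = "coeff g1 (degree g1) ^ (Suc (degree ?P) - degree g1)"
  have div: "smult ?k ?P = g1 * Q + r" "r = 0 \<or> degree r < degree g1"
    using pseudo_divmod[OF g1nz, of ?P Q r] unfolding Q_def r_def by auto
  have "r = 0"
  proof (rule ccontr)
    assume "r \<noteq> 0"
    moreover have "act r u n = 0" for n
    proof -
      have "r = smult ?k ?P - Q * g1" using div(1) by (simp add: mult.commute)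
      moreover have "act g1 u = (\<lambda>_. 0)" using g1 unfolding A_def by auto
      ultimately show ?thesis
        using a by (simp add: act_diff act_smult act_mult satisfies_recurrence_iff)
    qed
    ultimately have "degree g0 \<le> degree r" using g0_min unfolding A_def by blast
    then show False using div(2) \<open>r \<noteq> 0\<close> deg by simp
  qed
  then have "g1 dvd smult ?k ?P" using div(1) by simp
  then have "g1 dvd ?P" by (rule dvd_of_primitive_dvd_smult[OF cont, rotated]) (use g1nz in simp)
  then obtain h where h: "?P = g1 * h" by (auto simp: dvd_def)
  have "lead_coeff g1 * lead_coeff h = 1"
    using h lead_coeff_mult[of g1 h] by (metis coeff_characteristic_poly_length degree_characteristic_poly)
  then have lc: "lead_coeff g1 * lead_coeff g1 = 1" by (auto simp: zmult_eq_1_iff)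
  define g2 where "g2 = smult (lead_coeff g1) g1"
  have g2: "lead_coeff g2 = 1" "act g2 u n = 0" for n
    using lc g1 by (auto simp: g2_def A_def act_smult)
  have dg2: "degree g2 = degree g0" using lc deg by (auto simp: g2_def)
  \<comment> \<open>A recurrence has order at least \<open>1\<close>, although the constant
    \<open>1\<close> annihilates the zero sequence. The assumption on \<open>length a\<close>
    excludes that sequence.\<close>
  have "degree g2 \<noteq> 0"
  proof
    assume "degree g2 = 0"
    then have "g2 = 1" using g2(1) by (metis degree_eq_zeroE lead_coeff_pCons(2) one_pCons degree_0 coeff_pCons_0)
    then have "u n = 0" for n using g2(2)[of n] by (simp add: act_const one_pCons)
    then have "satisfies_recurrence [0] u" by (simp add: satisfies_recurrence_def)
    then show False using le[of "[0]"] a2 by simp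
  qed
  then obtain b where "length b = degree g2" "satisfies_recurrence b u"
    using recurrence_of_monic[OF g2(1) _ g2(2)] by auto
  then have "length a \<le> degree g0" using le dg2 by metis
  also have "\<dots> \<le> degree g" using g0_min g unfolding A_def by blast
  finally show ?thesis .
qed

definition poly_of :: "nat \<Rightarrow> (nat \<Rightarrow> 'a::zero) \<Rightarrow> 'a poly" where
  "poly_of k z = Poly (map z [0..<k])"

lemma act_poly_of: "act (poly_of k z) u n = (\<Sum>i<k. z i * u (n + i))"
proof (cases "k = 0")
  case True
  then show ?thesis by (simp add: poly_of_def)
next
  case False
  have c: "coeff (poly_of k z) i = (if i < k then z i else 0)" for i
    by (simp add: poly_of_def nth_default_def)
  have "degree (poly_of k z) \<le> k - 1"
    by (rule degree_le) (use False in \<open>auto simp: c\<close>)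
  then have "act (poly_of k z) u n = (\<Sum>i<k. coeff (poly_of k z) i * u (n + i))"
    using False by (intro act_eq_sum) simp
  then show ?thesis by (simp add: c)
qed

text \<open>A complex relation between shifts, read at the first \<open>length a\<close> indices, is
  a linear system with integer coefficients. A rational solution exists as well, and cleared of
  denominators it annihilates \<open>u\<close> everywhere.\<close>

lemma minimal_recurrence_complex:
  fixes R :: "complex poly"
  assumes min: "minimal_recurrence a u" and R: "R \<noteq> 0" "degree R < length a" and a2: "length a \<ge> 2"
  shows "\<exists>n. act R (\<lambda>n. of_int (u n)) n \<noteq> 0"
proof (rule ccontr)
  assume "\<not> ?thesis"
  then have zero: "act R (\<lambda>n. of_int (u n)) n = 0" for n by blast
  have a: "satisfies_recurrence a u" using min unfolding minimal_recurrence_def by simp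
  define s where "s = degree R"
  have lc: "coeff R s \<noteq> 0" using R(1) by (simp add: s_def)
  define c where "c i = - coeff R i / coeff R s" for i
  have "of_int (u (n + s)) = (\<Sum>j<s. c j * of_int (u (n + j)))" for n
  proof -
    have "0 = (\<Sum>i<Suc s. coeff R i * of_int (u (n + i)))"
      using zero[of n] act_eq_sum[of R "Suc s"] by (simp add: s_def)
    then have "coeff R s * of_int (u (n + s)) = - (\<Sum>i<s. coeff R i * of_int (u (n + i)))"
      by (simp add: algebra_simps eq_neg_iff_add_eq_0)
    then have "of_int (u (n + s)) = - (\<Sum>i<s. coeff R i * of_int (u (n + i))) / coeff R s"
      using lc by (simp add: field_simps)
    then show ?thesis by (simp add: c_def sum_divide_distrib sum_negf)
  qed
  then obtain d :: "nat \<Rightarrow> rat" where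
    d: "\<And>n. n < length a \<Longrightarrow> of_int (u (n + s)) = (\<Sum>j<s. d j * of_int (u (n + j)))"
    using rational_combination[where I = "{..<length a}" and t = "\<lambda>n. of_int (u (n + s))" and r = s
        and c = c and h = "\<lambda>j n. of_int (u (n + j))"] by auto
  obtain D z where D: "D > 0" and z: "\<forall>j<s. of_int (z j) = of_int D * d j"
    using common_denominator[of "{..<s}" d] by auto
  define g where "g = monom D s - poly_of s z"
  have g_act: "act g u n = D * u (n + s) - (\<Sum>j<s. z j * u (n + j))" for n
    by (simp add: g_def act_diff act_monom act_poly_of)
  have "act g u n = 0" if "n < length a" for n
  proof -
    have "(of_int (\<Sum>j<s. z j * u (n + j)) :: rat) = (\<Sum>j<s. of_int D * (d j * of_int (u (n + j))))"
      using z by (simp add: mult.assoc)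
    also have "\<dots> = of_int D * of_int (u (n + s))"
      unfolding d[OF that] by (simp add: sum_distrib_left)
    finally have "(of_int (\<Sum>j<s. z j * u (n + j)) :: rat) = of_int (D * u (n + s))" by simp
    then show ?thesis unfolding g_act by (simp only: of_int_eq_iff)
  qed
  then have g_zero: "act g u n = 0" for n
    using solutions_eqI[OF recurrence_act[OF a, of g] recurrence_act[OF a, of 0], of n] by simp
  have "coeff (poly_of s z) i = 0" if "i \<ge> s" for i
    using that by (simp add: poly_of_def nth_default_def)
  then have cg: "coeff g s = D" "\<And>i. i > s \<Longrightarrow> coeff g i = 0" by (auto simp: g_def)
  then have "g \<noteq> 0" using D by auto
  moreover have "degree g \<le> s" by (rule degree_le) (use cg in auto)
  ultimately show False
    using minimal_recurrence_annihilator[OF min _ g_zero a2] R(2) s_def by fastforce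
qed

text \<open>Let \<open>x\<close> and \<open>y\<close> be distinct roots with
  \<open>x ^ M = y ^ M\<close>. By minimality, the characteristic polynomial divided by either
  root's factor maps \<open>u\<close> to a nonzero multiple of the powers of that root. So the
  sequence \<open>x ^ n - y ^ n\<close>, zero at all multiples of \<open>M\<close>, is a complex
  combination of shifts of \<open>u\<close>; \<open>rational_functional\<close> replaces it by an
  integer one.\<close>

lemma degenerate_imp_not_faithful:
  assumes "is_lrs u" "\<not> non_degenerate u" shows "\<not> progression_faithful u"
proof -
  obtain a where min: "minimal_recurrence a u"
  proof -
    obtain b where "satisfies_recurrence b u" using assms(1) unfolding is_lrs_def by blast
    then show ?thesis
      using ex_has_least_nat[of "\<lambda>a. satisfies_recurrence a u" b length] that
      unfolding minimal_recurrence_def by blast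
  qed
  then have a: "satisfies_recurrence a u" unfolding minimal_recurrence_def by simp
  define P :: "complex poly" where "P = map_poly of_int (characteristic_poly a)"
  have dP: "degree P = length a" unfolding P_def by simp
  have P0: "P \<noteq> 0" unfolding P_def by simp
  obtain x y M where xy: "poly P x = 0" "poly P y = 0" "x \<noteq> y" "M \<ge> 1" "(x / y) ^ M = 1"
    using assms(2) min unfolding non_degenerate_def characteristic_roots_def P_def by blast
  have y0: "y \<noteq> 0" using xy(4,5) by (cases "y = 0") (auto simp: power_0_left)
  then have xyM: "x ^ M = y ^ M" using xy(5) by (simp add: power_divide)
  obtain P' where P': "P = [:- x, 1:] * P'" using xy(1) by (auto simp: poly_eq_0_iff_dvd dvd_def)
  then have "poly P' y = 0" using xy(2,3) by simp
  then obtain R where R: "P' = [:- y, 1:] * R" by (auto simp: poly_eq_0_iff_dvd dvd_def)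
  have R0: "R \<noteq> 0" using P0 P' R by auto
  have lin: "degree ([:- s, 1:] * Q) = Suc (degree Q)" "[:- s, 1:] * Q \<noteq> 0"
    if "Q \<noteq> 0" for s :: complex and Q
    using that by (subst degree_mult_eq, simp_all only: mult_eq_0_iff) auto
  have "degree P = Suc (Suc (degree R))"
    unfolding P' R by (simp only: lin R0 not_False_eq_True)
  then have dR: "length a = Suc (Suc (degree R))" using dP by simp
  define uc where "uc n = (of_int (u n) :: complex)" for n
  have uP: "act P uc n = 0" for n
    using a unfolding P_def uc_def act_of_int by (simp add: satisfies_recurrence_iff)
  have geom: "\<exists>k. k \<noteq> 0 \<and> (\<forall>n. act ([:- s, 1:] * R) uc n = k * t ^ n)"
    if "P = [:- t, 1:] * ([:- s, 1:] * R)" for s t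
  proof -
    let ?G = "[:- s, 1:] * R"
    have "?G \<noteq> 0" "degree ?G < length a" unfolding dR lin(1)[OF R0] using lin(2)[OF R0] by simp_all
    then obtain n where n: "act ?G uc n \<noteq> 0"
      using minimal_recurrence_complex[OF min, of ?G] dR unfolding uc_def by auto
    have "act [:- t, 1:] (act ?G uc) n = 0" for n
      by (simp only: act_mult[symmetric] that[symmetric] uP)
    then show ?thesis using n by (rule geometric_sequence)
  qed
  obtain \<alpha> where \<alpha>: "\<alpha> \<noteq> 0" "\<forall>n. act ([:- y, 1:] * R) uc n = \<alpha> * x ^ n"
    using geom[of x y] P' R by blast
  obtain \<beta> where \<beta>: "\<beta> \<noteq> 0" "\<forall>n. act ([:- x, 1:] * R) uc n = \<beta> * y ^ n"
    using geom[of y x] P' R by (metis mult.left_commute)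
  define C where "C = smult (1 / \<alpha>) ([:- y, 1:] * R) - smult (1 / \<beta>) ([:- x, 1:] * R)"
  have C: "act C uc n = x ^ n - y ^ n" for n
    using \<alpha> \<beta> by (simp add: C_def act_diff act_smult)
  have "degree C < length a"
  proof -
    have "degree (smult (1 / \<alpha>) ([:- y, 1:] * R)) < length a"
      "degree (smult (1 / \<beta>) ([:- x, 1:] * R)) < length a"
      unfolding dR degree_smult_eq lin(1)[OF R0] by simp_all
    then show ?thesis unfolding C_def by (intro degree_diff_less)
  qed
  then have Csum: "(\<Sum>i<length a. coeff C i * of_int (u (n + i))) = x ^ n - y ^ n" for n
    using act_eq_sum[of C "length a" uc n] C by (simp add: uc_def)
  \<comment> \<open>Two consecutive powers of \<open>x\<close> and \<open>y\<close> cannot both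
    agree. The lower bound is needed because an eventually zero solution vanishes from index
    \<open>length a\<close> on.\<close>
  obtain n1 where n1: "n1 \<ge> length a" "x ^ n1 \<noteq> y ^ n1"
  proof (cases "x ^ length a = y ^ length a")
    case True
    then have "x ^ Suc (length a) \<noteq> y ^ Suc (length a)" using xy(3) y0 by simp
    then show ?thesis using that[of "Suc (length a)"] by simp
  qed (use that in blast)
  have "\<exists>z :: nat \<Rightarrow> rat. (\<forall>j<length a. (\<Sum>i\<in>{..<length a}. z i * of_int (u (M * j + i))) = 0) \<and>
      (\<Sum>i\<in>{..<length a}. z i * of_int (u (n1 + i))) \<noteq> 0"
    by (rule rational_functional[where y = "coeff C"])
      (use n1 xyM in \<open>simp_all add: Csum power_mult\<close>)
  then obtain z :: "nat \<Rightarrow> rat" where z: "\<And>j. j < length a \<Longrightarrow> (\<Sum>i<length a. z i * of_int (u (M * j + i))) = 0"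
    "(\<Sum>i<length a. z i * of_int (u (n1 + i))) \<noteq> 0"
    by auto
  obtain D q where D: "D > 0" and q: "\<forall>j\<in>{..<length a}. of_int (q j) = of_int D * z j"
    using common_denominator[of "{..<length a}" z] by auto
  define c where "c = poly_of (length a) q"
  have c: "(of_int (act c u n) :: rat) = of_int D * (\<Sum>i<length a. z i * of_int (u (n + i)))" for n
    using q by (simp add: c_def act_poly_of sum_distrib_left mult.assoc)
  have small: "act c u (M * j) = 0" if "j < length a" for j
  proof -
    have "(of_int (act c u (M * j)) :: rat) = 0" unfolding c z(1)[OF that] by (rule mult_zero_right)
    then show ?thesis by (simp only: of_int_eq_0_iff)
  qed
  have "act c u (0 + M * j) = 0" for j
    by (rule progression_zero[OF recurrence_act[OF a]]) (simp add: small)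
  moreover have "(of_int (act c u n1) :: rat) \<noteq> 0" unfolding c using z(2) D by (simp only: mult_eq_0_iff) simp
  then have "act c u n1 \<noteq> 0" by (simp only: of_int_eq_0_iff not_False_eq_True)
  then have "\<not> eventually_zero (act c u)"
    using eventually_zero_from_order[OF recurrence_act[OF a, of c] _ n1(1)]
    unfolding eventually_zero_def by blast
  ultimately show ?thesis unfolding progression_faithful_def using xy(4) by blast
qed

lemma non_degenerate_iff: "is_lrs u \<Longrightarrow> non_degenerate u \<longleftrightarrow> progression_faithful u"
  using non_degenerate_imp_faithful degenerate_imp_not_faithful by blast

section \<open>Smooth sequences and their zeros\<close>

definition delta :: "nat \<Rightarrow> (nat \<Rightarrow> int) \<Rightarrow> nat \<Rightarrow> int" where
  "delta N f n = f (n + N) - f n"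

text \<open>With \<open>q\<close> the square of a prime \<open>p\<close>, an integer form of p-adic
  analyticity along every class modulo \<open>N\<close>: the iterated differences are the
  coefficients of Newton's series, and their divisibility makes it a convergent power
  series.\<close>

definition smooth :: "int \<Rightarrow> nat \<Rightarrow> (nat \<Rightarrow> int) \<Rightarrow> bool" where
  "smooth q N f \<longleftrightarrow> (\<forall>j n. q ^ j dvd (delta N ^^ j) f n)"

lemma delta_power_Suc: "(delta N ^^ Suc j) f = (delta N ^^ j) (delta N f)"
  by (simp add: funpow_swap1)

lemma delta_power_add:
  "(delta N ^^ j) (\<lambda>n. f n + g n) = (\<lambda>n. (delta N ^^ j) f n + (delta N ^^ j) g n)"
  by (induction j) (auto simp: delta_def)

lemma delta_power_cmult: "(delta N ^^ j) (\<lambda>n. c * f n) = (\<lambda>n. c * (delta N ^^ j) f n)"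
  by (induction j) (auto simp: delta_def right_diff_distrib)

lemma delta_power_shift: "(delta N ^^ j) (\<lambda>n. f (n + k)) = (\<lambda>n. (delta N ^^ j) f (n + k))"
  by (induction j) (auto simp: delta_def algebra_simps)

lemma delta_power_zero: "(delta N ^^ j) (\<lambda>_. 0) = (\<lambda>_. 0)"
  by (induction j) (auto simp: delta_def)

lemma delta_mult:
  "delta N (\<lambda>n. f n * g n) = (\<lambda>n. (delta N f n * g n + f n * delta N g n) + delta N f n * delta N g n)"
  by (auto simp: delta_def algebra_simps)

text \<open>Induction by the discrete Leibniz rule \<open>delta_mult\<close>. The offsets
  \<open>s\<close> and \<open>t\<close> are there for the induction, since passing from a factor to
  its difference raises its offset by one.\<close>

lemma delta_power_mult_dvd:
  assumes "\<And>j n. q ^ (s + j) dvd (delta N ^^ j) f n" "\<And>j n. q ^ (t + j) dvd (delta N ^^ j) g n"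
  shows "q ^ (s + t + j) dvd (delta N ^^ j) (\<lambda>n. f n * g n) n"
  using assms
proof (induction j arbitrary: s t f g n)
  case 0
  have "q ^ s dvd f n" "q ^ t dvd g n" using 0(1)[of 0 n] 0(2)[of 0 n] by simp_all
  then show ?case by (simp add: power_add mult_dvd_mono)
next
  case (Suc j)
  have f: "q ^ (Suc s + j) dvd (delta N ^^ j) (delta N f) n" for j n
    using Suc.prems(1)[of "Suc j" n] by (simp only: delta_power_Suc add_Suc add_Suc_right)
  have g: "q ^ (Suc t + j) dvd (delta N ^^ j) (delta N g) n" for j n
    using Suc.prems(2)[of "Suc j" n] by (simp only: delta_power_Suc add_Suc add_Suc_right)
  have fg: "q ^ (s + t + Suc j) dvd (delta N ^^ j) (\<lambda>n. delta N f n * g n) n"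
    using Suc.IH[OF f Suc.prems(2)] by simp
  have gf: "q ^ (s + t + Suc j) dvd (delta N ^^ j) (\<lambda>n. f n * delta N g n) n"
    using Suc.IH[OF Suc.prems(1) g] by simp
  have "q ^ (s + t + Suc j) dvd q ^ (Suc s + Suc t + j)" by (rule le_imp_power_dvd) simp
  then have ff: "q ^ (s + t + Suc j) dvd (delta N ^^ j) (\<lambda>n. delta N f n * delta N g n) n"
    using Suc.IH[OF f g] dvd_trans by blast
  show ?case
    unfolding delta_power_Suc delta_mult delta_power_add by (intro dvd_add fg gf ff)
qed

lemma smooth_mult: "smooth q N f \<Longrightarrow> smooth q N g \<Longrightarrow> smooth q N (\<lambda>n. f n * g n)"
  unfolding smooth_def using delta_power_mult_dvd[of q 0 N f 0 g] by simp

lemma smooth_add: "smooth q N f \<Longrightarrow> smooth q N g \<Longrightarrow> smooth q N (\<lambda>n. f n + g n)"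
  unfolding smooth_def delta_power_add by (simp add: dvd_add)

lemma smooth_cmult: "smooth q N f \<Longrightarrow> smooth q N (\<lambda>n. c * f n)"
  unfolding smooth_def delta_power_cmult by simp

lemma smooth_shift: "smooth q N f \<Longrightarrow> smooth q N (\<lambda>n. f (n + k))"
  unfolding smooth_def delta_power_shift by simp

lemma smooth_const: "smooth q N (\<lambda>_. c)"
  unfolding smooth_def
proof (intro allI)
  fix j and n :: nat
  show "q ^ j dvd (delta N ^^ j) (\<lambda>_. c) n"
  proof (cases j)
    case (Suc i)
    have "delta N (\<lambda>_. c) = (\<lambda>_. 0)" by (auto simp: delta_def)
    then show ?thesis unfolding Suc delta_power_Suc by (simp add: delta_power_zero)
  qed simp
qed

lemma smooth_sum: "(\<And>i. i \<in> I \<Longrightarrow> smooth q N (f i)) \<Longrightarrow> smooth q N (\<lambda>n. \<Sum>i\<in>I. f i n)"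
  by (induction I rule: infinite_finite_induct) (simp_all add: smooth_const smooth_add)

text \<open>Newton's forward difference formula. The range \<open>J\<close> is free, so that one
  polynomial can represent several values of \<open>m\<close>.\<close>

lemma newton_expansion:
  "m < J \<Longrightarrow> f (n + N * m) = (\<Sum>j<J. int (m choose j) * (delta N ^^ j) f n)"
proof (induction m arbitrary: f J)
  case 0
  then obtain J' where J: "J = Suc J'" by (cases J) auto
  show ?case unfolding J by (subst sum.lessThan_Suc_shift) simp
next
  case (Suc m)
  then obtain J' where J: "J = Suc J'" and m: "m < J'" by (cases J) auto
  let ?a = "\<lambda>j. (delta N ^^ j) f n"
  have "f (n + N * Suc m) = f (n + N * m) + delta N f (n + N * m)"
    by (simp add: delta_def algebra_simps)
  also have "\<dots> = (\<Sum>j<J. int (m choose j) * ?a j) + (\<Sum>j<J'. int (m choose j) * ?a (Suc j))"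
    using Suc.IH[of J f] Suc.IH[of J' "delta N f"] m Suc.prems by (simp add: delta_power_Suc[symmetric] del: funpow.simps)
  also have "\<dots> = (\<Sum>j<J. int (Suc m choose j) * ?a j)"
    unfolding J sum.lessThan_Suc_shift by (simp add: sum.distrib distrib_right del: funpow.simps)
  finally show ?case .
qed

text \<open>The multiples of \<open>p\<close> among the factors are \<open>p\<close> times
  \<open>1\<close> up to \<open>n div p\<close>; the other factors are collected in
  \<open>c\<close>.\<close>

lemma fact_prime_decomposition:
  assumes "prime (p::nat)"
  shows "\<exists>c. coprime c p \<and> fact n = p ^ (n div p) * fact (n div p) * c"
proof (induction n)
  case 0
  then show ?case by (intro exI[of _ 1]) simp
next
  case (Suc n)
  then obtain c where c: "coprime c p" "fact n = p ^ (n div p) * fact (n div p) * c" by blast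
  show ?case
  proof (cases "p dvd Suc n")
    case True
    then have k: "Suc n div p = Suc (n div p)" by (simp add: div_Suc dvd_eq_mod_eq_0)
    define l where "l = n div p"
    have "p * (Suc n div p) = Suc n" using True by (rule dvd_mult_div_cancel)
    then have "Suc n = p * Suc l" unfolding k l_def by simp
    then have "fact (Suc n) = p * Suc l * (p ^ l * fact l * c)"
      using c(2) unfolding l_def[symmetric] fact_Suc by simp
    also have "\<dots> = p ^ (Suc n div p) * fact (Suc n div p) * c"
      unfolding k l_def[symmetric] by (simp add: algebra_simps)
    finally show ?thesis using c(1) by blast
  next
    case False
    then have k: "Suc n div p = n div p" by (simp add: div_Suc dvd_eq_mod_eq_0)
    have "coprime (c * Suc n) p"
      using c(1) prime_imp_coprime[OF assms False] by (simp add: coprime_commute del: mult_Suc_right)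
    moreover have "fact (Suc n) = p ^ (Suc n div p) * fact (Suc n div p) * (c * Suc n)"
      unfolding k using c(2) by (simp add: algebra_simps)
    ultimately show ?thesis by blast
  qed
qed

text \<open>The p-adic valuation of \<open>fact n\<close> is at most \<open>n\<close>: with
  \<open>k = n div p\<close> it is at most \<open>k + k\<close> by induction, and
  \<open>p >= 2\<close>.\<close>

lemma fact_dvd_prime_power:
  assumes "prime (p::nat)"
  shows "\<exists>D. coprime D p \<and> fact n dvd D * p ^ n"
proof (induction n rule: less_induct)
  case (less n)
  show ?case
  proof (cases "n = 0")
    case True
    then show ?thesis by (intro exI[of _ 1]) simp
  next
    case False
    have p2: "p \<ge> 2" using assms by (rule prime_ge_2_nat)
    define k where "k = n div p"
    have "k < n" using False p2 unfolding k_def by simp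
    then obtain D where D: "coprime D p" "fact k dvd D * p ^ k" using less.IH by blast
    obtain c where c: "coprime c p" "fact n = p ^ k * fact k * c"
      using fact_prime_decomposition[OF assms, of n] unfolding k_def by blast
    have "fact n dvd p ^ k * (D * p ^ k) * c"
      unfolding c(2) using D(2) by (intro mult_dvd_mono) simp_all
    also have "p ^ k * (D * p ^ k) * c = (D * c) * p ^ (k + k)" by (simp add: power_add)
    also have "\<dots> dvd (D * c) * p ^ n"
    proof (intro mult_dvd_mono le_imp_power_dvd dvd_refl)
      have "2 * k \<le> p * k" using p2 by simp
      also have "p * k \<le> n" unfolding k_def by simp
      finally show "k + k \<le> n" by simp
    qed
    finally show ?thesis using D(1) c(1) by (intro exI[of _ "D * c"]) simp
  qed
qed

lemma facts_dvd_prime_power: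
  assumes "prime (p::nat)"
  shows "\<exists>D. coprime D p \<and> (\<forall>j<J. fact j dvd D * p ^ j)"
proof (induction J)
  case 0
  then show ?case by (intro exI[of _ 1]) simp
next
  case (Suc J)
  then obtain D where D: "coprime D p" "\<forall>j<J. fact j dvd D * p ^ j" by blast
  obtain E where E: "coprime E p" "fact J dvd E * p ^ J" using fact_dvd_prime_power[OF assms] by blast
  have "fact j dvd (D * E) * p ^ j" if "j < Suc J" for j
  proof (cases "j = J")
    case True
    have "E * p ^ J dvd (D * E) * p ^ J" by simp
    with E(2) show ?thesis unfolding True by (rule dvd_trans)
  next
    case False
    have "D * p ^ j dvd (D * E) * p ^ j" by simp
    moreover have "fact j dvd D * p ^ j" using D(2) False that by simp
    ultimately show ?thesis by (rule dvd_trans[rotated])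
  qed
  moreover have "coprime (D * E) p" using D(1) E(1) by simp
  ultimately show ?case by blast
qed

definition falling :: "nat \<Rightarrow> int poly" where
  "falling j = (\<Prod>i<j. [:- int i, 1:])"

lemma degree_falling: "degree (falling j) \<le> j"
proof (induction j)
  case (Suc j)
  have "degree (falling (Suc j)) \<le> degree (falling j) + degree [:- int j, 1:]"
    unfolding falling_def prod.lessThan_Suc by (rule degree_mult_le)
  with Suc show ?case by simp
qed (simp add: falling_def)

lemma poly_falling: "poly (falling j) (int m) = fact j * int (m choose j)"
proof -
  have "(of_int (poly (falling j) (int m)) :: rat) = (\<Prod>i=0..<j. of_nat m - of_nat i)"
    by (simp add: falling_def poly_prod atLeast0LessThan)
  also have "\<dots> = fact j * (of_nat m gchoose j)" by (rule gbinomial_mult_fact[symmetric])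
  also have "\<dots> = of_int (fact j * int (m choose j))" by (simp add: binomial_gbinomial)
  finally show ?thesis by (simp only: of_int_eq_iff)
qed

lemma poly_dvd_of_coeffs: "(\<And>i. k dvd coeff F i) \<Longrightarrow> k dvd poly F (x::int)"
  unfolding poly_altdef by (intro dvd_sum) simp

text \<open>
  Dividing by a root raises the \<open>p\<close>-adic valuation of every coefficient by one: this is Strassmann's
  theorem in the form used here.
\<close>

lemma synthetic_div_dvd:
  fixes P :: int
  assumes "\<And>i. P ^ (i + t) dvd coeff F i"
  shows "P ^ (i + Suc t) dvd coeff (synthetic_div F x) i"
  using assms
proof (induction F arbitrary: t i)
  case (pCons a F)
  have F: "P ^ (i + Suc t) dvd coeff F i" for i
    using pCons.prems[of "Suc i"] by simp
  show ?case
  proof (cases i)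
    case 0
    have "P ^ Suc t dvd coeff F i" for i
    proof -
      have "P ^ Suc t dvd P ^ (i + Suc t)" by (rule le_imp_power_dvd) simp
      then show ?thesis using F by (rule dvd_trans)
    qed
    then have "P ^ Suc t dvd poly F x" by (rule poly_dvd_of_coeffs)
    then show ?thesis unfolding 0 by (simp add: synthetic_div_pCons)
  next
    case (Suc j)
    have "P ^ (j + Suc (Suc t)) dvd coeff (synthetic_div F x) j" by (rule pCons.IH[OF F])
    then show ?thesis unfolding Suc by (simp add: synthetic_div_pCons)
  qed
qed simp

text \<open>The zeros are divided off one after another, each raising \<open>t\<close> by one, and
  the value of \<open>F\<close> is a multiple of the value of the final quotient.\<close>

lemma roots_power_dvd:
  fixes P :: int
  assumes "finite Z" "\<And>i. P ^ (i + t) dvd coeff F i" "\<And>z. z \<in> Z \<Longrightarrow> poly F z = 0"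
  shows "P ^ (t + card Z) dvd poly F x"
  using assms
proof (induction Z arbitrary: F t)
  case empty
  have "P ^ t dvd coeff F i" for i
  proof -
    have "P ^ t dvd P ^ (i + t)" by (rule le_imp_power_dvd) simp
    then show ?thesis using empty.prems(1) by (rule dvd_trans)
  qed
  then show ?case using poly_dvd_of_coeffs by simp
next
  case (insert z Z)
  define G where "G = synthetic_div F z"
  have FG: "F = [:- z, 1:] * G"
    using synthetic_div_correct'[of z F] insert.prems(2)[of z] unfolding G_def by simp
  have "P ^ (Suc t + card Z) dvd poly G x"
  proof (rule insert.IH)
    show "P ^ (i + Suc t) dvd coeff G i" for i
      unfolding G_def by (rule synthetic_div_dvd[OF insert.prems(1)])
    fix y assume y: "y \<in> Z"
    then have "poly F y = 0" "y \<noteq> z" using insert.prems(2) insert.hyps by auto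
    then show "poly G y = 0" unfolding FG by simp
  qed
  then show ?case unfolding FG using insert.hyps by simp
qed

text \<open>
  The modulus is \<open>p\<^sup>2\<close> and not \<open>p\<close>, since \<open>p\<^sup>j / j!\<close> is \<open>p\<close>-integral, which leaves a factor
  \<open>p\<^sup>j\<close> in the coefficients \<open>p\<^sup>2\<^sup>j / j!\<close> of Newton's expansion.
\<close>

theorem zeros_power_dvd:
  fixes p :: nat
  assumes p: "prime p" and f: "smooth (int p ^ 2) N f"
    and Z: "finite Z" "\<And>m. m \<in> Z \<Longrightarrow> f (n + N * m) = 0"
  shows "int p ^ card Z dvd f (n + N * m)"
proof -
  \<comment> \<open>Large enough for one Newton polynomial to give the values at all of
    \<open>Z\<close> and at \<open>m\<close>.\<close>
  define J where "J = Suc (Max (insert m Z))"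
  have J: "k < J" if "k \<in> insert m Z" for k
    unfolding J_def using Max_ge[of "insert m Z" k] Z(1) that by (simp add: less_Suc_eq_le)
  obtain D where D: "coprime D p" "\<And>j. j < J \<Longrightarrow> fact j dvd D * p ^ j"
    using facts_dvd_prime_power[OF p] by blast
  have "\<exists>e. D * p ^ j = fact j * e" if "j < J" for j using D(2)[OF that] by (simp add: dvd_def)
  then obtain e where e: "\<And>j. j < J \<Longrightarrow> D * p ^ j = fact j * e j" by metis
  have "\<exists>b. (delta N ^^ j) f n = (int p ^ 2) ^ j * b" for j
    using f unfolding smooth_def dvd_def by blast
  then obtain b where b: "\<And>j. (delta N ^^ j) f n = (int p ^ 2) ^ j * b j" by metis
  \<comment> \<open>Newton's polynomial multiplied by \<open>D\<close>. Since
    \<open>D * p ^ j\<close> is divisible by \<open>fact j\<close>, this is integral and one of the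
    two factors \<open>p ^ j\<close> of the difference survives. As \<open>D\<close> is coprime to
    \<open>p\<close>, it does not disturb the divisibility.\<close>
  define F where "F = (\<Sum>j<J. smult (int p ^ j * (b j * int (e j))) (falling j))"
  have F: "poly F (int k) = int D * f (n + N * k)" if "k < J" for k
  proof -
    have "poly F (int k) = (\<Sum>j<J. int D * (int (k choose j) * (delta N ^^ j) f n))"
      unfolding F_def poly_sum
    proof (rule sum.cong, rule refl)
      fix j assume "j \<in> {..<J}"
      then have "int D * int p ^ j = fact j * int (e j)"
        using e[of j] by (metis lessThan_iff of_nat_fact of_nat_mult of_nat_power)
      moreover have "(int p ^ 2) ^ j = int p ^ j * int p ^ j"
        by (simp only: power_mult[symmetric] power_add[symmetric] mult_2)
      ultimately show "poly (smult (int p ^ j * (b j * int (e j))) (falling j)) (int k) =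
          int D * (int (k choose j) * (delta N ^^ j) f n)"
        unfolding b poly_smult poly_falling by (simp add: mult_ac) 
    qed
    then show ?thesis using newton_expansion[OF that, of f n N] by (simp add: sum_distrib_left)
  qed
  have coeffs: "int p ^ (i + 0) dvd coeff F i" for i
    unfolding F_def coeff_sum
  proof (rule dvd_sum)
    fix j assume "j \<in> {..<J}"
    show "int p ^ (i + 0) dvd coeff (smult (int p ^ j * (b j * int (e j))) (falling j)) i"
    proof (cases "i \<le> j")
      case True
      then have "int p ^ i dvd int p ^ j" by (rule le_imp_power_dvd)
      then show ?thesis by simp
    next
      case False
      then have "coeff (falling j) i = 0" using degree_falling[of j] by (intro coeff_eq_0) simp
      then show ?thesis by simp
    qed
  qed
  have "int p ^ (0 + card (int ` Z)) dvd poly F (int m)"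
    by (rule roots_power_dvd[OF _ coeffs]) (use Z F J in auto)
  then have "int p ^ card Z dvd int D * f (n + N * m)"
    using F[of m] J by (simp add: card_image)
  moreover have "coprime (int p ^ card Z) (int D)"
    using D(1) by (simp add: coprime_commute)
  ultimately show ?thesis by (simp add: coprime_dvd_mult_right_iff)
qed

text \<open>By \<open>zeros_power_dvd\<close>, \<open>s\<close> zeros make a nonzero value at least
  \<open>p ^ s > s\<close> in absolute value; take \<open>s\<close> to be that absolute
  value.\<close>

lemma infinite_zeros_imp_zero:
  fixes p :: nat
  assumes "prime p" "smooth (int p ^ 2) N f" "infinite {m. f (n + N * m) = 0}"
  shows "f (n + N * m) = 0"
proof (rule ccontr)
  assume nz: "f (n + N * m) \<noteq> 0"
  define s where "s = nat \<bar>f (n + N * m)\<bar>"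
  obtain Z where Z: "finite Z" "card Z = s" "Z \<subseteq> {m. f (n + N * m) = 0}"
    using infinite_arbitrarily_large[OF assms(3)] by blast
  have "int p ^ s dvd f (n + N * m)"
    using zeros_power_dvd[OF assms(1,2) Z(1), of n m] Z by auto
  then have "\<bar>int p ^ s\<bar> \<le> \<bar>f (n + N * m)\<bar>" using nz by (rule dvd_imp_le_int[rotated])
  moreover have "s < p ^ s" using prime_gt_1_nat[OF assms(1)] by (simp add: power_gt_expt)
  then have "int s < int p ^ s" by (metis of_nat_less_iff of_nat_power)
  ultimately show False unfolding s_def by simp
qed

section \<open>Periods modulo a prime square\<close>

definition reversible :: "int list \<Rightarrow> bool" where
  "reversible a \<longleftrightarrow> a \<noteq> [] \<and> last a \<noteq> 0"

text \<open>Solving the recurrence for its oldest term requires division by the last coefficient,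
  which is invertible modulo \<open>q\<close>.\<close>

lemma backward_dvd:
  assumes "satisfies_recurrence a z" "coprime q (last a)" "\<And>n. n \<ge> i \<Longrightarrow> q dvd z n"
  shows "q dvd z n"
proof -
  let ?k = "length a"
  have k: "?k > 0" using assms(1) by (auto simp: satisfies_recurrence_def)
  have "\<forall>n\<ge>i - d. q dvd z n" for d
  proof (induction d)
    case (Suc d)
    show ?case
    proof (intro allI impI)
      fix n assume n: "n \<ge> i - Suc d"
      have above: "q dvd z j" if "j > n" for j using Suc n that by simp
      have "z (n + ?k) = (\<Sum>j<?k. a ! j * z (n + ?k - 1 - j))"
        using assms(1) unfolding satisfies_recurrence_def by blast
      also have "\<dots> = (\<Sum>j<?k - 1. a ! j * z (n + ?k - 1 - j)) + a ! (?k - 1) * z n"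
        using k by (cases ?k) simp_all
      finally have "a ! (?k - 1) * z n = z (n + ?k) - (\<Sum>j<?k - 1. a ! j * z (n + ?k - 1 - j))"
        by simp
      moreover have "q dvd z (n + ?k)" using above k by simp
      moreover have "q dvd (\<Sum>j<?k - 1. a ! j * z (n + ?k - 1 - j))"
        by (intro dvd_sum dvd_mult above) auto
      ultimately have "q dvd last a * z n" using k by (simp add: last_conv_nth)
      then show "q dvd z n" using assms(2) by (simp add: coprime_dvd_mult_right_iff)
    qed
  qed (use assms(3) in simp)
  from this[of i] show ?thesis by simp
qed

text \<open>Pigeonhole on the residues of all fundamental solutions at one index. A repetition
  gives, by the addition formula, a period for every solution from some index on, and
  \<open>backward_dvd\<close> extends it to all indices.\<close>

lemma common_period:
  assumes a: "a \<noteq> []" and q: "q > 1" "coprime q (last a)"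
  shows "\<exists>D\<ge>1. D \<le> nat q ^ length a \<and>
    (\<forall>w n. satisfies_recurrence a w \<longrightarrow> q dvd w (n + D) - w n)"
proof -
  let ?k = "length a" and ?Q = "nat q ^ length a"
  define R where "R i = restrict (\<lambda>l. basis_solution a l i mod q) {..<?k}" for i
  have "R ` {..?Q} \<subseteq> {..<?k} \<rightarrow>\<^sub>E {0..<q}" using q by (auto simp: R_def split: if_splits)
  moreover have fin: "finite ({..<?k} \<rightarrow>\<^sub>E {0..<q})" by (simp add: finite_PiE)
  moreover have "card ({..<?k} \<rightarrow>\<^sub>E {0..<q}) = ?Q" by (simp add: card_PiE)
  ultimately have "card (R ` {..?Q}) < card {..?Q}"
    using card_mono by (metis card_atMost le_imp_less_Suc)
  then have "\<not> inj_on R {..?Q}" using pigeonhole by blast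
  then obtain i j where ij: "i < j" "j \<le> ?Q" "R i = R j"
    unfolding inj_on_def by (metis atMost_iff linorder_neqE_nat)
  have res: "q dvd basis_solution a l j - basis_solution a l i" if "l < ?k" for l
    using fun_cong[OF ij(3)[symmetric], of l] that by (simp add: R_def mod_eq_dvd_iff)
  have "q dvd w (n + (j - i)) - w n" if w: "satisfies_recurrence a w" for w n
  proof (rule backward_dvd[of a "\<lambda>n. w (n + (j - i)) - w n" q i])
    have "satisfies_recurrence a (\<lambda>n. w (n + (j - i)))" by (rule recurrence_shift[OF w])
    then show "satisfies_recurrence a (\<lambda>n. w (n + (j - i)) - w n)"
      using w by (simp add: satisfies_recurrence_iff act_seq_diff)
    fix n assume n: "i \<le> n"
    have "w (n - i + j) - w (n - i + i) =
        (\<Sum>l<?k. (basis_solution a l j - basis_solution a l i) * w (n - i + l))"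
      unfolding addition_formula[OF w, of "n - i" j] addition_formula[OF w, of "n - i" i]
      by (simp add: sum_subtractf left_diff_distrib)
    moreover have "q dvd (\<Sum>l<?k. (basis_solution a l j - basis_solution a l i) * w (n - i + l))"
      by (intro dvd_sum dvd_mult2 res) simp
    ultimately show "q dvd w (n + (j - i)) - w n" using n ij(1) by simp
  qed (rule q(2))
  then show ?thesis using ij by (intro exI[of _ "j - i"]) auto
qed

text \<open>The difference of a solution, divided by \<open>q\<close>, is again an integer solution,
  so the argument can be iterated.\<close>

lemma smooth_of_period:
  assumes per: "\<And>w n. satisfies_recurrence a w \<Longrightarrow> q dvd w (n + N) - w n"
    and q: "q \<noteq> 0" and w: "satisfies_recurrence a w"
  shows "smooth q N w"
proof -
  have "q ^ j dvd (delta N ^^ j) w n" if "satisfies_recurrence a w" for j w n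
    using that
  proof (induction j arbitrary: w)
    case (Suc j)
    define w' where "w' n = delta N w n div q" for n
    have qw': "delta N w n = q * w' n" for n
      using per[OF Suc.prems, of n] by (simp add: w'_def delta_def)
    have "satisfies_recurrence a (delta N w)"
      using Suc.prems recurrence_shift[OF Suc.prems, of N] unfolding delta_def[abs_def]
      by (simp add: satisfies_recurrence_iff act_seq_diff)
    then have "satisfies_recurrence a (\<lambda>n. q * w' n)" by (simp only: qw'[symmetric])
    then have "satisfies_recurrence a w'"
      using q by (simp add: satisfies_recurrence_iff act_seq_smult)
    then have "q ^ j dvd (delta N ^^ j) w' n" by (rule Suc.IH)
    moreover have "(delta N ^^ Suc j) w n = q * (delta N ^^ j) w' n"
    proof -
      have "delta N w = (\<lambda>n. q * w' n)" using qw' by auto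
      then show ?thesis unfolding delta_power_Suc by (simp only: delta_power_cmult)
    qed
    ultimately show ?case by (simp add: mult_dvd_mono)
  qed simp
  then show ?thesis unfolding smooth_def using w by blast
qed

definition height_le :: "int list \<Rightarrow> int list \<Rightarrow> nat \<Rightarrow> bool" where
  "height_le a w h \<longleftrightarrow> length a \<le> h \<and>
     (\<forall>i<length a. \<bar>nth_default 0 a i\<bar> \<le> int h \<and> \<bar>nth_default 0 w i\<bar> \<le> int h)"

text \<open>
  The period of a recurrence of order \<open>k \<le> h\<close> modulo \<open>p\<^sup>2\<close>, where \<open>p \<le> h + 1\<close>, is at most
  \<open>p\<^sup>2\<^sup>k\<close> and therefore divides this number.
\<close>

definition period :: "nat \<Rightarrow> nat" where
  "period h = fact ((h + 1) ^ (2 * h))"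

lemma period_pos [simp]: "period h > 0"
  by (simp add: period_def)

lemma reversible_smooth:
  assumes a: "reversible a" "length a \<le> h" "\<And>i. i < length a \<Longrightarrow> \<bar>a ! i\<bar> \<le> int h"
  shows "\<exists>p. prime p \<and> (\<forall>w. satisfies_recurrence a w \<longrightarrow> smooth (int p ^ 2) (period h) w)"
proof -
  let ?c = "nat \<bar>last a\<bar>"
  have ne: "a \<noteq> []" and c: "?c > 0" using a(1) by (auto simp: reversible_def)
  have ch: "?c \<le> h" using a(3)[of "length a - 1"] ne by (simp add: last_conv_nth)
  \<comment> \<open>A prime factor of \<open>?c + 1\<close> does not divide \<open>?c\<close>, and
    it is at most \<open>h + 1\<close>. This is the base in the definition of
    \<open>period\<close>.\<close>
  obtain p where p: "prime p" "p dvd Suc ?c" using prime_factor_nat[of "Suc ?c"] c by auto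
  have ph: "p \<le> h + 1" using dvd_imp_le[OF p(2)] ch by simp
  have "\<not> p dvd ?c" using p by (metis dvd_add_right_iff not_prime_unit plus_1_eq_Suc add.commute)
  then have "coprime p ?c" using p(1) by (rule prime_imp_coprime[rotated])
  then have "coprime (int p) (last a)" by (metis coprime_abs_right_iff coprime_int_iff int_nat_eq abs_ge_zero)
  then have cop: "coprime (int p ^ 2) (last a)" by simp
  have p1: "p > 1" using p(1) by (rule prime_gt_1_nat)
  have "int p ^ 2 > 1" using p1 by (simp add: one_less_power)
  then obtain D where D: "D \<ge> 1" "D \<le> nat (int p ^ 2) ^ length a"
    "\<And>w n. satisfies_recurrence a w \<Longrightarrow> int p ^ 2 dvd w (n + D) - w n"
    using common_period[OF ne _ cop] by blast
  have "nat (int p ^ 2) ^ length a = p ^ (2 * length a)"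
    by (simp add: nat_power_eq power_mult)
  also have "\<dots> \<le> (h + 1) ^ (2 * length a)" using ph by (rule power_mono) simp
  also have "\<dots> \<le> (h + 1) ^ (2 * h)" using a(2) by (intro power_increasing) auto
  finally have "D dvd period h" unfolding period_def using D by (intro dvd_fact) auto
  then obtain k where k: "period h = D * k" by (auto simp: dvd_def)
  have "int p ^ 2 dvd w (n + D * k) - w n" if w: "satisfies_recurrence a w" for w n k
  proof (induction k)
    case (Suc k)
    have "w (n + D * Suc k) - w n = (w ((n + D * k) + D) - w (n + D * k)) + (w (n + D * k) - w n)"
      by (simp add: algebra_simps)
    then show ?case using Suc D(3)[OF w, of "n + D * k"] by (metis dvd_add)
  qed simp
  then have "smooth (int p ^ 2) (period h) w" if "satisfies_recurrence a w" for w
    using p1 that unfolding k by (intro smooth_of_period[of a]) auto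
  then show ?thesis using p(1) by blast
qed

text \<open>Trailing zero coefficients are dropped. The shorter recurrence holds only from a later
  index on, hence the shift by \<open>length a\<close>.\<close>

lemma reversible_part:
  assumes "a \<noteq> []" "\<exists>i<length a. a ! i \<noteq> 0"
  obtains b where "reversible b" "length b \<le> length a" "\<And>i. i < length b \<Longrightarrow> b ! i = a ! i"
    "\<And>w. satisfies_recurrence a w \<Longrightarrow> satisfies_recurrence b (\<lambda>n. w (n + length a))"
proof -
  define i0 where "i0 = Max {i. i < length a \<and> a ! i \<noteq> 0}"
  have fin: "finite {i. i < length a \<and> a ! i \<noteq> 0}" by simp
  have i0: "i0 < length a" "a ! i0 \<noteq> 0"
    using Max_in[OF fin] assms(2) unfolding i0_def by auto
  have above: "a ! i = 0" if "i < length a" "i > i0" for i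
  proof (rule ccontr)
    assume "a ! i \<noteq> 0"
    then have "i \<le> i0" unfolding i0_def using that by (intro Max_ge[OF fin]) simp
    then show False using that by simp
  qed
  define b where "b = take (Suc i0) a"
  have lb: "length b = Suc i0" using i0 by (simp add: b_def)
  have bi: "b ! i = a ! i" if "i < length b" for i using that by (simp add: b_def)
  have "b \<noteq> []" using lb by auto
  then have "reversible b" using i0 lb bi by (simp add: reversible_def last_conv_nth)
  moreover have "satisfies_recurrence b (\<lambda>n. w (n + length a))" if w: "satisfies_recurrence a w" for w
    unfolding satisfies_recurrence_def
  proof (intro conjI allI)
    show "b \<noteq> []" by fact
    fix n
    have "w ((n + Suc i0) + length a) = (\<Sum>i<length a. a ! i * w ((n + Suc i0) + length a - 1 - i))"
      using w unfolding satisfies_recurrence_def by blast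
    also have "\<dots> = (\<Sum>i<Suc i0. a ! i * w ((n + Suc i0) + length a - 1 - i))"
      by (rule sum.mono_neutral_right) (use i0 above in auto)
    also have "\<dots> = (\<Sum>i<length b. b ! i * w (n + length b - 1 - i + length a))"
    proof (rule sum.cong)
      fix i assume "i \<in> {..<length b}"
      then have "(n + Suc i0) + length a - 1 - i = n + length b - 1 - i + length a" "b ! i = a ! i"
        using lb bi by auto
      then show "a ! i * w ((n + Suc i0) + length a - 1 - i) = b ! i * w (n + length b - 1 - i + length a)"
        by simp
    qed (simp add: lb)
    finally show "w (n + length b + length a) = (\<Sum>i<length b. b ! i * w (n + length b - 1 - i + length a))"
      by (simp add: lb)
  qed
  ultimately show ?thesis using that[of b] lb i0 bi by simp
qed

lemma tail_zero_of_zero_coefficients: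
  assumes "satisfies_recurrence a w" "\<forall>i<length a. a ! i = 0" shows "w (n + length a) = 0"
  using assms unfolding satisfies_recurrence_def by simp

lemma smooth_tail:
  assumes "a \<noteq> []" "height_le a v h"
  shows "\<exists>p. prime p \<and> (\<forall>w. satisfies_recurrence a w \<longrightarrow>
    smooth (int p ^ 2) (period h) (\<lambda>n. w (n + length a)))"
proof (cases "\<exists>i<length a. a ! i \<noteq> 0")
  case True
  obtain b where b: "reversible b" "length b \<le> length a" "\<And>i. i < length b \<Longrightarrow> b ! i = a ! i"
    "\<And>w. satisfies_recurrence a w \<Longrightarrow> satisfies_recurrence b (\<lambda>n. w (n + length a))"
    using reversible_part[OF assms(1) True] by blast
  have "\<bar>b ! i\<bar> \<le> int h" if "i < length b" for i
    using b(2,3) that assms(2) by (auto simp: height_le_def nth_default_nth)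
  moreover have "length b \<le> h" using b(2) assms(2) by (simp add: height_le_def)
  ultimately show ?thesis using reversible_smooth[OF b(1), of h] b(4) by blast
next
  case False
  have "smooth (int 2 ^ 2) (period h) (\<lambda>n. w (n + length a))" if "satisfies_recurrence a w" for w
    using tail_zero_of_zero_coefficients[OF that] False smooth_const[of _ _ 0] by simp
  then show ?thesis using two_is_prime_nat by blast
qed

section \<open>Multiples of a sequence that are non-degenerate\<close>

interpretation fs: vector_space "\<lambda>(c::rat) (f::nat \<Rightarrow> rat) n. c * f n"
  by unfold_locales (auto simp: plus_fun_def algebra_simps)

lemma sum_fun_apply: "(\<Sum>i\<in>I. f i) (x::nat) = (\<Sum>i\<in>I. f i x :: rat)"
  by (induction I rule: infinite_finite_induct) (auto simp: zero_fun_def)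

text \<open>Stated for indexed families, because different indices may give the same function; this
  already is a relation.\<close>

lemma family_dependent:
  fixes F :: "'i \<Rightarrow> nat \<Rightarrow> rat"
  assumes "finite I" "finite T" "\<And>i. i \<in> I \<Longrightarrow> F i \<in> fs.span T" "card T < card I"
  shows "\<exists>c. (\<exists>i\<in>I. c i \<noteq> 0) \<and> (\<forall>n. (\<Sum>i\<in>I. c i * F i n) = 0)"
proof (cases "inj_on F I")
  case False
  then obtain i j where ij: "i \<in> I" "j \<in> I" "i \<noteq> j" "F i = F j" unfolding inj_on_def by blast
  define c :: "'i \<Rightarrow> rat" where "c x = of_bool (x = i) - of_bool (x = j)" for x
  have "(\<Sum>x\<in>I. c x * F x n) = 0" for n
  proof -
    have "(\<Sum>x\<in>I. c x * F x n) = (\<Sum>x\<in>I. if x = i then F i n else 0) - (\<Sum>x\<in>I. if x = j then F j n else 0)"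
      unfolding sum_subtractf[symmetric] by (rule sum.cong) (auto simp: c_def)
    then show ?thesis using ij assms(1) by simp
  qed
  moreover have "c i \<noteq> 0" using ij(3) by (simp add: c_def)
  ultimately show ?thesis using ij(1) by blast
next
  case True
  have "fs.dependent (F ` I)"
  proof (rule ccontr)
    assume "fs.independent (F ` I)"
    moreover have "F ` I \<subseteq> fs.span T" using assms(3) by blast
    ultimately have "card (F ` I) \<le> card T" using fs.independent_span_bound[OF assms(2)] by blast
    then show False using assms(4) card_image[OF True] by simp
  qed
  then obtain d where d: "\<exists>f\<in>F ` I. d f \<noteq> 0" "(\<Sum>f\<in>F ` I. (\<lambda>n. d f * f n)) = 0"
    using fs.dependent_finite[of "F ` I"] assms(1) by auto
  have "(\<Sum>i\<in>I. d (F i) * F i n) = 0" for n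
    using fun_cong[OF d(2), of n] by (simp add: sum_fun_apply sum.reindex[OF True] zero_fun_def)
  then show ?thesis using d(1) by (intro exI[of _ "\<lambda>i. d (F i)"]) auto
qed

lemma span_times:
  assumes "x \<in> fs.span A" "y \<in> fs.span B" "\<And>a b. a \<in> A \<Longrightarrow> b \<in> B \<Longrightarrow> (\<lambda>n. a n * b n) \<in> fs.span C"
  shows "(\<lambda>n. x n * y n) \<in> fs.span C"
proof -
  have ay: "(\<lambda>n. a n * y n) \<in> fs.span C" if a: "a \<in> A" for a
    using assms(2)
  proof (induction rule: fs.span_induct_alt)
    case base
    then show ?case using fs.span_zero[of C] by (simp add: zero_fun_def)
  next
    case (step c z w)
    have "(\<lambda>n. a n * ((\<lambda>n. c * z n) + w) n) = (\<lambda>n. c * (a n * z n)) + (\<lambda>n. a n * w n)"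
      by (auto simp: algebra_simps)
    then show ?case using fs.span_add[OF fs.span_scale[OF assms(3)[OF a step(1)], of c] step(2)] by simp
  qed
  show ?thesis using assms(1)
  proof (induction rule: fs.span_induct_alt)
    case base
    then show ?case using fs.span_zero[of C] by (simp add: zero_fun_def)
  next
    case (step c z w)
    have "(\<lambda>n. ((\<lambda>n. c * z n) + w) n * y n) = (\<lambda>n. c * (z n * y n)) + (\<lambda>n. w n * y n)"
      by (auto simp: algebra_simps)
    then show ?case using fs.span_add[OF fs.span_scale[OF ay[OF step(1)], of c] step(2)] by simp
  qed
qed

locale smooth_solutions =
  fixes b :: "int list" and p N :: nat
  assumes ne: "b \<noteq> []" and prime: "prime p" and N1: "N \<ge> 1"
    and smooth: "\<And>w. satisfies_recurrence b w \<Longrightarrow> smooth (int p ^ 2) N w"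
begin

text \<open>Polynomials in the solutions, regarded as functions, with \<open>L\<close> an upper
  bound for the degree. Working with functions leaves room for algebraic relations between the
  fundamental solutions.\<close>

inductive solution_poly :: "nat \<Rightarrow> (nat \<Rightarrow> int) \<Rightarrow> bool" where
  const: "solution_poly L (\<lambda>_. c)"
| basis: "l < length b \<Longrightarrow> solution_poly (Suc L) (basis_solution b l)"
| add: "solution_poly L f \<Longrightarrow> solution_poly L g \<Longrightarrow> solution_poly L (\<lambda>n. f n + g n)"
| mult: "solution_poly L f \<Longrightarrow> solution_poly M g \<Longrightarrow> solution_poly (L + M) (\<lambda>n. f n * g n)"

lemma solution_poly_mono: "solution_poly L f \<Longrightarrow> L \<le> M \<Longrightarrow> solution_poly M f"
  using solution_poly.mult[OF solution_poly.const[of "M - L" 1], of L f] by simp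

lemma solution_poly_cmult: "solution_poly L f \<Longrightarrow> solution_poly L (\<lambda>n. c * f n)"
  using solution_poly.mult[OF solution_poly.const[of 0 c], of L f] by simp

lemma solution_poly_sum: "(\<And>i. i \<in> I \<Longrightarrow> solution_poly L (f i)) \<Longrightarrow> solution_poly L (\<lambda>n. \<Sum>i\<in>I. f i n)"
  by (induction I rule: infinite_finite_induct) (simp_all add: solution_poly.const solution_poly.add)

lemma solution_poly_power: "solution_poly L f \<Longrightarrow> solution_poly (j * L) (\<lambda>n. f n ^ j)"
  by (induction j) (simp_all add: solution_poly.const solution_poly.mult)

lemma solution_poly_smooth: "solution_poly L f \<Longrightarrow> smooth (int p ^ 2) N f"
  by (induction rule: solution_poly.induct)
    (simp_all add: smooth_const smooth_add smooth_mult smooth satisfies_recurrence_basis[OF ne])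

lemma is_lrs_basis: "is_lrs (basis_solution b l)"
  unfolding is_lrs_def using satisfies_recurrence_basis[OF ne] by blast

lemma solution_poly_lrs: "solution_poly L f \<Longrightarrow> is_lrs f"
  by (induction rule: solution_poly.induct)
    (simp_all add: is_lrs_const is_lrs_add is_lrs_mult is_lrs_basis)

text \<open>Every application of the addition formula splits one summand \<open>n\<close> off the
  argument, at the price of one factor.\<close>

lemma solution_poly_solution_progression:
  assumes "satisfies_recurrence b w" shows "solution_poly j (\<lambda>n. w (j * n + s))"
proof (induction j arbitrary: s)
  case 0
  then show ?case by (simp add: solution_poly.const)
next
  case (Suc j)
  have "w (Suc j * n + s) = (\<Sum>l<length b. basis_solution b l n * w (j * n + (s + l)))" for n
    using addition_formula[OF assms, of "j * n + s" n] by (simp add: algebra_simps)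
  moreover have "solution_poly (Suc j) (\<lambda>n. \<Sum>l<length b. basis_solution b l n * w (j * n + (s + l)))"
  proof (rule solution_poly_sum)
    fix l assume "l \<in> {..<length b}"
    then have "solution_poly (Suc 0 + j) (\<lambda>n. basis_solution b l n * w (j * n + (s + l)))"
      by (intro solution_poly.mult solution_poly.basis Suc) simp
    then show "solution_poly (Suc j) (\<lambda>n. basis_solution b l n * w (j * n + (s + l)))" by simp
  qed
  ultimately show ?case by (simp only:)
qed

lemma solution_poly_progression: "solution_poly L f \<Longrightarrow> solution_poly (j * L) (\<lambda>n. f (j * n + s))"
proof (induction rule: solution_poly.induct)
  case (basis l L)
  have "solution_poly j (\<lambda>n. basis_solution b l (j * n + s))"
    by (rule solution_poly_solution_progression[OF satisfies_recurrence_basis[OF ne]])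
  then show ?case by (rule solution_poly_mono) simp
next
  case (mult L f M g)
  then show ?case by (simp add: solution_poly.mult distrib_left)
qed (simp_all add: solution_poly.const solution_poly.add)

lemma solution_poly_solution: "satisfies_recurrence b w \<Longrightarrow> solution_poly 1 w"
  using solution_poly_solution_progression[of w 1 0] by simp

section \<open>Dimensions of the polynomial functions on a class\<close>

definition exponents :: "nat \<Rightarrow> (nat \<Rightarrow> nat) set" where
  "exponents L = {\<alpha>. (\<forall>l\<ge>length b. \<alpha> l = 0) \<and> (\<Sum>l<length b. \<alpha> l) \<le> L}"

definition mono_seq :: "(nat \<Rightarrow> nat) \<Rightarrow> nat \<Rightarrow> rat" where
  "mono_seq \<alpha> n = (\<Prod>l<length b. of_int (basis_solution b l n) ^ \<alpha> l)"

lemma exponents_finite: "finite (exponents L)" "card (exponents L) \<le> (L + 1) ^ length b"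
proof -
  let ?f = "\<lambda>\<alpha>::nat \<Rightarrow> nat. restrict \<alpha> {..<length b}"
  have inj: "inj_on ?f (exponents L)"
  proof (rule inj_onI)
    fix \<alpha> \<beta> assume ab: "\<alpha> \<in> exponents L" "\<beta> \<in> exponents L" "?f \<alpha> = ?f \<beta>"
    show "\<alpha> = \<beta>"
    proof
      fix l show "\<alpha> l = \<beta> l"
        using fun_cong[OF ab(3), of l] ab(1,2) by (cases "l < length b") (auto simp: exponents_def)
    qed
  qed
  have "?f ` exponents L \<subseteq> {..<length b} \<rightarrow>\<^sub>E {..L}"
  proof (rule image_subsetI)
    fix \<alpha> assume a: "\<alpha> \<in> exponents L"
    have "\<alpha> l \<le> L" if "l < length b" for l
    proof -
      have "\<alpha> l \<le> (\<Sum>l<length b. \<alpha> l)" by (rule member_le_sum) (use that in auto)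
      then show ?thesis using a by (simp add: exponents_def)
    qed
    then show "?f \<alpha> \<in> {..<length b} \<rightarrow>\<^sub>E {..L}" by auto
  qed
  moreover have fin: "finite ({..<length b} \<rightarrow>\<^sub>E {..L})" by (simp add: finite_PiE)
  moreover have "card ({..<length b} \<rightarrow>\<^sub>E {..L}) = (L + 1) ^ length b" by (simp add: card_PiE)
  ultimately show "finite (exponents L)" "card (exponents L) \<le> (L + 1) ^ length b"
    using inj finite_imageD[OF finite_subset inj] card_mono[OF fin] card_image[OF inj] by metis+
qed

lemma solution_poly_in_span: "solution_poly L f \<Longrightarrow> (\<lambda>n. of_int (f n)) \<in> fs.span (mono_seq ` exponents L)"
proof (induction rule: solution_poly.induct)
  case (const L c)
  have "(\<lambda>_. 0) \<in> exponents L" by (simp add: exponents_def)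
  then have "mono_seq (\<lambda>_. 0) \<in> fs.span (mono_seq ` exponents L)" by (intro fs.span_base) blast
  moreover have "mono_seq (\<lambda>_. 0) = (\<lambda>_. 1)" by (simp add: mono_seq_def[abs_def])
  ultimately have "(\<lambda>_. 1) \<in> fs.span (mono_seq ` exponents L)" by simp
  from fs.span_scale[OF this, of "of_int c"] show ?case by simp
next
  case (basis l L)
  define \<alpha> :: "nat \<Rightarrow> nat" where "\<alpha> i = of_bool (i = l)" for i
  have "(\<Sum>i<length b. \<alpha> i) = (\<Sum>i<length b. if i = l then 1 else 0)"
    by (rule sum.cong) (auto simp: \<alpha>_def)
  then have "\<alpha> \<in> exponents (Suc L)" using basis by (auto simp: exponents_def \<alpha>_def)
  moreover have "mono_seq \<alpha> = (\<lambda>n. of_int (basis_solution b l n))"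
  proof
    fix n
    have "mono_seq \<alpha> n = (\<Prod>i<length b. if i = l then of_int (basis_solution b l n) else 1)"
      unfolding mono_seq_def by (rule prod.cong) (auto simp: \<alpha>_def)
    then show "mono_seq \<alpha> n = of_int (basis_solution b l n)" using basis by simp
  qed
  ultimately show ?case by (metis fs.span_base image_eqI)
next
  case (add L f g)
  then show ?case using fs.span_add by (fastforce simp: plus_fun_def)
next
  case (mult L f M g)
  show ?case unfolding of_int_mult
  proof (rule span_times[OF mult.IH])
    fix x y assume "x \<in> mono_seq ` exponents L" "y \<in> mono_seq ` exponents M"
    then obtain \<alpha> \<beta> where ab: "\<alpha> \<in> exponents L" "x = mono_seq \<alpha>" "\<beta> \<in> exponents M" "y = mono_seq \<beta>"
      by blast
    have "(\<lambda>n. x n * y n) = mono_seq (\<lambda>l. \<alpha> l + \<beta> l)"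
      unfolding ab mono_seq_def by (simp add: power_add prod.distrib)
    moreover have "(\<lambda>l. \<alpha> l + \<beta> l) \<in> exponents (L + M)"
      using ab by (auto simp: exponents_def sum.distrib)
    ultimately show "(\<lambda>n. x n * y n) \<in> fs.span (mono_seq ` exponents (L + M))"
      by (metis fs.span_base image_eqI)
  qed
qed

definition on_class :: "nat \<Rightarrow> (nat \<Rightarrow> int) \<Rightarrow> nat \<Rightarrow> rat" where
  "on_class r f m = of_int (f (r + N * m))"

text \<open>Closed under sums and integer multiples only; \<open>fs.dim\<close> is the dimension of
  its rational span. Rational relations are made integral by
  \<open>common_denominator\<close>.\<close>

definition class_space :: "nat \<Rightarrow> nat \<Rightarrow> (nat \<Rightarrow> rat) set" where
  "class_space r L = {on_class r f | f. solution_poly L f}"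

lemma class_space_span:
  "class_space r L \<subseteq> fs.span ((\<lambda>\<alpha> m. mono_seq \<alpha> (r + N * m)) ` exponents L)"
proof
  fix x assume "x \<in> class_space r L"
  then obtain f where f: "solution_poly L f" "x = on_class r f" unfolding class_space_def by blast
  have "(\<lambda>m. y (r + N * m)) \<in> fs.span ((\<lambda>\<alpha> m. mono_seq \<alpha> (r + N * m)) ` exponents L)"
    if "y \<in> fs.span (mono_seq ` exponents L)" for y
    using that
  proof (induction rule: fs.span_induct_alt)
    case base
    then show ?case using fs.span_zero by (simp add: zero_fun_def)
  next
    case (step c z w)
    then obtain \<alpha> where "\<alpha> \<in> exponents L" "z = mono_seq \<alpha>" by blast
    then have "(\<lambda>m. z (r + N * m)) \<in> fs.span ((\<lambda>\<alpha> m. mono_seq \<alpha> (r + N * m)) ` exponents L)"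
      by (intro fs.span_base) blast
    from fs.span_add[OF fs.span_scale[OF this, of c] step(2)] show ?case by (simp add: plus_fun_def)
  qed
  from this[OF solution_poly_in_span[OF f(1)]] show "x \<in> fs.span ((\<lambda>\<alpha> m. mono_seq \<alpha> (r + N * m)) ` exponents L)"
    by (simp add: f(2) on_class_def[abs_def])
qed

lemma class_basis:
  obtains B where "finite B" "B \<subseteq> class_space r L" "fs.independent B" "class_space r L \<subseteq> fs.span B"
    "card B = fs.dim (class_space r L)" "card B \<le> (L + 1) ^ length b" "card B \<ge> 1"
proof -
  obtain B where B: "B \<subseteq> class_space r L" "fs.independent B" "class_space r L \<subseteq> fs.span B"
    "card B = fs.dim (class_space r L)"
    using fs.basis_exists by blast
  let ?T = "(\<lambda>\<alpha> m. mono_seq \<alpha> (r + N * m)) ` exponents L"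
  have T: "finite ?T" "card ?T \<le> (L + 1) ^ length b"
    by (rule finite_imageI[OF exponents_finite(1)])
      (rule order.trans[OF card_image_le[OF exponents_finite(1)] exponents_finite(2)])
  have "finite B \<and> card B \<le> card ?T"
    using fs.independent_span_bound[OF T(1) B(2)] B(1) class_space_span by blast
  moreover have "B \<noteq> {}"
  proof
    assume "B = {}"
    moreover have "on_class r (\<lambda>_. 1) \<in> class_space r L" unfolding class_space_def using solution_poly.const by blast
    ultimately have "on_class r (\<lambda>_. 1) = 0" using B(3) by auto
    then have "on_class r (\<lambda>_. 1) 0 = (0 :: nat \<Rightarrow> rat) 0" by (rule fun_cong)
    then show False by (simp add: on_class_def)
  qed
  ultimately have "finite B" "card B \<le> (L + 1) ^ length b" "card B \<ge> 1"
    using T(2) by (auto simp: Suc_le_eq card_gt_0_iff)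
  then show ?thesis using that[of B] B by blast
qed

lemma growth: "\<exists>M\<ge>1. fs.dim (class_space r (2 * N * M)) < M * fs.dim (class_space r M)"
proof (rule ccontr)
  define d where "d L = fs.dim (class_space r L)" for L
  have d: "d L \<ge> 1" "d L \<le> (L + 1) ^ length b" for L
    using class_basis[of r L] unfolding d_def by metis+
  assume "\<not> ?thesis"
  then have step: "M * d M \<le> d (2 * N * M)" if "M \<ge> 1" for M
    using that unfolding d_def by (simp add: not_less)
  define c where "c = 2 * N"
  have c2: "c \<ge> 2" using N1 by (simp add: c_def)
  \<comment> \<open>The step from \<open>c ^ i\<close> to \<open>c ^ (i + 1)\<close> multiplies the
    dimension by at least \<open>c ^ i\<close>, so the exponent grows quadratically in
    \<open>i\<close>, while the bound by the number of monomials allows only linear growth.\<close>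
  have lower: "c ^ (\<Sum>j<i. j) \<le> d (c ^ i)" for i
  proof (induction i)
    case 0
    then show ?case using d(1)[of 1] by simp
  next
    case (Suc i)
    have "c ^ (\<Sum>j<Suc i. j) = c ^ i * c ^ (\<Sum>j<i. j)" by (simp add: power_add mult.commute)
    also have "\<dots> \<le> c ^ i * d (c ^ i)" using Suc by simp
    also have "\<dots> \<le> d (2 * N * c ^ i)" using c2 by (intro step) simp
    finally show ?case by (simp add: c_def)
  qed
  define k where "k = length b"
  \<comment> \<open>Then the lower exponent is \<open>(k + 2) * (2 * k + 3)\<close>, which exceeds
    the upper exponent \<open>(i + 1) * k = (2 * k + 5) * k\<close>.\<close>
  define i where "i = 2 * k + 4"
  have "(\<Sum>j<i. j) = (k + 2) * (2 * k + 3)"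
  proof -
    have "2 * (\<Sum>j<i. j) = i * (i - 1)" for i :: nat
      by (induction i) (auto simp: algebra_simps)
    from this[of i] show ?thesis by (simp add: i_def algebra_simps)
  qed
  then have exp: "(i + 1) * k < (\<Sum>j<i. j)" by (simp add: i_def algebra_simps)
  have "c ^ (\<Sum>j<i. j) \<le> (c ^ i + 1) ^ k" using lower[of i] d(2)[of "c ^ i"] by (simp add: k_def)
  also have "\<dots> \<le> (c ^ (i + 1)) ^ k"
  proof (rule power_mono)
    have "c ^ i + 1 \<le> c ^ i + c ^ i" using c2 by simp
    also have "\<dots> = 2 * c ^ i" by simp
    also have "\<dots> \<le> c * c ^ i" using c2 by (rule mult_right_mono) simp
    finally show "c ^ i + 1 \<le> c ^ (i + 1)" by simp
  qed simp
  also have "\<dots> = c ^ ((i + 1) * k)" by (simp only: power_mult)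
  also have "\<dots> < c ^ (\<Sum>j<i. j)" using exp c2 by (intro power_strict_increasing) auto
  finally show False by simp
qed

text \<open>Restricted to one class, the polynomial functions therefore have no zero divisors. This
  permits cancellation in \<open>non_degenerate_multiple\<close>.\<close>

lemma solution_poly_zero_or_finite:
  assumes "solution_poly L f" "f (r + N * m0) \<noteq> 0" shows "finite {m. f (r + N * m) = 0}"
  using infinite_zeros_imp_zero[OF prime solution_poly_smooth[OF assms(1)], of r m0] assms(2) by blast

text \<open>A combination of shifts of this sequence is a smooth function restricted to the class of
  \<open>r\<close> modulo \<open>N\<close>, traversed completely. Zeros on any progression are
  infinitely many, so it vanishes identically.\<close>

lemma dense_progression_faithful:
  assumes g: "solution_poly L g" shows "progression_faithful (\<lambda>n. g (N * n + r))"
  unfolding progression_faithful_def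
proof (intro allI impI)
  fix c M n0 assume M: "1 \<le> M" and zero: "\<forall>j. act c (\<lambda>n. g (N * n + r)) (n0 + M * j) = 0"
  define g' where "g' n = (\<Sum>i\<le>degree c. coeff c i * g (n + N * i))" for n
  have act: "act c (\<lambda>n. g (N * n + r)) n = g' (r + N * n)" for n
    by (simp add: act_def g'_def algebra_simps)
  have sm: "smooth (int p ^ 2) N g'"
    unfolding g'_def[abs_def] by (intro smooth_sum smooth_cmult smooth_shift solution_poly_smooth[OF g])
  have "range (\<lambda>j. n0 + M * j) \<subseteq> {m. g' (r + N * m) = 0}" using zero by (auto simp: act)
  moreover have "infinite (range (\<lambda>j. n0 + M * j))"
    using M by (intro range_inj_infinite injI) simp
  ultimately have "infinite {m. g' (r + N * m) = 0}" using finite_subset by blast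
  then have "g' (r + N * n) = 0" for n by (rule infinite_zeros_imp_zero[OF prime sm])
  then show "eventually_zero (act c (\<lambda>n. g (N * n + r)))" by (simp add: act eventually_zero_def)
qed

text \<open>By \<open>growth\<close>, the products of a power of \<open>u\<close> with a basis
  element evaluated at \<open>N * n + s\<close> are more numerous than the dimension of a space
  containing them. This gives a nontrivial equation for \<open>u\<close> with coefficients
  \<open>W j\<close>, and cancelling the lowest power of \<open>u\<close> exhibits the lowest
  nonzero coefficient as a multiple of \<open>u\<close>.\<close>

theorem non_degenerate_multiple:
  assumes u: "satisfies_recurrence b (\<lambda>n. u (n + K))" "is_lrs u" and nz: "u (K + r + N * m0) \<noteq> 0"
  shows "\<exists>w t. is_lrs w \<and> is_lrs t \<and> non_degenerate w \<and> \<not> eventually_zero w \<and>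
    (\<forall>m. w (K + r + N * m) = u (K + r + N * m) * t (K + r + N * m))"
proof -
  obtain M where M: "M \<ge> 1" "fs.dim (class_space r (2 * N * M)) < M * fs.dim (class_space r M)"
    using growth by blast
  obtain B where B: "finite B" "B \<subseteq> class_space r M" "fs.independent B"
    "card B = fs.dim (class_space r M)"
    using class_basis[of r M] by metis
  obtain T where T: "finite T" "class_space r (2 * N * M) \<subseteq> fs.span T"
    "card T = fs.dim (class_space r (2 * N * M))"
    using class_basis[of r "2 * N * M"] by metis
  have "\<exists>f. solution_poly M f \<and> x = on_class r f" if "x \<in> B" for x
    using B(2) that unfolding class_space_def by blast
  then obtain rep where rep: "\<And>x. x \<in> B \<Longrightarrow> solution_poly M (rep x)" "\<And>x. x \<in> B \<Longrightarrow> x = on_class r (rep x)"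
    by metis
  \<comment> \<open>Only the shifted sequence satisfies the reversible recurrence \<open>b\<close>;
    the final multiple is stated for \<open>u\<close> itself.\<close>
  define v where "v n = u (n + K)" for n
  have v: "solution_poly 1 v" unfolding v_def by (rule solution_poly_solution[OF u(1)])
  \<comment> \<open>This makes \<open>g (N * n + s)\<close> the value of the sequence
    \<open>g (N * n + r)\<close> at the index \<open>n + K\<close>.\<close>
  define s where "s = N * K + r"
  define F where "F = (\<lambda>(j, x). on_class r (\<lambda>n. v n ^ j * rep x (N * n + s)))"
  define I where "I = {..<M} \<times> B"
  have "F i \<in> fs.span T" if iI: "i \<in> I" for i
  proof -
    obtain j x where i: "i = (j, x)" "j < M" "x \<in> B" using iI unfolding I_def by auto
    have "solution_poly (j * 1 + N * M) (\<lambda>n. v n ^ j * rep x (N * n + s))"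
      by (intro solution_poly.mult solution_poly_power solution_poly_progression v rep(1) i(3))
    moreover have "j * 1 + N * M \<le> 2 * N * M"
    proof -
      have "j \<le> N * M" using i(2) N1 by (metis le_trans less_imp_le mult_le_mono1 mult_1)
      moreover have "2 * N * M = N * M + N * M" by simp
      ultimately show ?thesis by linarith
    qed
    ultimately have "solution_poly (2 * N * M) (\<lambda>n. v n ^ j * rep x (N * n + s))" by (rule solution_poly_mono)
    then have "F i \<in> class_space r (2 * N * M)" unfolding i F_def class_space_def by auto
    then show ?thesis using T(2) by blast
  qed
  moreover have "finite I" "card T < card I"
    using M(2) B T by (simp_all add: I_def card_cartesian_product)
  ultimately obtain c0 where c0: "\<exists>i\<in>I. c0 i \<noteq> 0" "\<And>m. (\<Sum>i\<in>I. c0 i * F i m) = 0"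
    using family_dependent[of I T F] T(1) by blast
  obtain D c where D: "D > 0" and c: "\<forall>i\<in>I. of_int (c i) = of_int D * c0 i"
    using common_denominator[OF \<open>finite I\<close>] by blast
  define g where "g j n = (\<Sum>x\<in>B. c (j, x) * rep x n)" for j n
  have g: "solution_poly M (g j)" for j unfolding g_def by (intro solution_poly_sum solution_poly_cmult rep(1))
  define W where "W j n = g j (N * n + r)" for j n
  have W_shift: "W j (n + K) = g j (N * n + s)" for j n by (simp add: W_def s_def algebra_simps)
  have rel: "(\<Sum>j<M. v (r + N * m) ^ j * W j (r + N * m + K)) = 0" for m
  proof -
    have "(of_int (\<Sum>j<M. v (r + N * m) ^ j * W j (r + N * m + K)) :: rat) =
        (\<Sum>j<M. \<Sum>x\<in>B. of_int (c (j, x)) * F (j, x) m)"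
      unfolding W_shift g_def F_def on_class_def by (simp add: sum_distrib_left mult_ac)
    also have "\<dots> = (\<Sum>i\<in>I. of_int (c i) * F i m)"
      unfolding I_def sum.cartesian_product by (rule sum.cong) auto
    also have "\<dots> = of_int D * (\<Sum>i\<in>I. c0 i * F i m)"
      unfolding sum_distrib_left by (rule sum.cong) (use c in \<open>auto simp: mult.assoc\<close>)
    also have "\<dots> = 0" unfolding c0(2) by simp
    finally show ?thesis by (simp only: of_int_eq_0_iff)
  qed
  \<comment> \<open>The basis \<open>B\<close> is independent as a set of functions on the class of
    \<open>r\<close>, so a nontrivial combination is nonzero at some point of that class.\<close>
  have g_nz: "\<exists>m. g j (r + N * m) \<noteq> 0" if jx: "x \<in> B" "c (j, x) \<noteq> 0" for j x
  proof (rule ccontr)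
    assume zero: "\<not> ?thesis"
    have "(\<Sum>y\<in>B. (\<lambda>m. of_int (c (j, y)) * y m)) = 0"
    proof
      fix m
      have "(\<Sum>y\<in>B. (\<lambda>m. of_int (c (j, y)) * y m)) m = (\<Sum>y\<in>B. of_int (c (j, y)) * on_class r (rep y) m)"
        unfolding sum_fun_apply by (rule sum.cong) (use rep(2) in auto)
      also have "\<dots> = of_int (g j (r + N * m))" by (simp add: g_def on_class_def)
      also have "\<dots> = 0" using zero by simp
      finally show "(\<Sum>y\<in>B. (\<lambda>m. of_int (c (j, y)) * y m)) m = 0 m" by (simp add: zero_fun_def)
    qed
    then have "fs.dependent B"
      unfolding fs.dependent_finite[OF B(1)]
      by (intro exI[of _ "\<lambda>y. of_int (c (j, y))"] conjI bexI[of _ x]) (use jx in auto)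
    then show False using B(3) by simp
  qed
  define nonzero where "nonzero j \<longleftrightarrow> j < M \<and> (\<exists>m. g j (r + N * m) \<noteq> 0)" for j
  have "\<exists>j. nonzero j"
  proof -
    obtain j x where jx: "j < M" "x \<in> B" "c0 (j, x) \<noteq> 0" using c0(1) unfolding I_def by auto
    then have "(of_int (c (j, x)) :: rat) \<noteq> 0" using c D unfolding I_def by auto
    then have "c (j, x) \<noteq> 0" by simp
    then show ?thesis using g_nz[OF jx(2)] jx(1) unfolding nonzero_def by blast
  qed
  then obtain j0 where j0: "nonzero j0" "\<And>j. j < j0 \<Longrightarrow> \<not> nonzero j"
    using exists_least_iff[of nonzero] by blast
  have j0M: "j0 < M" using j0(1) unfolding nonzero_def by blast
  \<comment> \<open>The values of \<open>W j\<close> are exactly the values of \<open>g j\<close> on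
    the class of \<open>r\<close>.\<close>
  have W_low: "W j n = 0" if "j < j0" for j n
    using j0(2)[OF that] that j0M unfolding nonzero_def W_def by (simp add: add.commute)
  define t where "t n = - (\<Sum>j\<in>{j0<..<M}. u n ^ (j - j0 - 1) * W j n)" for n
  define X where "X n = g j0 (N * n + s) + (\<Sum>j\<in>{j0<..<M}. v n ^ (j - j0) * g j (N * n + s))" for n
  have X: "v (r + N * m) ^ j0 * X (r + N * m) = 0" for m
  proof -
    let ?n = "r + N * m"
    have "0 = (\<Sum>j\<in>{j0..<M}. v ?n ^ j * W j (?n + K))"
      unfolding rel[of m, symmetric] by (rule sum.mono_neutral_right) (use W_low in auto)
    also have "{j0..<M} = insert j0 {j0<..<M}" using j0M by auto
    also have "(\<Sum>j\<in>insert j0 {j0<..<M}. v ?n ^ j * W j (?n + K)) =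
        v ?n ^ j0 * W j0 (?n + K) + (\<Sum>j\<in>{j0<..<M}. v ?n ^ j * W j (?n + K))"
      by (subst sum.insert) auto
    also have "(\<Sum>j\<in>{j0<..<M}. v ?n ^ j * W j (?n + K)) =
        (\<Sum>j\<in>{j0<..<M}. v ?n ^ j0 * (v ?n ^ (j - j0) * W j (?n + K)))"
      by (rule sum.cong) (auto simp: mult.assoc[symmetric] power_add[symmetric])
    finally show ?thesis unfolding X_def W_shift by (simp add: distrib_left sum_distrib_left)
  qed
  obtain L where XL: "solution_poly L X"
  proof -
    let ?L = "M + N * M"
    have "solution_poly ?L (\<lambda>n. v n ^ (j - j0) * g j (N * n + s))" if "j < M" for j
    proof -
      have "solution_poly ((j - j0) * 1 + N * M) (\<lambda>n. v n ^ (j - j0) * g j (N * n + s))"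
        by (intro solution_poly.mult solution_poly_power solution_poly_progression v g)
      then show ?thesis by (rule solution_poly_mono) (use that in simp)
    qed
    moreover have "solution_poly ?L (\<lambda>n. g j0 (N * n + s))"
      by (rule solution_poly_mono[OF solution_poly_progression[OF g]]) simp
    ultimately have "solution_poly ?L X" unfolding X_def[abs_def] by (intro solution_poly.add solution_poly_sum) auto
    then show ?thesis using that by blast
  qed
  \<comment> \<open>Otherwise both \<open>X\<close> and \<open>v\<close> would have finitely many
    zeros on the class, although at each of its points one of them vanishes.\<close>
  have X0: "X (r + N * m) = 0" for m
  proof (rule ccontr)
    assume "X (r + N * m) \<noteq> 0"
    then have "finite {m. X (r + N * m) = 0}" by (rule solution_poly_zero_or_finite[OF XL])
    moreover have "finite {m. v (r + N * m) = 0}"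
      by (rule solution_poly_zero_or_finite[OF v, of r m0]) (use nz in \<open>simp add: v_def algebra_simps\<close>)
    moreover have "UNIV = {m. X (r + N * m) = 0} \<union> {m. v (r + N * m) = 0}" using X by auto
    ultimately show False by (metis finite_UnI infinite_UNIV_nat)
  qed
  have "W j0 (K + r + N * m) = u (K + r + N * m) * t (K + r + N * m)" for m
  proof -
    let ?n = "r + N * m"
    have "W j0 (?n + K) = - (\<Sum>j\<in>{j0<..<M}. v ?n ^ (j - j0) * W j (?n + K))"
      using X0[of m] unfolding X_def W_shift by simp
    also have "(\<Sum>j\<in>{j0<..<M}. v ?n ^ (j - j0) * W j (?n + K)) =
        v ?n * (\<Sum>j\<in>{j0<..<M}. v ?n ^ (j - j0 - 1) * W j (?n + K))"
      unfolding sum_distrib_left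
    proof (rule sum.cong, rule refl)
      fix j assume "j \<in> {j0<..<M}"
      then have "j - j0 = Suc (j - j0 - 1)" by auto
      then have "v ?n ^ (j - j0) = v ?n * v ?n ^ (j - j0 - 1)" by (metis power_Suc)
      then show "v ?n ^ (j - j0) * W j (?n + K) = v ?n * (v ?n ^ (j - j0 - 1) * W j (?n + K))"
        by (simp only: mult.assoc)
    qed
    finally have "W j0 (?n + K) = u (?n + K) * t (?n + K)" by (simp add: t_def v_def)
    moreover have "?n + K = K + r + N * m" by simp
    ultimately show ?thesis by (simp only:)
  qed
  moreover have lrsW: "is_lrs (W j)" for j
    unfolding W_def by (rule is_lrs_progression[OF solution_poly_lrs[OF g]])
  moreover have "is_lrs t"
  proof -
    have "is_lrs (\<lambda>n. (- 1) * (\<Sum>j\<in>{j0<..<M}. u n ^ (j - j0 - 1) * W j n))"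
      by (intro is_lrs_mult is_lrs_const is_lrs_sum is_lrs_power u(2) lrsW)
    then show ?thesis unfolding t_def[abs_def] by simp
  qed
  moreover have "non_degenerate (W j0)"
    unfolding non_degenerate_iff[OF lrsW] W_def by (rule dense_progression_faithful[OF g])
  moreover have "\<not> eventually_zero (W j0)"
  proof
    assume "eventually_zero (W j0)"
    then obtain k where k: "\<And>n. n \<ge> k \<Longrightarrow> W j0 n = 0" unfolding eventually_zero_def by blast
    have "{k..} \<subseteq> {m. g j0 (r + N * m) = 0}" using k by (auto simp: W_def add.commute)
    moreover obtain m where "g j0 (r + N * m) \<noteq> 0" using j0(1) unfolding nonzero_def by blast
    then have "finite {m. g j0 (r + N * m) = 0}" by (rule solution_poly_zero_or_finite[OF g])
    ultimately show False using infinite_Ici finite_subset by blast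
  qed
  ultimately show ?thesis by blast
qed

end

theorem non_degenerate_multiples:
  assumes "satisfies_recurrence a u"
  shows "\<exists>N\<ge>1. \<forall>r m0. u (length a + r + N * m0) \<noteq> 0 \<longrightarrow>
    (\<exists>w t. is_lrs w \<and> is_lrs t \<and> non_degenerate w \<and> \<not> eventually_zero w \<and>
      (\<forall>m. w (length a + r + N * m) = u (length a + r + N * m) * t (length a + r + N * m)))"
proof (cases "\<exists>i<length a. a ! i \<noteq> 0")
  case False
  then have "u (length a + r + 1 * m0) = 0" for r m0
    using tail_zero_of_zero_coefficients[OF assms, of "r + m0"] by (simp add: algebra_simps)
  then show ?thesis by (intro exI[of _ 1]) blast
next
  case True
  have ne: "a \<noteq> []" using assms by (simp add: satisfies_recurrence_def)
  obtain b where b: "reversible b" "length b \<le> length a" "\<And>i. i < length b \<Longrightarrow> b ! i = a ! i"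
    "satisfies_recurrence b (\<lambda>n. u (n + length a))"
    using reversible_part[OF ne True] assms by metis
  define h where "h = length b + nat (\<Sum>i<length b. \<bar>b ! i\<bar>)"
  have "\<bar>b ! i\<bar> \<le> int h" if "i < length b" for i
  proof -
    have "\<bar>b ! i\<bar> \<le> (\<Sum>i<length b. \<bar>b ! i\<bar>)" by (rule member_le_sum) (use that in auto)
    then show ?thesis unfolding h_def by simp
  qed
  then obtain p where p: "prime p" "\<And>w. satisfies_recurrence b w \<Longrightarrow> smooth (int p ^ 2) (period h) w"
    using reversible_smooth[OF b(1), of h] unfolding h_def by auto
  interpret smooth_solutions b p "period h"
    by unfold_locales (use b(1) p period_pos[of h] in \<open>auto simp: reversible_def Suc_le_eq\<close>)
  have "is_lrs u" using assms unfolding is_lrs_def by blast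
  then show ?thesis
    using non_degenerate_multiple[OF b(4)] N1 by blast
qed

section \<open>Counting large zeros\<close>

lemma height_le_iff:
  assumes "a \<noteq> []"
  shows "height a u \<le> int h \<longleftrightarrow> height_le a (map u [0..<length a]) h"
proof -
  let ?S = "{int (length a)} \<union> {\<bar>a ! i\<bar> | i. i < length a} \<union> {\<bar>u j\<bar> | j. j < length a}"
  have S: "?S = {int (length a)} \<union> (\<lambda>i. \<bar>a ! i\<bar>) ` {..<length a} \<union> (\<lambda>j. \<bar>u j\<bar>) ` {..<length a}"
    by auto
  have "finite ?S" unfolding S by simp
  then have "height a u \<le> int h \<longleftrightarrow> (\<forall>x\<in>?S. x \<le> int h)"
    unfolding height_def by (intro Max_le_iff) auto
  also have "\<dots> \<longleftrightarrow> height_le a (map u [0..<length a]) h"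
    unfolding height_le_def by (auto simp: nth_default_nth)
  finally show ?thesis .
qed

lemma height_ge_length: "int (length a) \<le> height a u"
proof -
  let ?S = "{int (length a)} \<union> {\<bar>a ! i\<bar> | i. i < length a} \<union> {\<bar>u j\<bar> | j. j < length a}"
  have S: "?S = {int (length a)} \<union> (\<lambda>i. \<bar>a ! i\<bar>) ` {..<length a} \<union> (\<lambda>j. \<bar>u j\<bar>) ` {..<length a}"
    by auto
  have "finite ?S" unfolding S by simp
  then show ?thesis unfolding height_def by (rule Max_ge) simp
qed

lemma infinite_nonzero_iff: "infinite {m. u m \<noteq> (0::int)} \<longleftrightarrow> \<not> eventually_zero u"
  unfolding eventually_zero_def infinite_nat_iff_unbounded_le by auto

text \<open>The inner exponential is an integer, so the threshold compares a power of
  \<open>e\<close> with a natural number.\<close>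

lemma exp_exp_threshold:
  assumes "h \<ge> 1" shows "exp (10 * real h * ln (real h)) = real (h ^ (10 * h))"
proof -
  have "exp (10 * real h * ln (real h)) = exp (real (10 * h) * ln (real h))" by simp
  also have "\<dots> = exp (ln (real h)) ^ (10 * h)" by (rule exp_of_nat_mult)
  finally show ?thesis using assms by simp
qed

definition beyond :: "nat \<Rightarrow> nat \<Rightarrow> bool" where
  "beyond h n \<longleftrightarrow> exp (real (h ^ (10 * h))) \<le> real n"

definition witness :: "nat \<Rightarrow> int list \<Rightarrow> (nat \<Rightarrow> int) \<Rightarrow> bool" where
  "witness h a u \<longleftrightarrow> satisfies_recurrence a u \<and> non_degenerate u \<and> \<not> eventually_zero u \<and>
     height_le a (map u [0..<length a]) h"

text \<open>The threshold increases with the height, so the exact height may be replaced by any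
  upper bound \<open>h\<close>.\<close>

lemma large_zeros_iff:
  "n \<in> large_zeros \<longleftrightarrow> (\<exists>h a u. h \<ge> 1 \<and> beyond h n \<and> witness h a u \<and> u n = 0)"
proof
  assume "n \<in> large_zeros"
  then obtain a u where au: "satisfies_recurrence a u" "non_degenerate u" "infinite {m. u m \<noteq> 0}" "u n = 0"
    "real n \<ge> exp (exp (10 * real_of_int (height a u) * ln (real_of_int (height a u))))"
    unfolding large_zeros_def by blast
  have ne: "a \<noteq> []" using au(1) by (simp add: satisfies_recurrence_def)
  define h where "h = nat (height a u)"
  have "height a u \<ge> 1" using height_ge_length[of a u] ne by (cases a) auto
  then have h: "h \<ge> 1" "height a u = int h" by (auto simp: h_def)
  have "beyond h n" using au(5) unfolding beyond_def h(2) of_int_of_nat_eq exp_exp_threshold[OF h(1)] .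
  moreover have "witness h a u"
    using au h(2) unfolding witness_def infinite_nonzero_iff height_le_iff[OF ne, symmetric] by simp
  ultimately show "\<exists>h a u. h \<ge> 1 \<and> beyond h n \<and> witness h a u \<and> u n = 0" using h(1) au(4) by blast
next
  assume "\<exists>h a u. h \<ge> 1 \<and> beyond h n \<and> witness h a u \<and> u n = 0"
  then obtain h a u where w: "h \<ge> 1" "beyond h n" "witness h a u" "u n = 0" by blast
  then have au: "satisfies_recurrence a u" "non_degenerate u" "infinite {m. u m \<noteq> 0}"
    "height_le a (map u [0..<length a]) h"
    unfolding witness_def infinite_nonzero_iff by auto
  have ne: "a \<noteq> []" using au(1) by (simp add: satisfies_recurrence_def)
  have H: "height a u \<le> int h" using au(4) height_le_iff[OF ne] by blast
  have H1: "1 \<le> height a u" using height_ge_length[of a u] ne by (cases a) auto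
  have "10 * real_of_int (height a u) * ln (real_of_int (height a u)) \<le> 10 * real h * ln (real h)"
  proof (intro mult_mono)
    show "real_of_int (height a u) \<le> real h" using H by linarith
    then show "ln (real_of_int (height a u)) \<le> ln (real h)" using H1 by simp
  qed (use H1 in auto)
  then have "exp (exp (10 * real_of_int (height a u) * ln (real_of_int (height a u)))) \<le>
      exp (exp (10 * real h * ln (real h)))" by simp
  also have "\<dots> \<le> real n" using w(2) unfolding beyond_def exp_exp_threshold[OF w(1)] .
  finally show "n \<in> large_zeros" unfolding large_zeros_def using au w(4) by blast
qed

text \<open>One step of the recurrence sums at most \<open>h\<close> terms with coefficients at most
  \<open>h\<close>, a factor of \<open>h ^ 2\<close>.\<close>

lemma recurrence_growth:
  assumes "satisfies_recurrence a u" "height_le a (map u [0..<length a]) h"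
  shows "\<bar>u n\<bar> \<le> int h ^ (2 * n + 1)"
proof (induction n rule: less_induct)
  case (less n)
  have k: "length a \<ge> 1" using assms(1) by (cases a) (auto simp: satisfies_recurrence_def)
  have kh: "length a \<le> h" and ah: "\<And>i. i < length a \<Longrightarrow> \<bar>a ! i\<bar> \<le> int h"
    and uh: "\<And>i. i < length a \<Longrightarrow> \<bar>u i\<bar> \<le> int h"
    using assms(2) by (auto simp: height_le_def nth_default_nth)
  have h1: "int h \<ge> 1" using k kh by simp
  show ?case
  proof (cases "n < length a")
    case True
    have "int h ^ 1 \<le> int h ^ (2 * n + 1)" using h1 by (intro power_increasing) auto
    then show ?thesis using uh[OF True] by simp
  next
    case False
    have "u (n - length a + length a) = (\<Sum>i<length a. a ! i * u (n - length a + length a - 1 - i))"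
      using assms(1) unfolding satisfies_recurrence_def by blast
    then have "u n = (\<Sum>i<length a. a ! i * u (n - 1 - i))" using False by simp
    then have "\<bar>u n\<bar> \<le> (\<Sum>i<length a. \<bar>a ! i * u (n - 1 - i)\<bar>)" by (simp only: sum_abs)
    also have "\<dots> \<le> (\<Sum>i<length a. int h * int h ^ (2 * (n - 1) + 1))"
    proof (rule sum_mono)
      fix i assume "i \<in> {..<length a}"
      then have i: "i < length a" by simp
      have "\<bar>u (n - 1 - i)\<bar> \<le> int h ^ (2 * (n - 1 - i) + 1)" using less[of "n - 1 - i"] False k by simp
      also have "\<dots> \<le> int h ^ (2 * (n - 1) + 1)" using h1 by (intro power_increasing) auto
      finally show "\<bar>a ! i * u (n - 1 - i)\<bar> \<le> int h * int h ^ (2 * (n - 1) + 1)"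
        unfolding abs_mult using ah[OF i] by (intro mult_mono) auto
    qed
    also have "\<dots> = int (length a) * (int h * int h ^ (2 * (n - 1) + 1))" by simp
    also have "\<dots> \<le> int h * (int h * int h ^ (2 * (n - 1) + 1))"
      using kh by (intro mult_right_mono) auto
    also have "\<dots> = int h ^ Suc (Suc (2 * (n - 1) + 1))" by simp
    also have "Suc (Suc (2 * (n - 1) + 1)) = 2 * n + 1" using False k by simp
    finally show ?thesis .
  qed
qed

text \<open>Some index at most \<open>h + period h + period h * h\<close> in the class carries a
  nonzero value. By \<open>recurrence_growth\<close> and \<open>h <= 2 ^ h\<close>, that value is at
  most \<open>2\<close> to this number, while every zero in the class contributes a prime
  factor.\<close>

definition class_bound :: "nat \<Rightarrow> nat" where
  "class_bound h = h * (2 * (h + period h + period h * h) + 1)"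

text \<open>The summand \<open>h\<close> accounts for the indices below the order, the other one for
  the classes.\<close>

definition zeros_bound :: "nat \<Rightarrow> nat" where
  "zeros_bound h = h + period h * class_bound h"

text \<open>Faithfulness excludes vanishing on the whole progression, and
  \<open>progression_zero\<close> then locates a nonzero value among the first terms, where its size
  is under control.\<close>

lemma witness_not_zero_on_class:
  assumes "witness h a u" "N \<ge> 1"
  shows "\<exists>m<length a. u (s + N * m) \<noteq> 0"
proof (rule ccontr)
  assume "\<not> ?thesis"
  then have "u (s + N * m) = 0" for m
    using progression_zero[of a u s N] assms(1) unfolding witness_def by blast
  then have "act 1 u (s + N * m) = 0" for m by (simp add: one_pCons act_const)
  moreover have "progression_faithful u"
    using assms(1) non_degenerate_imp_faithful unfolding witness_def by blast
  ultimately have "eventually_zero (act 1 u)" using assms(2) unfolding progression_faithful_def by blast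
  moreover have "act 1 u = u" by (auto simp: one_pCons act_const)
  ultimately show False using assms(1) unfolding witness_def by simp
qed

lemma class_zeros:
  assumes w: "witness h a u" and r: "r < period h"
  shows "finite {m. u (length a + r + period h * m) = 0} \<and>
    card {m. u (length a + r + period h * m) = 0} \<le> class_bound h"
proof (rule finite_if_finite_subsets_card_bdd)
  fix Z assume Z: "Z \<subseteq> {m. u (length a + r + period h * m) = 0}" "finite Z"
  let ?N = "period h"
  have a: "satisfies_recurrence a u" and ht: "height_le a (map u [0..<length a]) h"
    using w unfolding witness_def by auto
  have ne: "a \<noteq> []" using a by (simp add: satisfies_recurrence_def)
  have kh: "length a \<le> h" using ht by (simp add: height_le_def)
  obtain p where p: "prime p" "smooth (int p ^ 2) ?N (\<lambda>n. u (n + length a))"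
    using smooth_tail[OF ne ht] a by blast
  obtain m where m: "m < length a" "u (length a + r + ?N * m) \<noteq> 0"
    using witness_not_zero_on_class[OF w, of ?N "length a + r"] period_pos[of h] by (auto simp: Suc_le_eq)
  have "int p ^ card Z dvd u (r + ?N * m + length a)"
    by (rule zeros_power_dvd[OF p Z(2), of r m]) (use Z(1) in \<open>auto simp: algebra_simps\<close>)
  then have "int p ^ card Z dvd u (length a + r + ?N * m)" by (simp add: algebra_simps)
  then have "\<bar>int p ^ card Z\<bar> \<le> \<bar>u (length a + r + ?N * m)\<bar>" using m(2) by (rule dvd_imp_le_int[rotated])
  also have "\<dots> \<le> int h ^ (2 * (length a + r + ?N * m) + 1)" by (rule recurrence_growth[OF a ht])
  also have "\<dots> \<le> (2 ^ h) ^ (2 * (length a + r + ?N * m) + 1)"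
  proof (rule power_mono)
    have "h \<le> 2 ^ h" by simp
    then have "int h \<le> int (2 ^ h)" by (simp only: of_nat_le_iff)
    then show "int h \<le> 2 ^ h" by simp
  qed simp
  also have "\<dots> = 2 ^ (h * (2 * (length a + r + ?N * m) + 1))" by (simp only: power_mult)
  also have "\<dots> \<le> 2 ^ class_bound h"
  proof (rule power_increasing)
    have "?N * m \<le> ?N * h" using m(1) kh by (intro mult_le_mono2) simp
    then have "2 * (length a + r + ?N * m) + 1 \<le> 2 * (h + ?N + ?N * h) + 1"
      using kh r by (intro add_mono mult_le_mono2) auto
    then show "h * (2 * (length a + r + ?N * m) + 1) \<le> class_bound h"
      unfolding class_bound_def by (rule mult_le_mono2)
  qed simp
  finally have "int p ^ card Z \<le> 2 ^ class_bound h" by simp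
  moreover have "(2::int) ^ card Z \<le> int p ^ card Z"
    using prime_ge_2_nat[OF p(1)] by (intro power_mono) auto
  ultimately have "(2::int) ^ card Z \<le> 2 ^ class_bound h" by linarith
  then show "card Z \<le> class_bound h" by simp
qed

lemma witness_zeros:
  assumes "witness h a u"
  shows "finite {n. u n = 0}" "card {n. u n = 0} \<le> zeros_bound h"
proof -
  let ?N = "period h" and ?Z = "\<lambda>r. {m. u (length a + r + period h * m) = 0}"
  let ?U = "{..<length a} \<union> (\<Union>r<?N. (\<lambda>m. length a + r + ?N * m) ` ?Z r)"
  have sub: "{n. u n = 0} \<subseteq> ?U"
  proof
    fix n assume "n \<in> {n. u n = 0}"
    then have n: "u n = 0" by simp
    show "n \<in> ?U"
    proof (cases "n < length a")
      case False
      define r m where "r = (n - length a) mod ?N" and "m = (n - length a) div ?N"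
      have "n = length a + r + ?N * m" unfolding r_def m_def using False by (simp add: algebra_simps)
      moreover have "r < ?N" unfolding r_def by simp
      ultimately show ?thesis using n by blast
    qed simp
  qed
  have fin: "finite (?Z r)" "card (?Z r) \<le> class_bound h" if "r < ?N" for r
    using class_zeros[OF assms that] by auto
  have finU: "finite ?U" using fin(1) by auto
  then show "finite {n. u n = 0}" using sub finite_subset by blast
  have "card {n. u n = 0} \<le> card ?U" by (rule card_mono[OF finU sub])
  also have "\<dots> \<le> card {..<length a} + card (\<Union>r<?N. (\<lambda>m. length a + r + ?N * m) ` ?Z r)"
    by (rule card_Un_le)
  also have "card (\<Union>r<?N. (\<lambda>m. length a + r + ?N * m) ` ?Z r) \<le>
      (\<Sum>r<?N. card ((\<lambda>m. length a + r + ?N * m) ` ?Z r))"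
    by (rule card_UN_le) simp
  also have "\<dots> \<le> (\<Sum>r<?N. class_bound h)"
    by (rule sum_mono) (use fin card_image_le le_trans in blast)
  also have "\<dots> = ?N * class_bound h" by simp
  also have "card {..<length a} \<le> h" using assms by (simp add: witness_def height_le_def)
  finally show "card {n. u n = 0} \<le> zeros_bound h" by (simp add: zeros_bound_def)
qed

definition all_zeros :: "nat \<Rightarrow> nat set" where
  "all_zeros h = {n. \<exists>a u. witness h a u \<and> u n = 0}"

text \<open>The square bounds the number of pairs of integer lists of length at most
  \<open>h\<close> with entries between \<open>- h\<close> and \<open>h\<close>.\<close>

definition zeros_total :: "nat \<Rightarrow> nat" where
  "zeros_total h = ((h + 1) * (2 * h + 1) ^ h) ^ 2 * zeros_bound h"

lemma all_zeros_card: "finite (all_zeros h) \<and> card (all_zeros h) \<le> zeros_total h"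
proof -
  define A where "A = {xs :: int list. set xs \<subseteq> {- int h..int h} \<and> length xs \<le> h}"
  define T where "T = {(a, w). (a, w) \<in> A \<times> A \<and> witness h a (lrs a w)}"
  have finA: "finite A" unfolding A_def by (rule finite_lists_length_le) simp
  have "card A = (\<Sum>i\<le>h. (2 * h + 1) ^ i)"
  proof -
    have "card {- int h..int h} = 2 * h + 1" by (simp only: card_atLeastAtMost_int)
    then show ?thesis unfolding A_def by (subst card_lists_length_le) simp_all
  qed
  also have "\<dots> \<le> (\<Sum>i\<le>h. (2 * h + 1) ^ h)" by (intro sum_mono power_increasing) auto
  also have "\<dots> = (h + 1) * (2 * h + 1) ^ h" by simp
  finally have cardA: "card A \<le> (h + 1) * (2 * h + 1) ^ h" .
  have TA: "T \<subseteq> A \<times> A" unfolding T_def by auto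
  have finT: "finite T" using finite_subset[OF TA] finA by simp
  have "card T \<le> card (A \<times> A)" using TA finA by (intro card_mono) auto
  also have "\<dots> = card A * card A" by (rule card_cartesian_product)
  also have "\<dots> \<le> ((h + 1) * (2 * h + 1) ^ h) ^ 2"
    unfolding power2_eq_square by (intro mult_le_mono cardA)
  finally have cardT: "card T \<le> ((h + 1) * (2 * h + 1) ^ h) ^ 2" .
  have eq: "all_zeros h \<subseteq> (\<Union>(a, w)\<in>T. {n. lrs a w n = 0})"
  proof
    fix n assume "n \<in> all_zeros h"
    then obtain a u where au: "witness h a u" "u n = 0" unfolding all_zeros_def by blast
    let ?w = "map u [0..<length a]"
    have sat: "satisfies_recurrence a u" and ht: "height_le a ?w h"
      using au(1) unfolding witness_def by auto
    have len: "length a \<le> h" and ent: "\<And>i. i < length a \<Longrightarrow> \<bar>a ! i\<bar> \<le> int h"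
      "\<And>i. i < length a \<Longrightarrow> \<bar>u i\<bar> \<le> int h"
      using ht by (auto simp: height_le_def nth_default_nth)
    have "a \<in> A" using len ent(1) unfolding A_def by (force simp: in_set_conv_nth abs_le_iff)
    moreover have "?w \<in> A" using len ent(2) unfolding A_def by (force simp: abs_le_iff)
    ultimately have "(a, ?w) \<in> T" unfolding T_def using au(1) lrs_eq[OF sat] by simp
    moreover have "lrs a ?w n = 0" using au(2) lrs_eq[OF sat] by simp
    ultimately show "n \<in> (\<Union>(a, w)\<in>T. {n. lrs a w n = 0})" by blast
  qed
  have each: "finite (case x of (a, w) \<Rightarrow> {n. lrs a w n = 0})"
    "card (case x of (a, w) \<Rightarrow> {n. lrs a w n = 0}) \<le> zeros_bound h" if "x \<in> T" for x
    using that witness_zeros unfolding T_def by auto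
  have fin: "finite (\<Union>(a, w)\<in>T. {n. lrs a w n = 0})" using finT each(1) by (intro finite_UN_I) auto
  have "card (all_zeros h) \<le> card (\<Union>(a, w)\<in>T. {n. lrs a w n = 0})" by (rule card_mono[OF fin eq])
  also have "\<dots> \<le> (\<Sum>x\<in>T. card (case x of (a, w) \<Rightarrow> {n. lrs a w n = 0}))"
    by (rule card_UN_le[OF finT])
  also have "\<dots> \<le> (\<Sum>x\<in>T. zeros_bound h)" by (rule sum_mono) (rule each(2))
  also have "\<dots> = card T * zeros_bound h" by simp
  also have "\<dots> \<le> zeros_total h" unfolding zeros_total_def using cardT by (rule mult_le_mono1)
  finally show ?thesis using finite_subset[OF eq fin] by blast
qed

text \<open>The origin of the constant \<open>10\<close>. With \<open>T = (h + 1) ^ (2 * h)\<close>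
  the period is \<open>fact T <= T ^ T\<close>, so the total is at most
  \<open>T ^ (2 * T + 7)\<close> and its square at most \<open>exp (16 * T ^ 2)\<close>. Finally
  \<open>T ^ 2 <= h ^ (8 * h)\<close> and \<open>16 <= h ^ (2 * h)\<close>.\<close>

lemma zeros_total_bound:
  assumes h: "h \<ge> 2" shows "real (zeros_total h) ^ 2 \<le> exp (real (h ^ (10 * h)))"
proof -
  define T where "T = (h + 1) ^ (2 * h)"
  define N where "N = period h"
  have N: "N = fact T" by (simp add: N_def T_def period_def)
  \<comment> \<open>A lower bound for \<open>T\<close> that lets it absorb the numerical constants
    of the estimate.\<close>
  have "(3::nat) ^ 4 \<le> (h + 1) ^ 4" using h by (intro power_mono) auto
  also have "\<dots> \<le> T" unfolding T_def using h by (intro power_increasing) auto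
  finally have T81: "T \<ge> 81" by simp
  have hT: "h + 1 \<le> T"
    unfolding T_def using h power_increasing[of 1 "2 * h" "h + 1"] by simp
  have "(2 * h + 1) ^ h \<le> ((h + 1) ^ 2) ^ h"
    by (rule power_mono) (simp_all add: power2_eq_square)
  then have pT: "(2 * h + 1) ^ h \<le> T" by (simp add: T_def power_mult)
  have NT: "T \<le> N" unfolding N by (rule fact_ge_self)
  have N1: "N \<ge> 1" using NT T81 by simp
  have "class_bound h \<le> T * (2 * (T + N + N * T) + 1)"
    unfolding class_bound_def N_def[symmetric] using hT by (intro mult_le_mono add_mono) auto
  also have "\<dots> \<le> T * (2 * (N * T + N * T + N * T) + N * T)"
  proof -
    define P where "P = N * T"
    have "T \<le> P" "N \<le> P" "1 \<le> P" using N1 T81 by (auto simp: P_def)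
    then have "2 * (T + N + P) + 1 \<le> 2 * (P + P + P) + P"
      by (intro add_mono mult_le_mono2 order_refl)
    then show ?thesis unfolding P_def by (rule mult_le_mono2)
  qed
  finally have cb: "class_bound h \<le> 7 * N * T ^ 2" by (simp add: power2_eq_square algebra_simps)
  have "zeros_bound h \<le> N * (N * T ^ 2) + N * (7 * N * T ^ 2)"
  proof -
    have "T * 1 \<le> T * T" using T81 by (intro mult_le_mono2) simp
    moreover have "h \<le> T" using hT by simp
    ultimately have "h \<le> T ^ 2" unfolding power2_eq_square mult_1_right by (rule order.trans[rotated])
    also have "T ^ 2 \<le> N * (N * T ^ 2)"
      using mult_le_mono[OF N1 mult_le_mono[OF N1 order_refl[of "T ^ 2"]]] by simp
    finally show ?thesis
      unfolding zeros_bound_def N_def[symmetric] using cb by (intro add_mono mult_le_mono2)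
  qed
  then have zb: "zeros_bound h \<le> 8 * N ^ 2 * T ^ 2" by (simp add: power2_eq_square algebra_simps)
  have "zeros_total h \<le> (T * T) ^ 2 * (8 * N ^ 2 * T ^ 2)"
    unfolding zeros_total_def by (intro mult_le_mono power_mono zb hT pT) auto
  also have "\<dots> = 8 * N ^ 2 * (T ^ 2 * T ^ 2 * T ^ 2)" by (simp add: power_mult_distrib mult_ac)
  also have "T ^ 2 * T ^ 2 * T ^ 2 = T ^ 6" by (simp add: power_add[symmetric])
  also have "8 * N ^ 2 * T ^ 6 \<le> T * (T ^ T) ^ 2 * T ^ 6"
  proof (intro mult_le_mono power_mono)
    have "fact T \<le> (of_nat (T ^ T) :: nat)" by (rule fact_le_power)
    then show "N \<le> T ^ T" unfolding N by simp
  qed (use T81 in auto)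
  also have "\<dots> = T ^ 1 * T ^ (T * 2) * T ^ 6" by (simp only: power_mult power_one_right)
  also have "\<dots> = T ^ (1 + T * 2 + 6)" by (simp only: power_add)
  also have "1 + T * 2 + 6 = 2 * T + 7" by simp
  finally have zt: "zeros_total h \<le> T ^ (2 * T + 7)" .
  have "real T \<le> exp (real T)" using exp_ge_add_one_self[of "real T"] by linarith
  then have "real T ^ (2 * T + 7) \<le> exp (real T) ^ (2 * T + 7)" by (intro power_mono) auto
  also have "\<dots> = exp (real ((2 * T + 7) * T))" by (simp add: exp_of_nat_mult[symmetric] algebra_simps)
  finally have "real (zeros_total h) \<le> exp (real ((2 * T + 7) * T))"
    using zt by (metis of_nat_le_iff of_nat_power order_trans)
  then have "real (zeros_total h) ^ 2 \<le> exp (real ((2 * T + 7) * T)) ^ 2" by (intro power_mono) auto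
  also have "\<dots> = exp (real (2 * ((2 * T + 7) * T)))" by (simp add: exp_of_nat_mult[symmetric])
  also have "\<dots> \<le> exp (real (h ^ (10 * h)))"
  proof -
    have "2 * ((2 * T + 7) * T) \<le> 16 * T ^ 2"
    proof -
      have "2 * (2 * T + 7) \<le> 16 * T" using T81 by simp
      then have "2 * (2 * T + 7) * T \<le> 16 * T * T" by (rule mult_le_mono1)
      then show ?thesis by (simp add: power2_eq_square algebra_simps)
    qed
    also have "\<dots> \<le> h ^ (2 * h) * h ^ (8 * h)"
    proof (rule mult_le_mono)
      have "(2::nat) ^ 4 \<le> h ^ 4" using h by (rule power_mono) simp
      also have "\<dots> \<le> h ^ (2 * h)" using h by (intro power_increasing) auto
      finally show "16 \<le> h ^ (2 * h)" by simp
      have "h + 1 \<le> 2 * h" using h by simp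
      also have "\<dots> \<le> h * h" using h by (rule mult_le_mono1)
      finally have "h + 1 \<le> h ^ 2" by (simp only: power2_eq_square)
      then have "((h + 1) ^ (2 * h)) ^ 2 \<le> ((h ^ 2) ^ (2 * h)) ^ 2" by (intro power_mono) auto
      also have "\<dots> = h ^ (8 * h)" by (simp add: power_mult[symmetric])
      finally show "T ^ 2 \<le> h ^ (8 * h)" unfolding T_def .
    qed
    also have "\<dots> = h ^ (10 * h)" by (simp add: power_add[symmetric])
    finally show ?thesis by (simp only: exp_le_cancel_iff of_nat_le_iff)
  qed
  finally show ?thesis .
qed

lemma beyond_le: "beyond h n \<Longrightarrow> h \<le> n"
proof -
  assume "beyond h n"
  show "h \<le> n"
  proof (cases "h = 0")
    case False
    have "h ^ 1 \<le> h ^ (10 * h)" using False by (intro power_increasing) auto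
    then have "real h \<le> real (h ^ (10 * h))" by (simp only: power_one_right of_nat_le_iff)
    also have "\<dots> \<le> exp (real (h ^ (10 * h)))" using exp_ge_add_one_self[of "real (h ^ (10 * h))"] by linarith
    also have "\<dots> \<le> real n" using \<open>beyond h n\<close> unfolding beyond_def .
    finally show ?thesis by simp
  qed simp
qed

lemma witness_mono: "witness h a u \<Longrightarrow> h \<le> h' \<Longrightarrow> witness h' a u"
  unfolding witness_def height_le_def by force

text \<open>Let \<open>h\<close> be the largest height whose threshold is at most \<open>X\<close>.
  All large zeros up to \<open>X\<close> are zeros of witnesses of height at most \<open>h\<close>,
  and for \<open>h >= 2\<close> their number is at most the square root of the threshold, hence of
  \<open>X\<close>.\<close>

lemma large_zeros_sparse:
  obtains C :: nat where "\<And>X. (card (large_zeros \<inter> {1..X})) ^ 2 \<le> C * X"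
proof
  fix X
  \<comment> \<open>The first entry covers \<open>h = 1\<close>, where
    \<open>zeros_total_bound\<close> does not apply; the second covers
    \<open>h >= 2\<close>.\<close>
  let ?C = "max (zeros_total 1 ^ 2) 1"
  define H where "H = {h. h \<ge> 1 \<and> beyond h X}"
  have finH: "finite H" unfolding H_def by (rule finite_subset[of _ "{..X}"]) (auto dest: beyond_le)
  show "(card (large_zeros \<inter> {1..X})) ^ 2 \<le> ?C * X"
  proof (cases "H = {}")
    case True
    have "large_zeros \<inter> {1..X} = {}"
      using True unfolding H_def by (force simp: large_zeros_iff beyond_def)
    then show ?thesis by simp
  next
    case False
    define h where "h = Max H"
    have h: "h \<ge> 1" "beyond h X" using Max_in[OF finH False] unfolding h_def H_def by auto
    have "large_zeros \<inter> {1..X} \<subseteq> all_zeros h"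
    proof
      fix n assume n: "n \<in> large_zeros \<inter> {1..X}"
      then have "n \<in> large_zeros" by simp
      then obtain h' a u where w: "h' \<ge> 1" "beyond h' n" "witness h' a u" "u n = 0"
        unfolding large_zeros_iff by blast
      have "real n \<le> real X" using n by simp
      then have "beyond h' X" using w(2) unfolding beyond_def by linarith
      then have "h' \<le> h" unfolding h_def using w(1) finH by (intro Max_ge) (auto simp: H_def)
      then show "n \<in> all_zeros h" using witness_mono[OF w(3)] w(4) unfolding all_zeros_def by blast
    qed
    then have "card (large_zeros \<inter> {1..X}) \<le> card (all_zeros h)"
      using all_zeros_card by (intro card_mono) auto
    also have "\<dots> \<le> zeros_total h" using all_zeros_card by blast
    finally have le: "card (large_zeros \<inter> {1..X}) ^ 2 \<le> zeros_total h ^ 2" by (rule power_mono) simp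
    have X1: "X \<ge> 1" using beyond_le[OF h(2)] h(1) by simp
    show ?thesis
    proof (cases "h = 1")
      case True
      have "zeros_total 1 ^ 2 \<le> ?C * X" using X1 by (metis le_trans max.cobounded1 mult_le_mono2 nat_mult_1_right)
      with le show ?thesis unfolding True by (rule order.trans)
    next
      case False
      then have "real (zeros_total h) ^ 2 \<le> exp (real (h ^ (10 * h)))" using h(1) by (intro zeros_total_bound) simp
      also have "\<dots> \<le> real X" using h(2) unfolding beyond_def .
      finally have "zeros_total h ^ 2 \<le> X" by (metis of_nat_le_iff of_nat_power)
      also have "\<dots> \<le> ?C * X" by simp
      finally have "zeros_total h ^ 2 \<le> ?C * X" .
      with le show ?thesis by (rule order.trans)
    qed
  qed
qed

lemma density_one_complement: "density_one (UNIV - large_zeros)"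
proof -
  obtain C where C: "\<And>X. (card (large_zeros \<inter> {1..X})) ^ 2 \<le> C * X"
    using large_zeros_sparse by blast
  define L where "L X = card (large_zeros \<inter> {1..X})" for X
  have L: "real (L X) / real X \<le> sqrt (real C / real X)" for X
  proof (cases "X = 0")
    case False
    have "(real (L X) / real X) ^ 2 = real (L X ^ 2) / real X ^ 2" by (simp add: power_divide)
    also have "\<dots> \<le> real (C * X) / real X ^ 2"
      using C[of X] unfolding L_def by (intro divide_right_mono) (simp_all only: of_nat_le_iff zero_le_power2)
    also have "\<dots> = real C / real X" using False by (simp add: power2_eq_square)
    finally show ?thesis by (rule real_le_rsqrt)
  qed simp
  have "(\<lambda>X. sqrt (real C / real X)) \<longlonglongrightarrow> sqrt 0"
    by (rule tendsto_real_sqrt[OF lim_const_over_n])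
  then have "(\<lambda>X. sqrt (real C / real X)) \<longlonglongrightarrow> 0" by simp
  then have "(\<lambda>X. real (L X) / real X) \<longlonglongrightarrow> 0"
    by (rule tendsto_sandwich[OF _ _ tendsto_const, rotated 2]) (use L in auto)
  then have "(\<lambda>X. 1 - real (L X) / real X) \<longlonglongrightarrow> 1 - 0" by (rule tendsto_diff[OF tendsto_const])
  then have lim: "(\<lambda>X. 1 - real (L X) / real X) \<longlonglongrightarrow> 1" by simp
  have eq: "1 - real (L X) / real X = real (card ((UNIV - large_zeros) \<inter> {1..X})) / real X"
    if "X \<ge> 1" for X
  proof -
    have "(UNIV - large_zeros) \<inter> {1..X} = {1..X} - large_zeros \<inter> {1..X}" by auto
    then have "card ((UNIV - large_zeros) \<inter> {1..X}) = X - L X"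
      by (simp add: card_Diff_subset L_def)
    moreover have "L X \<le> X" unfolding L_def using card_mono[of "{1..X}" "large_zeros \<inter> {1..X}"] by simp
    ultimately show ?thesis using that by (simp add: of_nat_diff diff_divide_distrib)
  qed
  show ?thesis
    unfolding density_one_def
    by (rule Lim_transform_eventually[OF lim eventually_sequentiallyI[of 1]]) (rule eq)
qed

text \<open>A progression has a positive proportion of the numbers up to \<open>X\<close>, too many
  for a set of size at most \<open>sqrt (C * X)\<close>.\<close>

lemma progression_meets_complement:
  assumes "N \<ge> 1" shows "\<exists>m. s + N * m \<notin> large_zeros"
proof (rule ccontr)
  assume "\<not> ?thesis"
  then have all: "s + N * m \<in> large_zeros" for m by blast
  obtain C where C: "\<And>X. (card (large_zeros \<inter> {1..X})) ^ 2 \<le> C * X"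
    using large_zeros_sparse by blast
  \<comment> \<open>Just large enough that \<open>m ^ 2\<close> exceeds
    \<open>C * (s + N) * m\<close>, and so \<open>C * (s + N * m)\<close>.\<close>
  define m where "m = C * (s + N) + 1"
  have "(\<lambda>i. s + N * i) ` {1..m} \<subseteq> large_zeros \<inter> {1..s + N * m}"
    using all assms by (auto simp: Suc_le_eq)
  then have "card ((\<lambda>i. s + N * i) ` {1..m}) \<le> card (large_zeros \<inter> {1..s + N * m})"
    by (intro card_mono) auto
  moreover have "inj_on (\<lambda>i. s + N * i) {1..m}" using assms by (intro inj_onI) simp
  ultimately have "m \<le> card (large_zeros \<inter> {1..s + N * m})" by (simp add: card_image)
  then have "m ^ 2 \<le> card (large_zeros \<inter> {1..s + N * m}) ^ 2" by (rule power_mono) simp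
  also have "\<dots> \<le> C * (s + N * m)" by (rule C)
  also have "\<dots> \<le> C * ((s + N) * m)" by (intro mult_le_mono2) (simp add: m_def distrib_right)
  also have "\<dots> = (C * (s + N)) * m" by simp
  also have "\<dots> < m * m" by (rule mult_strict_right_mono) (simp_all add: m_def)
  finally show False by (simp add: power2_eq_square)
qed

section \<open>Deciding non-degeneracy\<close>

lemma computable_lrs [computable_intros]:
  assumes "computable f" "computable g" "computable k"
  shows "computable (\<lambda>x. lrs (f x) (g x) (k x))"
proof (rule computable_compose3[OF _ assms])
  show "computable (\<lambda>z. lrs (fst z) (fst (snd z)) (snd (snd z)))"
    unfolding lrs_def lrs_prefix_def by (intro computable_intros)
qed

text \<open>
  Exactly one of two certificates exists: one writes the evaluation of the shifts of \<open>lrs a w\<close> at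
  \<open>length a + l\<close> as a rational combination of the evaluations on a progression, the other is a
  combination of shifts that vanishes on the progression but not at \<open>length a + l\<close>.
\<close>

definition span_cert :: "int list \<times> int list \<times> nat \<times> nat \<Rightarrow> nat \<times> int list \<Rightarrow> bool" where
  "span_cert x y \<longleftrightarrow> (case x of (a, w, h, l) \<Rightarrow> case y of (D, T) \<Rightarrow>
     0 < D \<and> (\<forall>i<length a. int D * lrs a w (length a + l + i) =
       (\<Sum>j<length a. nth_default 0 T j * lrs a w (length a + period h * j + i))))"

definition functional_cert :: "int list \<times> int list \<times> nat \<times> nat \<Rightarrow> int list \<Rightarrow> bool" where
  "functional_cert x c \<longleftrightarrow> (case x of (a, w, h, l) \<Rightarrow>
     (\<forall>j<length a. (\<Sum>i<length a. nth_default 0 c i * lrs a w (length a + period h * j + i)) = 0) \<and>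
     (\<Sum>i<length a. nth_default 0 c i * lrs a w (length a + l + i)) \<noteq> 0)"

lemma computable_period [computable_intros]:
  assumes "computable f" shows "computable (\<lambda>x. period (f x))"
  unfolding period_def by (intro computable_intros assms)

lemma computable_span_cert: "computable (\<lambda>z. span_cert (fst z) (snd z))"
  unfolding span_cert_def case_prod_beta by (intro computable_intros)

lemma computable_functional_cert: "computable (\<lambda>z. functional_cert (fst z) (snd z))"
  unfolding functional_cert_def case_prod_beta by (intro computable_intros)

lemma nth_default_map_upt: "i < k \<Longrightarrow> nth_default 0 (map f [0..<k]) i = f i"
  by (simp add: nth_default_nth)

text \<open>The alternative \<open>span_or_functional\<close> over the rationals, with denominators
  cleared on both sides.\<close>

lemma cert_dichotomy: "(\<exists>y. span_cert x y) \<longleftrightarrow> \<not> (\<exists>c. functional_cert x c)"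
proof -
  obtain a w h l where x: "x = (a, w, h, l)" by (cases x) auto
  define t where "t i = lrs a w (length a + l + i)" for i
  define g where "g j i = lrs a w (length a + period h * j + i)" for j i
  let ?K = "{..<length a}"
  show ?thesis
  proof
    assume "\<exists>y. span_cert x y"
    then obtain D T where DT: "D > 0"
      "\<And>i. i < length a \<Longrightarrow> int D * t i = (\<Sum>j<length a. nth_default 0 T j * g j i)"
      unfolding span_cert_def x t_def g_def by auto
    show "\<not> (\<exists>c. functional_cert x c)"
    proof
      assume "\<exists>c. functional_cert x c"
      then obtain c where c: "\<And>j. j < length a \<Longrightarrow> (\<Sum>i<length a. nth_default 0 c i * g j i) = 0"
        "(\<Sum>i<length a. nth_default 0 c i * t i) \<noteq> 0"
        unfolding functional_cert_def x t_def g_def by auto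
      have "int D * (\<Sum>i<length a. nth_default 0 c i * t i) =
          (\<Sum>i<length a. nth_default 0 c i * (int D * t i))"
        by (simp add: sum_distrib_left mult.left_commute)
      also have "\<dots> = (\<Sum>i<length a. nth_default 0 c i * (\<Sum>j<length a. nth_default 0 T j * g j i))"
        by (rule sum.cong) (use DT(2) in auto)
      also have "\<dots> = (\<Sum>i<length a. \<Sum>j<length a. nth_default 0 T j * (nth_default 0 c i * g j i))"
        by (simp add: sum_distrib_left mult.left_commute)
      also have "\<dots> = (\<Sum>j<length a. nth_default 0 T j * (\<Sum>i<length a. nth_default 0 c i * g j i))"
        by (subst sum.swap) (simp add: sum_distrib_left)
      also have "\<dots> = 0" by (rule sum.neutral) (use c(1) in auto)
      finally show False using c(2) DT(1) by simp
    qed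
  next
    assume none: "\<not> (\<exists>c. functional_cert x c)"
    have "\<not> (\<exists>y. (\<forall>j<length a. (\<Sum>i\<in>?K. y i * (of_int (g j i) :: rat)) = 0) \<and>
        (\<Sum>i\<in>?K. y i * of_int (t i)) \<noteq> 0)"
    proof
      assume "\<exists>y. (\<forall>j<length a. (\<Sum>i\<in>?K. y i * (of_int (g j i) :: rat)) = 0) \<and>
        (\<Sum>i\<in>?K. y i * of_int (t i)) \<noteq> 0"
      then obtain y where y: "\<And>j. j < length a \<Longrightarrow> (\<Sum>i\<in>?K. y i * (of_int (g j i) :: rat)) = 0"
        "(\<Sum>i\<in>?K. y i * of_int (t i)) \<noteq> 0" by blast
      obtain D z where D: "D > 0" and z: "\<forall>i\<in>?K. of_int (z i) = of_int D * y i"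
        using common_denominator[of ?K y] by auto
      define c where "c = map z [0..<length a]"
      have c: "(of_int (\<Sum>i<length a. nth_default 0 c i * f i) :: rat) =
          of_int D * (\<Sum>i\<in>?K. y i * of_int (f i))" for f
      proof -
        have "(of_int (\<Sum>i<length a. nth_default 0 c i * f i) :: rat) =
            (\<Sum>i<length a. of_int D * (y i * of_int (f i)))"
          unfolding of_int_sum of_int_mult
          by (rule sum.cong) (use z in \<open>auto simp: c_def nth_default_map_upt\<close>)
        then show ?thesis by (simp only: sum_distrib_left)
      qed
      have "(\<Sum>i<length a. nth_default 0 c i * g j i) = 0" if "j < length a" for j
      proof -
        have "(of_int (\<Sum>i<length a. nth_default 0 c i * g j i) :: rat) = 0"
          unfolding c y(1)[OF that] by (rule mult_zero_right)
        then show ?thesis by (simp only: of_int_eq_0_iff)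
      qed
      moreover have "(of_int (\<Sum>i<length a. nth_default 0 c i * t i) :: rat) \<noteq> 0"
        unfolding c using y(2) D by (simp only: mult_eq_0_iff) simp
      then have "(\<Sum>i<length a. nth_default 0 c i * t i) \<noteq> 0"
        by (simp only: of_int_eq_0_iff not_False_eq_True)
      ultimately have "functional_cert x c"
        unfolding functional_cert_def x t_def g_def by simp
      then show False using none by blast
    qed
    then obtain d :: "nat \<Rightarrow> rat" where
      d: "\<forall>i\<in>?K. of_int (t i) = (\<Sum>j<length a. d j * of_int (g j i))"
      using span_or_functional[where I = ?K and t = "\<lambda>i. of_int (t i)" and r = "length a"
          and h = "\<lambda>j i. (of_int (g j i) :: rat)"] by blast
    obtain D z where D: "D > 0" and z: "\<forall>j\<in>?K. of_int (z j) = of_int D * d j"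
      using common_denominator[of ?K d] by auto
    have "D * t i = (\<Sum>j<length a. nth_default 0 (map z [0..<length a]) j * g j i)"
      if "i < length a" for i
    proof -
      have "(of_int (\<Sum>j<length a. nth_default 0 (map z [0..<length a]) j * g j i) :: rat) =
          (\<Sum>j<length a. of_int D * (d j * of_int (g j i)))"
        unfolding of_int_sum of_int_mult
        by (rule sum.cong) (use z in \<open>auto simp: nth_default_map_upt\<close>)
      also have "\<dots> = of_int D * of_int (t i)" using d that by (simp add: sum_distrib_left)
      finally have "(of_int (\<Sum>j<length a. nth_default 0 (map z [0..<length a]) j * g j i) :: rat) =
          of_int (D * t i)" by simp
      then show ?thesis by (simp only: of_int_eq_iff)
    qed
    then have "span_cert x (nat D, map z [0..<length a])"
      using D unfolding span_cert_def x t_def g_def by simp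
    then show "\<exists>y. span_cert x y" by blast
  qed
qed

lemma computable_ex_span_cert: "computable (\<lambda>x. \<exists>y. span_cert x y)"
  by (rule computable_decide[OF computable_span_cert computable_functional_cert cert_dichotomy])

text \<open>A functional certificate is a combination of shifts that contradicts faithfulness.
  Conversely, a combination vanishing on some progression vanishes on one modulo
  \<open>period h\<close> by the p-adic argument, and the span certificates carry these zeros to
  \<open>length a\<close> consecutive indices.\<close>

lemma non_degenerate_iff_cert:
  assumes a: "a \<noteq> []" and h: "height_le a w h"
  shows "non_degenerate (lrs a w) \<longleftrightarrow> (\<forall>l<length a. \<exists>y. span_cert (a, w, h, l) y)"
proof -
  let ?u = "lrs a w" and ?K = "length a" and ?N = "period h"
  have sat: "satisfies_recurrence a ?u" by (rule satisfies_recurrence_lrs[OF a])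
  have "is_lrs ?u" using sat unfolding is_lrs_def by blast
  then have nd: "non_degenerate ?u \<longleftrightarrow> progression_faithful ?u" by (rule non_degenerate_iff)
  show ?thesis unfolding nd
  proof
    assume faithful: "progression_faithful ?u"
    show "\<forall>l<?K. \<exists>y. span_cert (a, w, h, l) y"
    proof (intro allI impI, rule ccontr)
      fix l assume "l < ?K" "\<not> (\<exists>y. span_cert (a, w, h, l) y)"
      then obtain c where "functional_cert (a, w, h, l) c" using cert_dichotomy by blast
      then have c: "\<And>j. j < ?K \<Longrightarrow> (\<Sum>i<?K. nth_default 0 c i * ?u (?K + ?N * j + i)) = 0"
        "(\<Sum>i<?K. nth_default 0 c i * ?u (?K + l + i)) \<noteq> 0"
        unfolding functional_cert_def by auto
      define P where "P = poly_of ?K (nth_default 0 c)"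
      have P: "act P ?u n = (\<Sum>i<?K. nth_default 0 c i * ?u (n + i))" for n
        unfolding P_def by (rule act_poly_of)
      have satP: "satisfies_recurrence a (act P ?u)" by (rule recurrence_act[OF sat])
      have "act P ?u (?K + ?N * j) = 0" for j
        by (rule progression_zero[OF satP]) (simp add: P c(1))
      moreover have "?N \<ge> 1" by (simp add: Suc_le_eq)
      ultimately have "eventually_zero (act P ?u)"
        using faithful unfolding progression_faithful_def by blast
      then obtain m where "\<And>n. n \<ge> m \<Longrightarrow> act P ?u n = 0" unfolding eventually_zero_def by blast
      then have "act P ?u (?K + l) = 0" by (rule eventually_zero_from_order[OF satP _ le_add1])
      then show False using c(2) by (simp add: P)
    qed
  next
    assume cert: "\<forall>l<?K. \<exists>y. span_cert (a, w, h, l) y"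
    show "progression_faithful ?u"
      unfolding progression_faithful_def
    proof (intro allI impI)
      fix c M n0 assume M: "1 \<le> M" and zero: "\<forall>j. act c ?u (n0 + M * j) = 0"
      define v where "v = act c ?u"
      have satv: "satisfies_recurrence a v" unfolding v_def by (rule recurrence_act[OF sat])
      obtain p where p: "prime p" and sm: "smooth (int p ^ 2) ?N (\<lambda>n. v (n + ?K))"
        using smooth_tail[OF a h] satv by blast
      \<comment> \<open>The start \<open>n0\<close> is advanced by the multiple
        \<open>M * ?N * ?K\<close>, which stays in the given progression and leaves room for the
        shift by \<open>?K\<close> required by \<open>smooth_tail\<close>.\<close>
      have "?K \<le> M * ?N * ?K" using M period_pos[of h] by (simp add: Suc_le_eq)
      then obtain d where d: "M * ?N * ?K = ?K + d" using le_Suc_ex by blast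
      define s where "s = n0 + d"
      have vz: "v (s + ?N * (M * j) + ?K) = 0" for j
      proof -
        have "s + ?N * (M * j) + ?K = n0 + (?K + d) + ?N * (M * j)" by (simp add: s_def)
        also have "\<dots> = n0 + M * (?N * (?K + j))" unfolding d[symmetric] by (simp add: algebra_simps)
        finally show ?thesis using zero unfolding v_def by simp
      qed
      have "range (\<lambda>j. M * j) \<subseteq> {m. v (s + ?N * m + ?K) = 0}" using vz by auto
      moreover have "infinite (range (\<lambda>j. M * j))" using M by (intro range_inj_infinite injI) simp
      ultimately have "infinite {m. v (s + ?N * m + ?K) = 0}" using finite_subset by blast
      from infinite_zeros_imp_zero[OF p sm this] have vN: "v (s + ?N * m + ?K) = 0" for m .
      \<comment> \<open>A certificate is checked for \<open>i < ?K\<close> only, but both sides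
        solve the recurrence in \<open>i\<close>. The identity thus holds for all \<open>i\<close>,
        and the combination \<open>c\<close> can be applied to it at \<open>s\<close>.\<close>
      have vl: "v (s + ?K + l) = 0" if l: "l < ?K" for l
      proof -
        obtain D T where D: "D > 0" and T: "\<And>i. i < ?K \<Longrightarrow>
          int D * ?u (?K + l + i) = (\<Sum>j<?K. nth_default 0 T j * ?u (?K + ?N * j + i))"
          using cert l unfolding span_cert_def by auto
        have "satisfies_recurrence a (\<lambda>i. int D * ?u (?K + l + i))"
          using recurrence_shift'[OF sat, of "?K + l"] by (simp add: satisfies_recurrence_iff act_seq_smult)
        moreover have "satisfies_recurrence a (\<lambda>i. \<Sum>j<?K. nth_default 0 T j * ?u (?K + ?N * j + i))"
          by (rule recurrence_sum[OF a recurrence_shift'[OF sat]])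
        ultimately have "int D * ?u (?K + l + i) = (\<Sum>j<?K. nth_default 0 T j * ?u (?K + ?N * j + i))" for i
          using T by (rule solutions_eqI)
        then have "act c (\<lambda>i. int D * ?u (i + (?K + l))) s =
            act c (\<lambda>i. \<Sum>j<?K. nth_default 0 T j * ?u (i + (?K + ?N * j))) s"
          by (simp only: add.commute)
        then have "int D * v (s + (?K + l)) = (\<Sum>j<?K. nth_default 0 T j * v (s + (?K + ?N * j)))"
          unfolding act_seq_smult act_seq_sum act_shift v_def .
        also have "\<dots> = 0"
        proof (rule sum.neutral, rule ballI)
          fix j
          have "s + (?K + ?N * j) = s + ?N * j + ?K" by simp
          then show "nth_default 0 T j * v (s + (?K + ?N * j)) = 0" using vN[of j] by (simp only: mult_zero_right)
        qed
        finally show ?thesis using D by (simp add: add.assoc)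
      qed
      have "v (s + ?K + n) = 0" for n
        by (rule monic_recurrence_zero[of "characteristic_poly a" ?K "\<lambda>n. v (s + ?K + n)"])
          (use recurrence_shift'[OF satv, of "s + ?K"] vl in \<open>simp_all add: satisfies_recurrence_iff\<close>)
      then have "v n = 0" if "n \<ge> s + ?K" for n using that by (metis le_add_diff_inverse)
      then show "eventually_zero (act c ?u)" unfolding eventually_zero_def v_def by blast
    qed
  qed
qed

lemma eventually_zero_lrs_iff:
  assumes "a \<noteq> []"
  shows "eventually_zero (lrs a w) \<longleftrightarrow> (\<forall>i<length a. lrs a w (length a + i) = 0)"
proof
  have sat: "satisfies_recurrence a (lrs a w)" by (rule satisfies_recurrence_lrs[OF assms])
  show "\<forall>i<length a. lrs a w (length a + i) = 0" if "eventually_zero (lrs a w)"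
    using that eventually_zero_from_order[OF sat] unfolding eventually_zero_def by (metis le_add1)
  assume zero: "\<forall>i<length a. lrs a w (length a + i) = 0"
  have "lrs a w (length a + n) = 0" for n
    by (rule monic_recurrence_zero[of "characteristic_poly a" "length a" "\<lambda>n. lrs a w (length a + n)"])
      (use recurrence_shift'[OF sat, of "length a"] zero in \<open>simp_all add: satisfies_recurrence_iff\<close>)
  then show "eventually_zero (lrs a w)" unfolding eventually_zero_def by (metis le_add_diff_inverse)
qed

definition witness_code :: "nat \<Rightarrow> int list \<Rightarrow> int list \<Rightarrow> bool" where
  "witness_code h a w \<longleftrightarrow> a \<noteq> [] \<and> length w = length a \<and> height_le a w h \<and>
     (\<forall>l<length a. \<exists>y. span_cert (a, w, h, l) y) \<and> \<not> (\<forall>i<length a. lrs a w (length a + i) = 0)"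

lemma computable_height_le [computable_intros]:
  assumes "computable f" "computable g" "computable k"
  shows "computable (\<lambda>x. height_le (f x) (g x) (k x))"
  unfolding height_le_def
  by (intro computable_intros computable_compose[OF assms(1)] computable_compose[OF assms(2)]
      computable_compose[OF assms(3)])

lemma computable_witness_code [computable_intros]:
  assumes "computable f" "computable g" "computable k"
  shows "computable (\<lambda>x. witness_code (f x) (g x) (k x))"
proof (rule computable_compose3[OF _ assms])
  show "computable (\<lambda>z. witness_code (fst z) (fst (snd z)) (snd (snd z)))"
    unfolding witness_code_def
    by (intro computable_intros computable_compose[OF computable_ex_span_cert])
qed

lemma lrs_initial_values:
  "length w = length a \<Longrightarrow> map (lrs a w) [0..<length a] = w"
  by (rule nth_equalityI) (simp_all add: lrs_init nth_default_nth)

lemma witness_code_iff: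
  assumes "a \<noteq> []" "length w = length a"
  shows "witness_code h a w \<longleftrightarrow> witness h a (lrs a w)"
  using assms satisfies_recurrence_lrs[OF assms(1)] non_degenerate_iff_cert[OF assms(1)]
    eventually_zero_lrs_iff[OF assms(1)]
  unfolding witness_code_def witness_def lrs_initial_values[OF assms(2)] by blast

lemma witness_code_of_witness:
  assumes "witness h a u"
  shows "witness_code h a (map u [0..<length a])" "lrs a (map u [0..<length a]) = u"
proof -
  have sat: "satisfies_recurrence a u" using assms unfolding witness_def by blast
  then show eq: "lrs a (map u [0..<length a]) = u" by (rule lrs_eq)
  have "a \<noteq> []" using sat by (simp add: satisfies_recurrence_def)
  then show "witness_code h a (map u [0..<length a])" using assms eq by (subst witness_code_iff) auto
qed

section \<open>The set of large zeros is recursive\<close>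

text \<open>Rational bounds for \<open>e\<close>: with \<open>x = 1 + 1 / (j + 1)\<close>, it lies
  between \<open>x ^ (j + 1)\<close> and \<open>x ^ (j + 2)\<close>. Both follow from
  \<open>1 + y <= exp y\<close>, for \<open>y = 1 / (j + 1)\<close> and
  \<open>y = - 1 / (j + 2)\<close>.\<close>

lemma exp_bounds:
  fixes j q :: nat
  defines "x \<equiv> (real j + 2) / (real j + 1)"
  shows "x ^ ((j + 1) * q) \<le> exp (real q)" "exp (real q) \<le> x ^ ((j + 2) * q)"
proof -
  have "x \<le> exp (1 / (real j + 1))"
    using exp_ge_add_one_self[of "1 / (real j + 1)"] by (simp add: x_def field_simps)
  then have "x ^ ((j + 1) * q) \<le> exp (1 / (real j + 1)) ^ ((j + 1) * q)"
    by (rule power_mono) (simp add: x_def)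
  also have "\<dots> = exp (real ((j + 1) * q) * (1 / (real j + 1)))" by (rule exp_of_nat_mult[symmetric])
  also have "real ((j + 1) * q) * (1 / (real j + 1)) = real q" by (simp add: field_simps)
  finally show "x ^ ((j + 1) * q) \<le> exp (real q)" .
  have "1 / x \<le> exp (- (1 / (real j + 2)))"
    using exp_ge_add_one_self[of "- (1 / (real j + 2))"] by (simp add: x_def field_simps)
  then have "exp (1 / (real j + 2)) \<le> x"
    by (simp add: exp_minus x_def field_simps)
  then have "exp (1 / (real j + 2)) ^ ((j + 2) * q) \<le> x ^ ((j + 2) * q)" by (rule power_mono) simp
  moreover have "exp (1 / (real j + 2)) ^ ((j + 2) * q) = exp (real ((j + 2) * q) * (1 / (real j + 2)))"
    by (rule exp_of_nat_mult[symmetric])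
  moreover have "real ((j + 2) * q) * (1 / (real j + 2)) = real q" by (simp add: field_simps)
  ultimately show "exp (real q) \<le> x ^ ((j + 2) * q)" by simp
qed

lemma exp_bounds_tendsto:
  "(\<lambda>j. ((real j + 2) / (real j + 1)) ^ ((j + 1) * q)) \<longlonglongrightarrow> exp (real q)"
  "(\<lambda>j. ((real j + 2) / (real j + 1)) ^ ((j + 2) * q)) \<longlonglongrightarrow> exp (real q)"
proof -
  have base: "(\<lambda>j. (real j + 2) / (real j + 1)) \<longlonglongrightarrow> 1"
  proof -
    have "(\<lambda>j. 1 + 1 / real (Suc j)) \<longlonglongrightarrow> 1 + 0"
      by (intro tendsto_add tendsto_const LIMSEQ_Suc[OF lim_1_over_n])
    moreover have "1 + 1 / real (Suc j) = (real j + 2) / (real j + 1)" for j by (simp add: field_simps)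
    ultimately show ?thesis by simp
  qed
  have lim: "(\<lambda>j. ((real j + 2) / (real j + 1)) ^ (j + 1)) \<longlonglongrightarrow> exp 1"
  proof -
    have "(\<lambda>j. (1 + 1 / real (Suc j)) ^ Suc j) \<longlonglongrightarrow> exp 1"
      by (rule LIMSEQ_Suc[OF tendsto_exp_limit_sequentially])
    moreover have "1 + 1 / real (Suc j) = (real j + 2) / (real j + 1)" for j by (simp add: field_simps)
    ultimately show ?thesis by simp
  qed
  have e: "exp (real q) = exp 1 ^ q" using exp_of_nat_mult[of q "1::real"] by simp
  show "(\<lambda>j. ((real j + 2) / (real j + 1)) ^ ((j + 1) * q)) \<longlonglongrightarrow> exp (real q)"
    unfolding e power_mult by (intro tendsto_power lim)
  have "(\<lambda>j. ((real j + 2) / (real j + 1)) * ((real j + 2) / (real j + 1)) ^ (j + 1)) \<longlonglongrightarrow> 1 * exp 1"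
    by (intro tendsto_mult base lim)
  then have "(\<lambda>j. ((real j + 2) / (real j + 1)) ^ (j + 2)) \<longlonglongrightarrow> exp 1" by simp
  then show "(\<lambda>j. ((real j + 2) / (real j + 1)) ^ ((j + 2) * q)) \<longlonglongrightarrow> exp (real q)"
    unfolding e power_mult by (intro tendsto_power)
qed

text \<open>
  If some \<open>e\<^sup>M\<close> with \<open>M \<ge> 1\<close> were an integer \<open>k\<close>, then comparing \<open>e\<^sup>q\<close> with \<open>n\<close> would amount to
  comparing \<open>k\<^sup>q\<close> with \<open>n\<^sup>M\<close>. Otherwise equality never occurs and approximations decide.
\<close>

lemma computable_exp_le:
  assumes f: "computable f" and g: "computable g" and pos: "\<And>x. f x \<ge> 1"
  shows "computable (\<lambda>x. exp (real (f x)) \<le> real (g x))"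
proof (cases "\<exists>M k. M \<ge> 1 \<and> exp (real M) = real k")
  case True
  then obtain M k where M: "M \<ge> 1" and k: "exp (real M) = real k" by blast
  have "exp (real q) \<le> real n \<longleftrightarrow> k ^ q \<le> n ^ M" for q n
  proof -
    have "exp (real q) \<le> real n \<longleftrightarrow> exp (real q) ^ M \<le> real n ^ M"
      using M by (intro power_mono_iff[symmetric]) auto
    also have "exp (real q) ^ M = exp (real M) ^ q"
      by (simp only: exp_of_nat_mult[symmetric] mult.commute)
    also have "exp (real M) ^ q \<le> real n ^ M \<longleftrightarrow> real (k ^ q) \<le> real (n ^ M)" by (simp add: k)
    finally show ?thesis by (simp only: of_nat_le_iff)
  qed
  \<comment> \<open>\<open>M\<close> and \<open>k\<close> are constants of the program; the
    distinction between the two cases is made in the proof and not by the program.\<close>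
  then show ?thesis by (simp only:) (intro computable_intros f g)
next
  case False
  define P where "P x j \<longleftrightarrow> (j + 2) ^ ((j + 2) * f x) \<le> g x * (j + 1) ^ ((j + 2) * f x)" for x j
  define Q where "Q x j \<longleftrightarrow> g x * (j + 1) ^ ((j + 1) * f x) < (j + 2) ^ ((j + 1) * f x)" for x j
  let ?x = "\<lambda>j. (real j + 2) / (real j + 1)"
  have P: "P x j \<longleftrightarrow> ?x j ^ ((j + 2) * f x) \<le> real (g x)" for x j
  proof -
    have "P x j \<longleftrightarrow> real ((j + 2) ^ ((j + 2) * f x)) \<le> real (g x * (j + 1) ^ ((j + 2) * f x))"
      unfolding P_def by (simp only: of_nat_le_iff)
    also have "\<dots> \<longleftrightarrow> (real j + 2) ^ ((j + 2) * f x) \<le> real (g x) * (real j + 1) ^ ((j + 2) * f x)"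
      by (simp add: add.commute)
    also have "\<dots> \<longleftrightarrow> ?x j ^ ((j + 2) * f x) \<le> real (g x)"
      unfolding power_divide by (subst pos_divide_le_eq) auto
    finally show ?thesis .
  qed
  have Q: "Q x j \<longleftrightarrow> real (g x) < ?x j ^ ((j + 1) * f x)" for x j
  proof -
    have "Q x j \<longleftrightarrow> real (g x * (j + 1) ^ ((j + 1) * f x)) < real ((j + 2) ^ ((j + 1) * f x))"
      unfolding Q_def by (simp only: of_nat_less_iff)
    also have "\<dots> \<longleftrightarrow> real (g x) * (real j + 1) ^ ((j + 1) * f x) < (real j + 2) ^ ((j + 1) * f x)"
      by (simp add: add.commute)
    also have "\<dots> \<longleftrightarrow> real (g x) < ?x j ^ ((j + 1) * f x)"
      unfolding power_divide by (subst pos_less_divide_eq) auto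
    finally show ?thesis .
  qed
  have le: "(\<exists>j. P x j) \<longleftrightarrow> exp (real (f x)) \<le> real (g x)" for x
  proof
    assume "\<exists>j. P x j"
    then obtain j where "?x j ^ ((j + 2) * f x) \<le> real (g x)" unfolding P by blast
    then show "exp (real (f x)) \<le> real (g x)" using exp_bounds(2)[of "f x" j] by linarith
  next
    assume "exp (real (f x)) \<le> real (g x)"
    moreover have "exp (real (f x)) \<noteq> real (g x)" using False pos[of x] by blast
    ultimately have "exp (real (f x)) < real (g x)" by simp
    from order_tendstoD(2)[OF exp_bounds_tendsto(2) this]
    have "\<exists>j. ?x j ^ ((j + 2) * f x) < real (g x)" by (auto simp: eventually_sequentially)
    then obtain j where "?x j ^ ((j + 2) * f x) < real (g x)" by blast
    then show "\<exists>j. P x j" unfolding P by (intro exI[of _ j]) simp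
  qed
  have gt: "(\<exists>j. Q x j) \<longleftrightarrow> real (g x) < exp (real (f x))" for x
  proof
    assume "\<exists>j. Q x j"
    then obtain j where "real (g x) < ?x j ^ ((j + 1) * f x)" unfolding Q by blast
    then show "real (g x) < exp (real (f x))" using exp_bounds(1)[of j "f x"] by linarith
  next
    assume "real (g x) < exp (real (f x))"
    from order_tendstoD(1)[OF exp_bounds_tendsto(1) this]
    show "\<exists>j. Q x j" unfolding Q by (auto simp: eventually_sequentially)
  qed
  have "computable (\<lambda>x. \<exists>j. P x j)"
  proof (rule computable_decide)
    show "computable (\<lambda>z. P (fst z) (snd z))"
      unfolding P_def by (intro computable_intros computable_compose[OF f] computable_compose[OF g])
    show "computable (\<lambda>z. Q (fst z) (snd z))"
      unfolding Q_def by (intro computable_intros computable_compose[OF f] computable_compose[OF g])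
    show "(\<exists>j. P x j) \<longleftrightarrow> \<not> (\<exists>j. Q x j)" for x unfolding le gt by linarith
  qed
  then show ?thesis unfolding le .
qed

lemma computable_beyond [computable_intros]:
  assumes "computable f" "computable g" shows "computable (\<lambda>x. beyond (f x) (g x))"
proof -
  have pos: "h ^ (10 * h) \<ge> 1" for h :: nat by (cases h) auto
  show ?thesis unfolding beyond_def by (intro computable_exp_le computable_intros assms pos)
qed

lemma prod_encode_mono:
  assumes "m \<le> m'" "n \<le> n'" shows "prod_encode (m, n) \<le> prod_encode (m', n')"
proof -
  have "triangle (m + n) \<le> triangle (m' + n')"
    using assms by (intro monoD[OF strict_mono_mono[OF triangle_strict_mono]]) simp
  then show ?thesis using assms(1) by (simp add: prod_encode_def)
qed

text \<open>The code of a list of \<open>i\<close> entries, each with code \<open>2 * n + 1\<close>.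
  As pairing is monotone, it dominates all integer lists of at most \<open>i\<close> entries of
  absolute value at most \<open>n\<close>.\<close>

definition code_bound :: "nat \<Rightarrow> nat \<Rightarrow> nat" where
  "code_bound n i = rec_nat 0 (\<lambda>_ y. Suc (prod_encode (2 * n + 1, y))) i"

lemma code_le_code_bound:
  fixes xs :: "int list"
  shows "length xs \<le> i \<Longrightarrow> (\<And>x. x \<in> set xs \<Longrightarrow> \<bar>x\<bar> \<le> int n) \<Longrightarrow> code xs \<le> code_bound n i"
proof (induction xs arbitrary: i)
  case Nil
  then show ?case by (simp add: code_list_def)
next
  case (Cons x xs)
  then obtain i' where i: "i = Suc i'" "length xs \<le> i'" by (cases i) auto
  have "code x \<le> 2 * n + 1"
  proof -
    have "\<bar>x\<bar> \<le> int n" using Cons.prems(2)[of x] by simp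
    then have "nat x \<le> n" "nat (- x - 1) \<le> n" by arith+
    then show ?thesis
      by (cases "0 \<le> x") (simp_all add: code_int_def int_encode_nonneg int_encode_neg)
  qed
  moreover have "code xs \<le> code_bound n i'" using Cons.IH[OF i(2)] Cons.prems(2) by simp
  ultimately have "prod_encode (code x, code xs) \<le> prod_encode (2 * n + 1, code_bound n i')"
    by (rule prod_encode_mono)
  then show ?case unfolding i(1) by (simp add: code_list_def code_bound_def)
qed

lemma computable_code_bound [computable_intros]:
  assumes "computable f" "computable g" shows "computable (\<lambda>x. code_bound (f x) (g x))"
  unfolding code_bound_def
  by (intro computable_intros computable_computable2[OF computable2_prod_encode]
      computable_compose[OF assms(1)] assms(2))

text \<open>The threshold for height \<open>h\<close> is at least \<open>h\<close>, so
  \<open>n\<close> bounds the height, the order, the coefficients and the initial values. Membership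
  becomes a bounded search.\<close>

lemma large_zeros_bounded:
  "n \<in> large_zeros \<longleftrightarrow> (\<exists>h<Suc n. 1 \<le> h \<and> beyond h n \<and>
     (\<exists>y. code y < Suc (prod_encode (code_bound n n, code_bound n n)) \<and>
       witness_code h (fst y) (snd y) \<and> lrs (fst y) (snd y) n = 0))"
proof
  assume "n \<in> large_zeros"
  then obtain h a u where w: "h \<ge> 1" "beyond h n" "witness h a u" "u n = 0"
    unfolding large_zeros_iff by blast
  have hn: "h \<le> n" using beyond_le[OF w(2)] .
  let ?w = "map u [0..<length a]"
  have ht: "height_le a ?w h" using w(3) unfolding witness_def by blast
  have "code a \<le> code_bound n n"
  proof (rule code_le_code_bound)
    show "length a \<le> n" using ht hn by (simp add: height_le_def)
    fix x assume "x \<in> set a"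
    then have "\<bar>x\<bar> \<le> int h" using ht by (auto simp: height_le_def nth_default_nth in_set_conv_nth)
    then show "\<bar>x\<bar> \<le> int n" using hn by simp
  qed
  moreover have "code ?w \<le> code_bound n n"
  proof (rule code_le_code_bound)
    show "length ?w \<le> n" using ht hn by (simp add: height_le_def)
    fix x assume "x \<in> set ?w"
    then have "\<bar>x\<bar> \<le> int h" using ht by (auto simp: height_le_def nth_default_nth)
    then show "\<bar>x\<bar> \<le> int n" using hn by simp
  qed
  ultimately have "code (a, ?w) \<le> prod_encode (code_bound n n, code_bound n n)"
    unfolding code_prod_def fst_conv snd_conv by (rule prod_encode_mono)
  then show "\<exists>h<Suc n. 1 \<le> h \<and> beyond h n \<and>
     (\<exists>y. code y < Suc (prod_encode (code_bound n n, code_bound n n)) \<and>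
       witness_code h (fst y) (snd y) \<and> lrs (fst y) (snd y) n = 0)"
    using w hn witness_code_of_witness[OF w(3)]
    by (intro exI[of _ h] conjI exI[of _ "(a, ?w)"]) auto
next
  assume "\<exists>h<Suc n. 1 \<le> h \<and> beyond h n \<and>
     (\<exists>y. code y < Suc (prod_encode (code_bound n n, code_bound n n)) \<and>
       witness_code h (fst y) (snd y) \<and> lrs (fst y) (snd y) n = 0)"
  then obtain h a w where w: "1 \<le> h" "beyond h n" "witness_code h a w" "lrs a w n = 0" by auto
  have "a \<noteq> []" "length w = length a" using w(3) by (auto simp: witness_code_def)
  then have "witness h a (lrs a w)" using w(3) witness_code_iff by blast
  then show "n \<in> large_zeros" unfolding large_zeros_iff using w by blast
qed

lemma computable_large_zeros [computable_intros]:
  assumes "computable f" shows "computable (\<lambda>x. f x \<in> large_zeros)"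
proof (rule computable_compose[OF _ assms])
  show "computable (\<lambda>n. n \<in> large_zeros)"
    unfolding large_zeros_bounded
    by (intro computable_intros computable_ex_code_less computable_computable2[OF computable2_prod_encode])
qed

section \<open>The decision procedure\<close>

type_synonym cert = "(int list \<times> int list) \<times> (int list \<times> int list) \<times> nat"

text \<open>
  The certificate \<open>((b, w), (c, t), h)\<close> consists of a witness of height at most \<open>h\<close> with recurrence
  \<open>b\<close> and initial values \<open>w\<close>, and of the factor, given by \<open>c\<close> and \<open>t\<close>, that makes it a multiple of
  \<open>lrs a v\<close> on the class of \<open>s\<close>.
\<close>

definition class_cert :: "int list \<Rightarrow> int list \<Rightarrow> nat \<Rightarrow> nat \<Rightarrow> nat \<Rightarrow> cert \<Rightarrow> bool" where
  "class_cert a v B s N c \<longleftrightarrow>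
     witness_code (snd (snd c)) (fst (fst c)) (snd (fst c)) \<and> 1 \<le> snd (snd c) \<and> beyond (snd (snd c)) B \<and>
     0 < length (fst (fst (snd c))) \<and>
     (\<forall>m<length (fst (fst c)) + length a * length (fst (fst (snd c))).
        lrs (fst (fst c)) (snd (fst c)) (s + N * m) =
        lrs a v (s + N * m) * lrs (fst (fst (snd c))) (snd (fst (snd c))) (s + N * m))"

definition zero_cert :: "int list \<times> int list \<Rightarrow> nat \<Rightarrow> bool" where
  "zero_cert x n \<longleftrightarrow> \<not> n \<in> large_zeros \<and> lrs (fst x) (snd x) n = 0"

text \<open>\<open>fst y\<close> is the bound below which zeros are checked directly; the length of
  \<open>snd y\<close> serves as the modulus, one class certificate per residue, with residues
  counted from the order of the recurrence.\<close>

definition no_zero_cert :: "int list \<times> int list \<Rightarrow> nat \<times> cert list \<Rightarrow> bool" where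
  "no_zero_cert x y \<longleftrightarrow> 0 < length (fst x) \<and> 0 < length (snd y) \<and> length (fst x) \<le> fst y \<and>
     (\<forall>n<fst y. \<not> (\<not> n \<in> large_zeros \<and> lrs (fst x) (snd x) n = 0)) \<and>
     (\<forall>i<length (snd y). class_cert (fst x) (snd x) (fst y) (length (fst x) + i) (length (snd y))
       (nth_default (([], []), ([], []), 0) (snd y) i))"

lemma computable_zero_cert: "computable (\<lambda>z. zero_cert (fst z) (snd z))"
  unfolding zero_cert_def by (intro computable_intros)

lemma computable_no_zero_cert: "computable (\<lambda>z. no_zero_cert (fst z) (snd z))"
  unfolding no_zero_cert_def class_cert_def by (intro computable_intros)

lemma beyond_mono: "beyond h n \<Longrightarrow> n \<le> m \<Longrightarrow> beyond h m"
  unfolding beyond_def by (meson of_nat_le_iff order_trans)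

text \<open>A zero of the given sequence beyond the bound is a zero of the witness for its class,
  which makes it large. The finitely many checks in the certificate suffice by
  \<open>progression_product_eq\<close>.\<close>

lemma no_zero_cert_sound:
  assumes y: "no_zero_cert (a, v) y" and z: "zero_cert (a, v) n"
  shows False
proof -
  let ?u = "lrs a v" and ?K = "length a"
  obtain B cs where yB: "y = (B, cs)" by (cases y) auto
  let ?N = "length cs"
  have a: "a \<noteq> []" and N: "?N > 0" and KB: "?K \<le> B"
    and small: "\<And>n. n < B \<Longrightarrow> \<not> (n \<notin> large_zeros \<and> ?u n = 0)"
    and cert: "\<And>i. i < ?N \<Longrightarrow> class_cert a v B (?K + i) ?N (nth_default (([], []), ([], []), 0) cs i)"
    using y unfolding no_zero_cert_def yB by auto
  have n: "n \<notin> large_zeros" "?u n = 0" using z unfolding zero_cert_def by auto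
  then have nB: "n \<ge> B" using small[of n] by force
  define i m where "i = (n - ?K) mod ?N" and "m = (n - ?K) div ?N"
  have nim: "n = ?K + i + ?N * m" unfolding i_def m_def using nB KB by (simp add: algebra_simps)
  have "i < ?N" unfolding i_def using N by simp
  obtain b w c t h where c: "nth_default (([], []), ([], []), 0) cs i = ((b, w), (c, t), h)"
    by (metis surj_pair)
  have cc: "witness_code h b w" "1 \<le> h" "beyond h B" "c \<noteq> []"
    "\<And>m. m < length b + ?K * length c \<Longrightarrow>
      lrs b w (?K + i + ?N * m) = ?u (?K + i + ?N * m) * lrs c t (?K + i + ?N * m)"
    using cert[OF \<open>i < ?N\<close>] unfolding c class_cert_def by auto
  have b: "b \<noteq> []" "length w = length b" using cc(1) by (auto simp: witness_code_def)
  have wit: "witness h b (lrs b w)" using cc(1) witness_code_iff[OF b] by blast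
  have "lrs b w (?K + i + ?N * m) = ?u (?K + i + ?N * m) * lrs c t (?K + i + ?N * m)"
    by (rule progression_product_eq[OF satisfies_recurrence_lrs[OF a] satisfies_recurrence_lrs[OF b(1)]
          satisfies_recurrence_lrs[OF cc(4)] cc(5)])
  then have "lrs b w n = 0" using n(2) unfolding nim[symmetric] by simp
  then have "n \<in> large_zeros"
    unfolding large_zeros_iff using cc(2) beyond_mono[OF cc(3) nB] wit by blast
  then show False using n(1) by blast
qed

lemma no_zero_cert_complete:
  assumes none: "\<not> (\<exists>n. zero_cert (a, v) n)"
  shows "\<exists>y. no_zero_cert (a, v) y"
proof -
  let ?u = "lrs a v" and ?K = "length a"
  have nz: "n \<in> large_zeros \<or> ?u n \<noteq> 0" for n using none unfolding zero_cert_def by auto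
  \<comment> \<open>The search has to stop on every input. For the empty list \<open>lrs\<close> is
    identically zero, and a zero certificate exists because the large zeros omit some
    number.\<close>
  have a: "a \<noteq> []"
  proof
    assume "a = []"
    then have "?u n = 0" for n by (simp add: lrs_def lrs_prefix_def)
    then show False using nz progression_meets_complement[of 1 0] by auto
  qed
  have sat: "satisfies_recurrence a ?u" by (rule satisfies_recurrence_lrs[OF a])
  obtain N where N: "N \<ge> 1" and mult: "\<And>r m0. ?u (?K + r + N * m0) \<noteq> 0 \<Longrightarrow>
    \<exists>w t. is_lrs w \<and> is_lrs t \<and> non_degenerate w \<and> \<not> eventually_zero w \<and>
      (\<forall>m. w (?K + r + N * m) = ?u (?K + r + N * m) * t (?K + r + N * m))"
    using non_degenerate_multiples[OF sat] by metis
  have "\<exists>B c. class_cert a v B (?K + i) N c" for i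
  proof -
    \<comment> \<open>Each class contains an index that is not a large zero, and there the sequence
      is nonzero by assumption.\<close>
    obtain m0 where "?u (?K + i + N * m0) \<noteq> 0"
      using progression_meets_complement[OF N, of "?K + i"] nz by blast
    then obtain w t where wt: "is_lrs w" "is_lrs t" "non_degenerate w" "\<not> eventually_zero w"
      "\<And>m. w (?K + i + N * m) = ?u (?K + i + N * m) * t (?K + i + N * m)"
      using mult[of i m0] by blast
    obtain b c where b: "satisfies_recurrence b w" and c: "satisfies_recurrence c t"
      using wt(1,2) unfolding is_lrs_def by blast
    have ne: "b \<noteq> []" "c \<noteq> []" using b c by (auto simp: satisfies_recurrence_def)
    define h where "h = nat (height b w)"
    have "height b w \<ge> 1" using height_ge_length[of b w] ne by (cases b) auto
    then have h: "h \<ge> 1" "height b w = int h" by (auto simp: h_def)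
    have "witness h b w"
      using b wt(3,4) h(2) height_le_iff[OF ne(1), of w h] unfolding witness_def by simp
    note code = witness_code_of_witness[OF this]
    obtain B where "exp (real (h ^ (10 * h))) \<le> real B" using real_arch_simple by blast
    then have "beyond h B" unfolding beyond_def .
    then have "class_cert a v B (?K + i) N ((b, map w [0..<length b]), (c, map t [0..<length c]), h)"
      unfolding class_cert_def using code h(1) ne(2) lrs_eq[OF c] wt(5) by simp
    then show ?thesis by blast
  qed
  then obtain Bf cf where cert: "\<And>i. class_cert a v (Bf i) (?K + i) N (cf i)" by metis
  \<comment> \<open>A common bound for all classes: it is at least each \<open>Bf i\<close>, which
    suffices since \<open>beyond\<close> is monotone in its second argument.\<close>
  define B where "B = ?K + (\<Sum>i<N. Bf i)"
  define cs where "cs = map cf [0..<N]"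
  have "class_cert a v B (?K + i) (length cs) (nth_default (([], []), ([], []), 0) cs i)"
    if "i < length cs" for i
  proof -
    have i: "i < N" using that by (simp add: cs_def)
    then have "Bf i \<le> (\<Sum>i<N. Bf i)" by (intro member_le_sum) auto
    then have "Bf i \<le> B" by (simp add: B_def)
    then have "class_cert a v B (?K + i) N (cf i)"
      using cert[of i] beyond_mono unfolding class_cert_def by blast
    then show ?thesis using i by (simp add: cs_def nth_default_nth)
  qed
  then have "no_zero_cert (a, v) (B, cs)"
    unfolding no_zero_cert_def using a N nz by (auto simp: B_def cs_def)
  then show ?thesis by blast
qed

lemma computable_has_zero: "computable (\<lambda>x. \<exists>n. zero_cert x n)"
proof (rule computable_decide[OF computable_zero_cert computable_no_zero_cert])
  fix x show "(\<exists>n. zero_cert x n) \<longleftrightarrow> \<not> (\<exists>y. no_zero_cert x y)"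
    using no_zero_cert_sound no_zero_cert_complete by (cases x) blast
qed

theorem corollary5p2:
  "universal_skolem_set (UNIV - large_zeros) \<and> density_one (UNIV - large_zeros)"
proof
  show "density_one (UNIV - large_zeros)" by (rule density_one_complement)
  have "infinite (UNIV - large_zeros)"
    unfolding infinite_nat_iff_unbounded_le
  proof
    fix s
    obtain m where "s + 1 * m \<notin> large_zeros" using progression_meets_complement[of 1 s] by auto
    then show "\<exists>n\<ge>s. n \<in> UNIV - large_zeros" by (intro exI[of _ "s + 1 * m"]) simp
  qed
  moreover have "recursive_set (UNIV - large_zeros)"
    by (rule recursive_setI) (simp, intro computable_intros)
  moreover have "\<exists>p. \<forall>a u. satisfies_recurrence a u \<longrightarrow>
      computes p [encode_ints a, encode_ints (map u [0..<length a])]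
        (of_bool (\<exists>n\<in>UNIV - large_zeros. u n = 0))"
  proof -
    obtain p where p: "\<And>a v. computes p [encode_ints a, encode_ints v]
        (of_bool (\<exists>n. zero_cert (a, v) n))"
      using computable_on_encode_ints[of "\<lambda>a v. \<exists>n. zero_cert (a, v) n"] computable_has_zero by auto
    have eq: "(\<exists>n. zero_cert (a, map u [0..<length a]) n) \<longleftrightarrow> (\<exists>n\<in>UNIV - large_zeros. u n = 0)"
      if "satisfies_recurrence a u" for a u
      by (auto simp: zero_cert_def lrs_eq[OF that])
    show ?thesis
    proof (rule exI[of _ p], intro allI impI)
      fix a u assume sat: "satisfies_recurrence a u"
      show "computes p [encode_ints a, encode_ints (map u [0..<length a])]
          (of_bool (\<exists>n\<in>UNIV - large_zeros. u n = 0))"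
        using p[of a "map u [0..<length a]"] unfolding eq[OF sat] .
    qed
  qed
  ultimately show "universal_skolem_set (UNIV - large_zeros)"
    unfolding universal_skolem_set_def by blast
qed

end
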